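(* Let $D$ be a bounded domain in $\mathbb{C}^n$ with smooth boundary, and let $1\leq q\leq n-1$. Suppose that for every function $\varphi$ of the form $$\varphi(z)=a\|z-z_0\|^2-b,\qquad a,b>0,\ z_0\in\mathbb{C}^n,$$ and for every $\bar\partial$-closed form $f\in\wedge^{0,q}(\bar D)\cap\mathrm{Dom}(\bar\partial^*_{\varphi})$, there exists $u\in L^2_{(0,q-1)}(D,\varphi)$ with $\bar\partial u=f$ on $D$ and $$\int_D|u|^2e^{-\varphi}\,d\lambda\ \leq\ \int_D\langle \mathrm{Levi}_{\varphi}^{-1}f,f\rangle e^{-\varphi}\,d\lambda\ =\ \frac{1}{aq}\int_D|f|^2e^{-\varphi}\,d\lambda .$$ Then $D$ is hyper-$q$-convex.
   Context: Notation. $\|\cdot\|$ is the Euclidean norm on $\mathbb{C}^n$ and $d\lambda$ is Lebesgue measure. $\wedge^{0,q}(\bar D)$ is the space of $(0,q)$-forms $\alpha=\sum'_{|I|=q}\alpha_I\,d\bar z_I$ (sum over strictly increasing multi-indices $I$) whose coefficients are smooth up to the boundary; $\alpha_I$ is extended to all multi-indices by skew-symmetry. The pointwise inner product is $\langle\alpha,\beta\rangle=\sum'_I\alpha_I\overline{\beta_I}$, and $|\alpha|^2=\langle\alpha,\alpha\rangle$. $L^2_{(0,q)}(D,\varphi)$ is the Hilbert space of $(0,q)$-forms on $D$ with inner product $\int_D\langle\alpha,\beta\rangle e^{-\varphi}d\lambda$. The operator $\bar\partial:L^2_{(0,q-1)}(D,\varphi)\to L^2_{(0,q)}(D,\varphi)$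 is the closed, densely defined operator acting in the sense of distributions, and $\bar\partial^*_\varphi$ is its Hilbert space adjoint, with domain $\mathrm{Dom}(\bar\partial^*_\varphi)$. For $\alpha\in\wedge^{0,q}(\bar D)$ one has $\alpha\in\mathrm{Dom}(\bar\partial^*_\varphi)$ if and only if $\sum_{i=1}^n\frac{\partial\rho}{\partial z_i}\alpha_{iK}=0$ on $\partial D$ for all $|K|=q-1$, where $\rho$ is a smooth defining function of $D$ as below (a condition independent of $\varphi$). For a smooth real function $\varphi$, $\mathrm{Levi}_\varphi$ is the Hermitian operator on $(0,q)$-forms determined by $\langle\mathrm{Levi}_\varphi\alpha,\alpha\rangle=\sum_{i,j}\sum'_{|K|=q-1}\frac{\partial^2\varphi}{\partial z_i\partial\bar z_j}\alpha_{iK}\overline{\alpha_{jK}}$; for $\varphi=a\|z-z_0\|^2-b$ it is multiplication by $aq$. Hyper-$q$-convexity. Let $\rho:\mathbb{C}^n\to\mathbb{R}$ be smooth with $D=\{\rho<0\}$, $\nabla\rho\neq0$ on $\partial D$, normalized so that $|\nabla\rho|=1$ on $\partial D$. For $p\in\partial D$ let $T^{1,0}_p\partial D=\{\xi\in\mathbb{C}^n:\sum_i\frac{\partial\rho}{\partial z_i}(p)\xi_i=0\}$, with the Hermitian inner product induced from $\mathbb{C}^n$. The Levi form at $p$ is the restriction to $T^{1,0}_p\partial D$ of $\xi\mapsto\sum_{i,j}\frac{\partial^2\rho}{\partial z_i\partial\bar z_j}(p)\xi_i\bar\xi_j$. $D$ is hyper-$q$-convex if at every $p\in\partial D$ the sum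 of any $q$ eigenvalues (counted with multiplicity) of the Levi form on $T^{1,0}_p\partial D$ is non-negative. *)

theory Defs
  imports "HOL-Analysis.Analysis"
begin

type_synonym 'n cspace = "complex ^ 'n"

section \<open>Smooth functions and Wirtinger derivatives\<close>

primrec continuously_differentiable ::
  "nat \<Rightarrow> ('a::real_normed_vector \<Rightarrow> 'b::real_normed_vector) \<Rightarrow> bool" where
  "continuously_differentiable 0 f \<longleftrightarrow> continuous_on UNIV f"
| "continuously_differentiable (Suc k) f \<longleftrightarrow>
     (\<forall>x. f differentiable (at x)) \<and>
     (\<forall>v. continuously_differentiable k (\<lambda>x. frechet_derivative f (at x) v))"

definition smooth :: "('a::real_normed_vector \<Rightarrow> 'b::real_normed_vector) \<Rightarrow> bool" where
  "smooth f \<longleftrightarrow> (\<forall>k. continuously_differentiable k f)"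

definition dz :: "'n \<Rightarrow> ('n::finite cspace \<Rightarrow> complex) \<Rightarrow> 'n cspace \<Rightarrow> complex" where
  "dz i g p = (frechet_derivative g (at p) (axis i 1) - \<i> * frechet_derivative g (at p) (axis i \<i>)) / 2"

definition dzbar :: "'n \<Rightarrow> ('n::finite cspace \<Rightarrow> complex) \<Rightarrow> 'n cspace \<Rightarrow> complex" where
  "dzbar i g p = (frechet_derivative g (at p) (axis i 1) + \<i> * frechet_derivative g (at p) (axis i \<i>)) / 2"

definition complex_hessian ::
  "('n::finite cspace \<Rightarrow> real) \<Rightarrow> 'n cspace \<Rightarrow> 'n \<Rightarrow> 'n \<Rightarrow> complex" where
  "complex_hessian \<phi> p i j = dz i (dzbar j (\<lambda>z. complex_of_real (\<phi> z))) p"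

definition quadratic_weight :: "real \<Rightarrow> real \<Rightarrow> 'n::finite cspace \<Rightarrow> 'n cspace \<Rightarrow> real" where
  "quadratic_weight a b z\<^sub>0 z = a * (norm (z - z\<^sub>0))\<^sup>2 - b"


section \<open>Forms of type (0,q)\<close>

text \<open>
  The value at a point of a (0,q)-form is the family of all its coefficients, indexed by arbitrary
  multi-indices (lists of length q) and skew-symmetric in them. Off the lists of length q the family
  is required to vanish, so that a covector is determined by its coefficients on the strictly
  increasing multi-indices. A form is a function from points to such families. The order on the
  index type only serves to pick out the strictly increasing multi-indices.
\<close>

definition covectors :: "nat \<Rightarrow> ('n list \<Rightarrow> complex) set" where
  "covectors q = {\<alpha>. (\<forall>I. length I \<noteq> q \<longrightarrow> \<alpha> I = 0) \<and>
     (\<forall>I j k. length I = q \<longrightarrow> j < k \<longrightarrow> k < q \<longrightarrow> \<alpha> (I[j := I ! k, k := I ! j]) = - \<alpha> I)}"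

definition multi_indices :: "nat \<Rightarrow> 'n::linorder list set" where
  "multi_indices q = {I. length I = q \<and> sorted_wrt (<) I}"

definition form_inner ::
  "nat \<Rightarrow> ('n::{finite,linorder} list \<Rightarrow> complex) \<Rightarrow> ('n list \<Rightarrow> complex) \<Rightarrow> complex" where
  "form_inner q \<alpha> \<beta> = (\<Sum>I\<in>multi_indices q. \<alpha> I * cnj (\<beta> I))"

definition form_normsq :: "nat \<Rightarrow> ('n::{finite,linorder} list \<Rightarrow> complex) \<Rightarrow> real" where
  "form_normsq q \<alpha> = Re (form_inner q \<alpha> \<alpha>)"

type_synonym 'n form = "'n cspace \<Rightarrow> 'n list \<Rightarrow> complex"

text \<open>
  Smoothness up to the boundary means that each coefficient is the restriction to the closure of a
  smooth function on the whole space.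
\<close>

definition smooth_forms :: "'n::finite cspace set \<Rightarrow> nat \<Rightarrow> 'n form set" where
  "smooth_forms D q = {\<alpha>. (\<forall>z\<in>closure D. \<alpha> z \<in> covectors q) \<and>
     (\<forall>I. length I = q \<longrightarrow> (\<exists>g. smooth g \<and> (\<forall>z\<in>closure D. g z = \<alpha> z I)))}"

text \<open>Elements of the weighted Hilbert space are represented by functions, not by classes of functions.\<close>

definition L2_forms ::
  "'n::{finite,linorder} cspace set \<Rightarrow> ('n cspace \<Rightarrow> real) \<Rightarrow> nat \<Rightarrow> 'n form set" where
  "L2_forms D \<phi> q = {\<alpha>. (\<forall>z\<in>D. \<alpha> z \<in> covectors q) \<and>
     (\<forall>I\<in>multi_indices q. (\<lambda>z. \<alpha> z I) \<in> borel_measurable (lebesgue_on D) \<and>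
        integrable (lebesgue_on D) (\<lambda>z. (cmod (\<alpha> z I))\<^sup>2 * exp (- \<phi> z)))}"

definition L2_inner ::
  "'n::{finite,linorder} cspace set \<Rightarrow> ('n cspace \<Rightarrow> real) \<Rightarrow> nat \<Rightarrow> 'n form \<Rightarrow> 'n form \<Rightarrow> complex"
  where
  "L2_inner D \<phi> q \<alpha> \<beta> =
     (LINT z|lebesgue_on D. form_inner q (\<alpha> z) (\<beta> z) * complex_of_real (exp (- \<phi> z)))"


section \<open>The Cauchy-Riemann operator and its adjoint\<close>

definition test_function :: "'n::finite cspace set \<Rightarrow> ('n cspace \<Rightarrow> complex) \<Rightarrow> bool" where
  "test_function D \<psi> \<longleftrightarrow> smooth \<psi> \<and> (\<exists>K. compact K \<and> K \<subseteq> D \<and> (\<forall>z. z \<notin> K \<longrightarrow> \<psi> z = 0))"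

definition delete_nth :: "nat \<Rightarrow> 'a list \<Rightarrow> 'a list" where
  "delete_nth k J = take k J @ drop (Suc k) J"

text \<open>
  For u of type (0,q) and v of type (0,q+1), this is the equation dbar u = v on D in the sense of
  distributions. It comes from integrating by parts in
  v_J = (sum over k of (-1)^k times the derivative of u_{J without j_k} in the conjugate of z_{j_k}),
  the coefficient formula for dbar u = (sum over j and increasing I of
  (du_I / dzbar_j) dzbar_j wedge dzbar_I).
\<close>

definition dbar_eq ::
  "'n::{finite,linorder} cspace set \<Rightarrow> nat \<Rightarrow> 'n form \<Rightarrow> 'n form \<Rightarrow> bool" where
  "dbar_eq D q u v \<longleftrightarrow> (\<forall>\<psi>. test_function D \<psi> \<longrightarrow> (\<forall>J\<in>multi_indices (Suc q).
     (LINT z|lebesgue_on D. v z J * \<psi> z) =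
     - (\<Sum>k<Suc q. (-1) ^ k * (LINT z|lebesgue_on D. u z (delete_nth k J) * dzbar (J ! k) \<psi> z))))"

definition dbar_closed :: "'n::{finite,linorder} cspace set \<Rightarrow> nat \<Rightarrow> 'n form \<Rightarrow> bool" where
  "dbar_closed D q f \<longleftrightarrow> dbar_eq D q f (\<lambda>z I. 0)"

text \<open>
  The domain of the Hilbert space adjoint of the maximal closed operator from (0,q)-forms to
  (0,q+1)-forms; the elements of the domain are thus (0,q+1)-forms.
\<close>

definition dbar_adjoint_dom ::
  "'n::{finite,linorder} cspace set \<Rightarrow> ('n cspace \<Rightarrow> real) \<Rightarrow> nat \<Rightarrow> 'n form set" where
  "dbar_adjoint_dom D \<phi> q = {\<alpha> \<in> L2_forms D \<phi> (Suc q). \<exists>\<beta> \<in> L2_forms D \<phi> q.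
     \<forall>u \<in> L2_forms D \<phi> q. \<forall>v \<in> L2_forms D \<phi> (Suc q). dbar_eq D q u v \<longrightarrow>
       L2_inner D \<phi> (Suc q) v \<alpha> = L2_inner D \<phi> q u \<beta>}"


section \<open>The Levi operator on forms\<close>

text \<open>
  For a Hermitian matrix H, the coefficient formula for the operator determined by the quadratic
  form in \<open>levi_op_inner\<close> below.
\<close>

definition levi_op :: "('n \<Rightarrow> 'n \<Rightarrow> complex) \<Rightarrow> ('n::finite list \<Rightarrow> complex) \<Rightarrow> 'n list \<Rightarrow> complex" where
  "levi_op H \<alpha> J = (\<Sum>k<length J. \<Sum>i\<in>UNIV. H i (J ! k) * \<alpha> (J[k := i]))"

definition Levi :: "('n::finite cspace \<Rightarrow> real) \<Rightarrow> 'n form \<Rightarrow> 'n form" where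
  "Levi \<phi> \<alpha> z = levi_op (complex_hessian \<phi> z) (\<alpha> z)"

definition Levi_inv :: "('n::finite cspace \<Rightarrow> real) \<Rightarrow> nat \<Rightarrow> 'n form \<Rightarrow> 'n form" where
  "Levi_inv \<phi> q \<alpha> z = inv_into (covectors q) (levi_op (complex_hessian \<phi> z)) (\<alpha> z)"

lemma covectors_length: "\<alpha> \<in> covectors q \<Longrightarrow> length I \<noteq> q \<Longrightarrow> \<alpha> I = 0"
  by (simp add: covectors_def)

lemma covectors_swap:
  assumes "\<alpha> \<in> covectors q"
  shows "\<alpha> (xs @ x # y # zs) = - \<alpha> (xs @ y # x # zs)"
proof (cases "length (xs @ x # y # zs) = q")
  case True
  have "\<forall>I j k. length I = q \<longrightarrow> j < k \<longrightarrow> k < q \<longrightarrow> \<alpha> (I[j := I ! k, k := I ! j]) = - \<alpha> I"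
    using assms by (simp add: covectors_def)
  from this[rule_format, of "xs @ y # x # zs" "length xs" "Suc (length xs)"] True
  show ?thesis by (simp add: list_update_append nth_append)
next
  case False
  then show ?thesis using covectors_length[OF assms] by simp
qed

lemma covectors_move:
  assumes "\<alpha> \<in> covectors q"
  shows "\<alpha> (xs @ i # ys) = (-1) ^ length xs * \<alpha> (i # xs @ ys)"
proof (induction xs arbitrary: ys rule: rev_induct)
  case Nil
  then show ?case by simp
next
  case (snoc x xs)
  then show ?case using covectors_swap[OF assms, of xs x i ys] snoc[of "x # ys"] by simp
qed

lemma covectors_repeated:
  assumes "\<alpha> \<in> covectors q" "j \<in> set K"
  shows "\<alpha> (j # K) = 0"
proof -
  obtain xs ys where K: "K = xs @ j # ys" using assms(2) by (meson split_list)
  have 1: "\<alpha> ((j # xs) @ j # ys) = (-1) ^ length (j # xs) * \<alpha> (j # (j # xs) @ ys)"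
    by (rule covectors_move[OF assms(1)])
  have "\<alpha> ([] @ j # j # xs @ ys) = - \<alpha> ([] @ j # j # xs @ ys)"
    by (rule covectors_swap[OF assms(1)])
  then have "\<alpha> (j # j # xs @ ys) = 0" by simp
  with 1 K show ?thesis by simp
qed

lemma levi_op_inner:
  fixes \<alpha> \<beta> :: "'n::{finite,linorder} list \<Rightarrow> complex"
  assumes a: "\<alpha> \<in> covectors (Suc q)" and b: "\<beta> \<in> covectors (Suc q)"
  shows "form_inner (Suc q) (levi_op H \<alpha>) \<beta> =
    (\<Sum>i\<in>UNIV. \<Sum>j\<in>UNIV. \<Sum>K\<in>multi_indices q. H i j * \<alpha> (i # K) * cnj (\<beta> (j # K)))"
proof -
  define F where "F = (\<lambda>(K, j). \<Sum>i\<in>UNIV. H i j * \<alpha> (i # K) * cnj (\<beta> (j # K)))"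
  have fin: "finite (multi_indices r :: 'n list set)" for r
    by (rule finite_subset[OF _ finite_lists_length_eq[of UNIV r]]) (auto simp: multi_indices_def)
  define S where "S = (multi_indices (Suc q) :: 'n list set) \<times> {..<Suc q}"
  define T where "T = {(K, j). K \<in> (multi_indices q :: 'n list set) \<and> j \<notin> set K}"
  have split: "J = take k J @ J ! k # drop (Suc k) J" if "k < length J" for J :: "'n list" and k
    using that by (simp add: id_take_nth_drop)
  have sorted: "sorted_wrt (<) (delete_nth k J)" "set (delete_nth k J) = set J - {J ! k}"
      "length (delete_nth k J) = q" "J ! k \<notin> set (delete_nth k J)" "distinct J" "sorted J"
      "J ! k \<in> set J"
    if "(J, k) \<in> S" for J k
  proof -
    have k: "k < length J" and s: "sorted_wrt (<) J" and l: "length J = Suc q"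
      using that by (auto simp: S_def multi_indices_def)
    show d: "distinct J" and "sorted J" using s by (auto simp: strict_sorted_iff)
    have "sorted_wrt (<) (take k J @ J ! k # drop (Suc k) J)" using s split[OF k] by simp
    then show "sorted_wrt (<) (delete_nth k J)"
      unfolding delete_nth_def sorted_wrt_append by auto
    have d': "distinct (take k J @ J ! k # drop (Suc k) J)" using d split[OF k] by simp
    have "set J = set (take k J @ J ! k # drop (Suc k) J)" using split[OF k] by simp
    with d' show "set (delete_nth k J) = set J - {J ! k}"
      unfolding delete_nth_def by auto
    then show "J ! k \<notin> set (delete_nth k J)" by simp
    show "length (delete_nth k J) = q" using k l by (simp add: delete_nth_def)
    show "J ! k \<in> set J" using k by simp
  qed
  have bij: "bij_betw (\<lambda>(J, k). (delete_nth k J, J ! k)) S T"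
  proof (rule bij_betwI')
    fix x y assume x: "x \<in> S" and y: "y \<in> S"
    obtain J k where xx: "x = (J, k)" by (cases x)
    obtain J' k' where yy: "y = (J', k')" by (cases y)
    note sx = sorted[OF x[unfolded xx]] and sy = sorted[OF y[unfolded yy]]
    show "((case x of (J, k) \<Rightarrow> (delete_nth k J, J ! k)) =
        (case y of (J, k) \<Rightarrow> (delete_nth k J, J ! k))) = (x = y)"
    proof
      assume "(case x of (J, k) \<Rightarrow> (delete_nth k J, J ! k)) =
        (case y of (J, k) \<Rightarrow> (delete_nth k J, J ! k))"
      then have e: "delete_nth k J = delete_nth k' J'" "J ! k = J' ! k'" using xx yy by auto
      have "set J = set J'" using sx(2,7) sy(2,7) e by auto
      then have "J = J'" using sx(5,6) sy(5,6) sorted_distinct_set_unique by blast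
      moreover have "k = k'" using e(2) \<open>J = J'\<close> sx(5) x y xx yy
        by (auto simp: S_def multi_indices_def nth_eq_iff_index_eq)
      ultimately show "x = y" using xx yy by simp
    qed simp
  next
    fix x assume x: "x \<in> S"
    obtain J k where xx: "x = (J, k)" by (cases x)
    show "(case x of (J, k) \<Rightarrow> (delete_nth k J, J ! k)) \<in> T"
      using sorted[OF x[unfolded xx]] xx by (auto simp: T_def multi_indices_def)
  next
    fix y assume y: "y \<in> T"
    obtain K j where yy: "y = (K, j)" by (cases y)
    have K: "sorted_wrt (<) K" "length K = q" "j \<notin> set K"
      using y yy by (auto simp: T_def multi_indices_def)
    define J where "J = insort j K"
    have J: "sorted_wrt (<) J" "length J = Suc q" "set J = insert j (set K)"
      using K by (auto simp: J_def strict_sorted_iff set_insort_key sorted_insort distinct_insort)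
    obtain k where k: "k < length J" "J ! k = j" using J(3) by (metis in_set_conv_nth insertI1)
    have JS: "(J, k) \<in> S" using J k by (auto simp: S_def multi_indices_def)
    have "set (delete_nth k J) = set K" using sorted(2)[OF JS] k J K(3) by auto
    then have "delete_nth k J = K"
      using sorted(1)[OF JS] K(1) by (auto simp: strict_sorted_iff intro: sorted_distinct_set_unique)
    then show "\<exists>x\<in>S. y = (case x of (J, k) \<Rightarrow> (delete_nth k J, J ! k))"
      using JS k yy by (intro bexI[of _ "(J, k)"]) auto
  qed
  have summand: "(\<Sum>i\<in>UNIV. H i (J ! k) * \<alpha> (J[k := i])) * cnj (\<beta> J) = F (delete_nth k J, J ! k)"
    if "(J, k) \<in> S" for J k
  proof -
    have k: "k < length J" using that by (auto simp: S_def multi_indices_def)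
    have A: "\<alpha> (J[k := i]) = (-1) ^ k * \<alpha> (i # delete_nth k J)" for i
      using covectors_move[OF a, of "take k J" i "drop (Suc k) J"] k
      by (simp add: upd_conv_take_nth_drop delete_nth_def)
    have B: "\<beta> J = (-1) ^ k * \<beta> (J ! k # delete_nth k J)"
      using covectors_move[OF b, of "take k J" "J ! k" "drop (Suc k) J"] k split[OF k]
      by (simp add: delete_nth_def)
    have s: "(-1) ^ k * (-1) ^ k = (1::complex)" by (simp flip: power_mult_distrib)
    have "H i (J ! k) * \<alpha> (J[k := i]) * cnj (\<beta> J) =
      ((-1) ^ k * (-1) ^ k) * (H i (J ! k) * \<alpha> (i # delete_nth k J) * cnj (\<beta> (J ! k # delete_nth k J)))"
      for i unfolding A B by (simp add: mult_ac)
    then show ?thesis unfolding F_def s sum_distrib_right prod.case mult_1_left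
      by (intro sum.cong refl)
  qed
  have "form_inner (Suc q) (levi_op H \<alpha>) \<beta> =
    (\<Sum>J\<in>multi_indices (Suc q). \<Sum>k<Suc q. (\<Sum>i\<in>UNIV. H i (J ! k) * \<alpha> (J[k := i])) * cnj (\<beta> J))"
    unfolding form_inner_def levi_op_def sum_distrib_right
    by (intro sum.cong refl) (auto simp: multi_indices_def)
  also have "\<dots> = (\<Sum>(J, k)\<in>S. (\<Sum>i\<in>UNIV. H i (J ! k) * \<alpha> (J[k := i])) * cnj (\<beta> J))"
    unfolding S_def by (rule sum.cartesian_product)
  also have "\<dots> = (\<Sum>x\<in>S. F (case x of (J, k) \<Rightarrow> (delete_nth k J, J ! k)))"
    by (rule sum.cong) (auto simp: summand)
  also have "\<dots> = sum F T" by (rule sum.reindex_bij_betw[OF bij])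
  also have "\<dots> = sum F (multi_indices q \<times> UNIV)"
  proof (rule sum.mono_neutral_left)
    show "\<forall>x\<in>multi_indices q \<times> UNIV - T. F x = 0"
      using covectors_repeated[OF b] by (auto simp: T_def F_def)
  qed (use fin in \<open>auto simp: T_def\<close>)
  also have "\<dots> = (\<Sum>K\<in>multi_indices q. \<Sum>j\<in>UNIV. \<Sum>i\<in>UNIV. H i j * \<alpha> (i # K) * cnj (\<beta> (j # K)))"
    unfolding F_def by (rule sum.cartesian_product[symmetric])
  also have "\<dots> = (\<Sum>j\<in>UNIV. \<Sum>K\<in>multi_indices q. \<Sum>i\<in>UNIV. H i j * \<alpha> (i # K) * cnj (\<beta> (j # K)))"
    by (rule sum.swap)
  also have "\<dots> = (\<Sum>j\<in>UNIV. \<Sum>i\<in>UNIV. \<Sum>K\<in>multi_indices q. H i j * \<alpha> (i # K) * cnj (\<beta> (j # K)))"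
    by (intro sum.cong refl sum.swap)
  also have "\<dots> = (\<Sum>i\<in>UNIV. \<Sum>j\<in>UNIV. \<Sum>K\<in>multi_indices q. H i j * \<alpha> (i # K) * cnj (\<beta> (j # K)))"
    by (rule sum.swap)
  finally show ?thesis .
qed

lemma complex_hessian_quadratic_weight:
  fixes z\<^sub>0 :: "'n::finite cspace"
  shows "complex_hessian (quadratic_weight a b z\<^sub>0) z i j = (if i = j then complex_of_real a else 0)"
proof -
  have d: "((\<lambda>z. complex_of_real (quadratic_weight a b z\<^sub>0 z)) has_derivative
      (\<lambda>h. complex_of_real (2 * a * inner (w - z\<^sub>0) h))) (at w)" for w
    unfolding quadratic_weight_def power2_norm_eq_inner
    by (auto intro!: derivative_eq_intros simp: inner_commute)
  have 1: "dzbar j (\<lambda>z. complex_of_real (quadratic_weight a b z\<^sub>0 z)) w = complex_of_real a * (w $ j - z\<^sub>0 $ j)"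
    for w
    unfolding dzbar_def frechet_derivative_at[OF d, symmetric]
    by (simp add: inner_axis complex_eq_iff inner_complex_def)
  have e: "((\<lambda>w. complex_of_real a * (w $ j - z\<^sub>0 $ j)) has_derivative (\<lambda>h. complex_of_real a * h $ j)) (at z)"
    by (auto intro!: derivative_eq_intros bounded_linear.has_derivative[OF bounded_linear_vec_nth])
  show ?thesis
    unfolding complex_hessian_def 1[abs_def] dz_def frechet_derivative_at[OF e, symmetric]
    by (auto simp: axis_def complex_eq_iff)
qed

lemma levi_op_quadratic_weight:
  assumes "\<alpha> \<in> covectors q"
  shows "levi_op (complex_hessian (quadratic_weight a b z\<^sub>0) z) \<alpha> = (\<lambda>J. complex_of_real (a * real q) * \<alpha> J)"
proof
  fix J
  show "levi_op (complex_hessian (quadratic_weight a b z\<^sub>0) z) \<alpha> J = complex_of_real (a * real q) * \<alpha> J"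
  proof (cases "length J = q")
    case True
    then show ?thesis
      by (simp add: levi_op_def complex_hessian_quadratic_weight if_distrib if_distribR sum.delta
          cong: if_cong)
  next
    case False
    then show ?thesis using covectors_length[OF assms] by (simp add: levi_op_def)
  qed
qed

lemma Levi_inv_quadratic_weight:
  assumes f: "f z \<in> covectors q" and "a > 0" "q > 0"
  shows "Levi_inv (quadratic_weight a b z\<^sub>0) q f z = (\<lambda>J. f z J / complex_of_real (a * real q))"
proof -
  let ?L = "levi_op (complex_hessian (quadratic_weight a b z\<^sub>0) z)"
  let ?g = "\<lambda>J. f z J / complex_of_real (a * real q)"
  have g: "?g \<in> covectors q" using f unfolding covectors_def by simp
  have aq: "complex_of_real (a * real q) \<noteq> 0" using assms by simp
  have "inj_on ?L (covectors q)"
  proof (rule inj_onI)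
    fix x y assume x: "x \<in> covectors q" and y: "y \<in> covectors q" and e: "?L x = ?L y"
    show "x = y"
    proof
      fix J
      show "x J = y J"
        using e aq fun_cong[of "?L x" "?L y" J]
        unfolding levi_op_quadratic_weight[OF x] levi_op_quadratic_weight[OF y] by simp
    qed
  qed
  moreover have "?L ?g = f z"
    unfolding levi_op_quadratic_weight[OF g] using aq by simp
  ultimately show ?thesis unfolding Levi_inv_def using g inv_into_f_f by metis
qed

lemma integral_Levi_inv_quadratic_weight:
  fixes D :: "'n::{finite,linorder} cspace set" and a b :: real and z\<^sub>0 :: "'n cspace"
  assumes "f \<in> smooth_forms D q" "a > 0" "q > 0"
  defines "\<phi> \<equiv> quadratic_weight a b z\<^sub>0"
  shows "(LINT z|lebesgue_on D. Re (form_inner q (Levi_inv \<phi> q f z) (f z)) * exp (- \<phi> z))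
    = 1 / (a * real q) * (LINT z|lebesgue_on D. form_normsq q (f z) * exp (- \<phi> z))"
proof -
  have "Re (form_inner q (Levi_inv \<phi> q f z) (f z)) * exp (- \<phi> z)
    = 1 / (a * real q) * (form_normsq q (f z) * exp (- \<phi> z))" if "z \<in> D" for z
  proof -
    have "f z \<in> covectors q"
      using assms(1) that closure_subset by (auto simp: smooth_forms_def)
    then have L: "Levi_inv \<phi> q f z = (\<lambda>J. f z J / complex_of_real (a * real q))"
      unfolding \<phi>_def using assms by (intro Levi_inv_quadratic_weight)
    have "form_inner q (Levi_inv \<phi> q f z) (f z) = form_inner q (f z) (f z) / complex_of_real (a * real q)"
      unfolding form_inner_def L by (simp add: sum_divide_distrib)
    then show ?thesis by (simp only: form_normsq_def Re_divide_of_real) simp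
  qed
  then have "(LINT z|lebesgue_on D. Re (form_inner q (Levi_inv \<phi> q f z) (f z)) * exp (- \<phi> z))
    = (LINT z|lebesgue_on D. 1 / (a * real q) * (form_normsq q (f z) * exp (- \<phi> z)))"
    by (intro Bochner_Integration.integral_cong) (auto simp: space_restrict_space)
  then show ?thesis by simp
qed


section \<open>Hyper-q-convexity\<close>

definition normalized_defining_function ::
  "('n::finite cspace \<Rightarrow> real) \<Rightarrow> 'n cspace set \<Rightarrow> bool" where
  "normalized_defining_function \<rho> D \<longleftrightarrow> smooth \<rho> \<and> D = {z. \<rho> z < 0} \<and>
     (\<forall>p\<in>frontier D. \<exists>g. GDERIV \<rho> p :> g \<and> norm g = 1)"

definition holomorphic_tangent_space ::
  "('n::finite cspace \<Rightarrow> real) \<Rightarrow> 'n cspace \<Rightarrow> 'n cspace set" where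
  "holomorphic_tangent_space \<rho> p =
     {\<xi>. (\<Sum>i\<in>UNIV. dz i (\<lambda>z. complex_of_real (\<rho> z)) p * \<xi> $ i) = 0}"

definition hermitian_inner :: "'n::finite cspace \<Rightarrow> 'n cspace \<Rightarrow> complex" where
  "hermitian_inner \<xi> \<eta> = (\<Sum>i\<in>UNIV. \<xi> $ i * cnj (\<eta> $ i))"

definition levi_form ::
  "('n::finite cspace \<Rightarrow> real) \<Rightarrow> 'n cspace \<Rightarrow> 'n cspace \<Rightarrow> 'n cspace \<Rightarrow> complex" where
  "levi_form \<rho> p \<xi> \<eta> = (\<Sum>i\<in>UNIV. \<Sum>j\<in>UNIV. complex_hessian \<rho> p i j * \<xi> $ i * cnj (\<eta> $ j))"

definition levi_eigenspace ::
  "('n::finite cspace \<Rightarrow> real) \<Rightarrow> 'n cspace \<Rightarrow> real \<Rightarrow> 'n cspace set" where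
  "levi_eigenspace \<rho> p c = {\<xi> \<in> holomorphic_tangent_space \<rho> p.
     \<forall>\<eta> \<in> holomorphic_tangent_space \<rho> p. levi_form \<rho> p \<xi> \<eta> = complex_of_real c * hermitian_inner \<xi> \<eta>}"

text \<open>
  A choice of q eigenvalues counted with multiplicity is a multiset of size q in which each number
  occurs at most as often as the complex dimension of its eigenspace (in particular, numbers that are
  not eigenvalues do not occur).
\<close>

definition hyper_convex ::
  "nat \<Rightarrow> ('n::finite cspace \<Rightarrow> real) \<Rightarrow> 'n cspace set \<Rightarrow> bool" where
  "hyper_convex q \<rho> D \<longleftrightarrow> (\<forall>p\<in>frontier D. \<forall>M :: real multiset.
     size M = q \<and> (\<forall>c. count M c \<le> vec.dim (levi_eigenspace \<rho> p c)) \<longrightarrow> sum_mset M \<ge> 0)"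

end

(* Assume the estimate and pair a closed form f in the domain of the adjoint with the solution u of
   dbar u = f: since (f, f) = (u, dbar* f), the bound on u gives a q |f|^2 <= |dbar* f|^2 in the weighted norms.
   On the other hand |dbar* f|^2 = (dbar dbar* f, f), and commuting the two operators turns the right-hand
   side into a q |f|^2 plus the integral of C + a S, where C does not depend on the weight and
   S = sum of conj(z - z0)_i (d f_iK / d zbar_j) conj(f_jK). Hence the integral of (C + a S) e^(-phi) is
   non-negative for every a > 0; no boundary integral has to be introduced.
   Choose z0 on the outer normal at p so that p is the nearest point of the closure of D. As a tends to
   infinity, e^(-phi) concentrates at p and S(p) >= 0 follows. Differentiating the boundary condition
   in tangential directions shows that S(p) is a positive multiple of the Levi form applied to f(p).
   It remains to find closed forms in the domain with prescribed tangential value at p: take exterior products of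
   dbar g_l with g_l = sum of c_l conj(z) - 4 rho sum of c_l d rho / d z, where the c_l are eigenvectors of the
   Levi form. For the resulting f(p), the Levi form is the sum of the eigenvalues times |f(p)|^2. *)

theory Submission
  imports Defs
begin

section \<open>Smooth functions\<close>

text \<open>The difficulty is that u is only square integrable: its equation may be tested only
  against functions with compact support in D, whereas f does not vanish on the boundary. Formal
  adjointness is therefore proved with a cutoff in \<open>n * \<rho>\<close>. Its derivative has
  size n, but it multiplies the contraction of f with the gradient of \<open>\<rho>\<close>, which
  the boundary condition makes O(\<open>\<rho>\<close>); the error is bounded uniformly and tends to
  zero at each point of D. The identity is used for u and for dbar* f, and both times the boundary
  condition is needed for f only. Since dbar dbar* f is then expanded pointwise, S is an ordinary
  smooth function on D. Two demands on the test form conflict: a correction that enforces the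
  boundary condition usually destroys closedness. Correcting the potentials g_l instead of the forms
  avoids this, since exterior products of dbar-exact (0,1)-forms are closed. The vectors c_l are
  tangential at p only; the correction enforces the condition along the whole boundary and leaves
  the value at p unchanged.\<close>

abbreviation fd :: "('a::real_normed_vector \<Rightarrow> 'b::real_normed_vector) \<Rightarrow> 'a \<Rightarrow> 'a \<Rightarrow> 'b" where
  "fd f x \<equiv> frechet_derivative f (at x)"

text \<open>\<open>frechet_derivative\<close> is a choice operator; uniqueness of derivatives lets
  any explicit derivative replace it, so each closure property below becomes a differentiation rule
  plus an induction on the order.\<close>

lemma cd_SucI:
  assumes "\<And>x. (f has_derivative f' x) (at x)"
    and "\<And>v. continuously_differentiable k (\<lambda>x. f' x v)"
  shows "continuously_differentiable (Suc k) f"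
proof -
  have "fd f x = f' x" for x
    using frechet_derivative_at[OF assms(1)] by simp
  then show ?thesis using assms by (auto simp: differentiable_def)
qed

lemma cd_Suc_imp:
  "continuously_differentiable (Suc k) f \<Longrightarrow> continuously_differentiable k f"
proof (induction k arbitrary: f)
  case 0
  then show ?case
    by (auto simp: continuous_on_eq_continuous_at differentiable_imp_continuous_within)
next
  case (Suc k)
  then show ?case by (metis continuously_differentiable.simps(2))
qed

lemma cd_has_derivative:
  "continuously_differentiable (Suc k) f \<Longrightarrow> (f has_derivative fd f x) (at x)"
  by (simp add: frechet_derivative_works[symmetric])

lemma cd_add:
  assumes "continuously_differentiable k f" "continuously_differentiable k g"
  shows "continuously_differentiable k (\<lambda>x. f x + g x)"
  using assms
proof (induction k arbitrary: f g)
  case 0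
  then show ?case by (auto intro: continuous_on_add)
next
  case (Suc k)
  show ?case
    by (rule cd_SucI[OF has_derivative_add
          [OF Suc.prems(1)[THEN cd_has_derivative]
              Suc.prems(2)[THEN cd_has_derivative]]])
      (use Suc in auto)
qed

lemma cd_const: "continuously_differentiable k (\<lambda>x. c)"
proof (induction k arbitrary: c)
  case (Suc k)
  then show ?case by (intro cd_SucI[OF has_derivative_const])
qed simp

lemma cd_bilinear:
  assumes B: "bounded_bilinear B"
    and "continuously_differentiable k f" "continuously_differentiable k g"
  shows "continuously_differentiable k (\<lambda>x. B (f x) (g x))"
  using assms(2,3)
proof (induction k arbitrary: f g)
  case 0
  then show ?case by (auto intro: bounded_bilinear.continuous_on[OF B])
next
  case (Suc k)
  show ?case
  proof (rule cd_SucI[OF bounded_bilinear.FDERIV[OF B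
          Suc.prems(1)[THEN cd_has_derivative]
              Suc.prems(2)[THEN cd_has_derivative]]])
    fix v
    show "continuously_differentiable k
        (\<lambda>x. B (f x) (fd g x v) + B (fd f x v) (g x))"
      using Suc.prems Suc.prems[THEN cd_Suc_imp]
      by (intro cd_add Suc.IH) auto
  qed
qed

lemma cd_bounded_linear:
  assumes L: "bounded_linear L" and "continuously_differentiable k f"
  shows "continuously_differentiable k (\<lambda>x. L (f x))"
  using assms(2)
proof (induction k arbitrary: f)
  case 0
  then show ?case by (auto intro: bounded_linear.continuous_on[OF L])
next
  case (Suc k)
  show ?case
    by (rule cd_SucI[OF bounded_linear.has_derivative[OF L
          Suc.prems[THEN cd_has_derivative]]])
      (use Suc in auto)
qed

text \<open>The chain rule gives a product in which one factor is again a composition, with h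
  replaced by its derivative and g kept; hence the induction varies h alone.\<close>

lemma cd_compose_real:
  fixes h :: "real \<Rightarrow> real"
  assumes "continuously_differentiable k h" "continuously_differentiable k g"
  shows "continuously_differentiable k (\<lambda>x. h (g x))"
  using assms
proof (induction k arbitrary: h)
  case 0
  then show ?case by (auto intro: continuous_on_compose2)
next
  case (Suc k)
  have h': "(h has_derivative fd h t) (at t)" for t
    using Suc.prems(1) by (rule cd_has_derivative)
  \<comment> \<open>On the real line a derivative is multiplication by its value at 1, which makes
    the derivative of h a function of one real variable again.\<close>
  have lin: "fd h t s = s * fd h t 1" for s t
    using linear_cmul[OF has_derivative_linear[OF h'], of t s 1] by simp
  show ?case
  proof (rule cd_SucI)
    show "((\<lambda>x. h (g x)) has_derivative
        (\<lambda>v. fd g x v * fd h (g x) 1)) (at x)" for x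
      using has_derivative_compose[OF cd_has_derivative[OF Suc.prems(2)] h']
      unfolding lin[symmetric] .
    show "continuously_differentiable k
        (\<lambda>x. fd g x v * fd h (g x) 1)" for v
      using Suc.prems Suc.prems(2)[THEN cd_Suc_imp]
      by (intro cd_bilinear[OF bounded_bilinear_mult]
          Suc.IH[of "\<lambda>t. fd h t 1"]) auto
  qed
qed

lemma smooth_differentiable: "smooth f \<Longrightarrow> f differentiable (at x)"
  unfolding smooth_def using continuously_differentiable.simps(2) by blast

lemma smooth_has_derivative: "smooth f \<Longrightarrow> (f has_derivative fd f x) (at x)"
  using frechet_derivative_works smooth_differentiable by blast

lemma smooth_fd: "smooth f \<Longrightarrow> smooth (\<lambda>x. fd f x v)"
  unfolding smooth_def using continuously_differentiable.simps(2) by blast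

lemma smooth_continuous_on: "smooth f \<Longrightarrow> continuous_on S f"
  by (meson continuous_at_imp_continuous_on differentiable_imp_continuous_within smooth_differentiable)

lemma smooth_const [intro]: "smooth (\<lambda>x. c)"
  by (simp add: smooth_def cd_const)

lemma smooth_add [intro]: "smooth f \<Longrightarrow> smooth g \<Longrightarrow> smooth (\<lambda>x. f x + g x)"
  by (simp add: smooth_def cd_add)

lemma smooth_bilinear:
  "bounded_bilinear B \<Longrightarrow> smooth f \<Longrightarrow> smooth g \<Longrightarrow> smooth (\<lambda>x. B (f x) (g x))"
  by (simp add: smooth_def cd_bilinear)

lemma smooth_bounded_linear: "bounded_linear L \<Longrightarrow> smooth f \<Longrightarrow> smooth (\<lambda>x. L (f x))"
  by (simp add: smooth_def cd_bounded_linear)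

lemma smooth_id [intro]: "smooth (\<lambda>x. x)"
  unfolding smooth_def
proof
  fix k show "continuously_differentiable k (\<lambda>x::'a. x)"
    by (cases k) (auto intro!: cd_SucI[OF has_derivative_ident]
        cd_const)
qed

lemma smooth_mult [intro]:
  fixes f g :: "'a::real_normed_vector \<Rightarrow> 'b::real_normed_algebra"
  shows "smooth f \<Longrightarrow> smooth g \<Longrightarrow> smooth (\<lambda>x. f x * g x)"
  by (rule smooth_bilinear[OF bounded_bilinear_mult])

lemma smooth_minus [intro]: "smooth f \<Longrightarrow> smooth (\<lambda>x. - f x)"
  by (rule smooth_bounded_linear[OF bounded_linear_minus[OF bounded_linear_ident]])

lemma smooth_diff [intro]: "smooth f \<Longrightarrow> smooth g \<Longrightarrow> smooth (\<lambda>x. f x - g x)"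
  using smooth_add[OF _ smooth_minus, of f g] by simp

lemma smooth_divide_const [intro]:
  fixes f :: "'a::real_normed_vector \<Rightarrow> 'b::real_normed_field"
  shows "smooth f \<Longrightarrow> smooth (\<lambda>x. f x / c)"
  by (rule smooth_bounded_linear[OF bounded_linear_divide])

lemma smooth_cnj [intro]: "smooth f \<Longrightarrow> smooth (\<lambda>x. cnj (f x))"
  by (rule smooth_bounded_linear[OF bounded_linear_cnj])

lemma smooth_of_real [intro]: "smooth f \<Longrightarrow> smooth (\<lambda>x. complex_of_real (f x))"
  by (rule smooth_bounded_linear[OF bounded_linear_of_real])

lemma smooth_Re [intro]: "smooth f \<Longrightarrow> smooth (\<lambda>x. Re (f x))"
  by (rule smooth_bounded_linear[OF bounded_linear_Re])

lemma smooth_Im [intro]: "smooth f \<Longrightarrow> smooth (\<lambda>x. Im (f x))"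
  by (rule smooth_bounded_linear[OF bounded_linear_Im])

lemma smooth_vec_nth [intro]: "smooth (\<lambda>z::'a::real_normed_vector^'n. z $ i)"
  by (rule smooth_bounded_linear[OF bounded_linear_vec_nth smooth_id])

lemma smooth_sum [intro]: "(\<And>i. i \<in> A \<Longrightarrow> smooth (f i)) \<Longrightarrow> smooth (\<lambda>x. \<Sum>i\<in>A. f i x)"
  by (induction A rule: infinite_finite_induct) auto

lemma smooth_prod [intro]:
  fixes f :: "'i \<Rightarrow> 'a::real_normed_vector \<Rightarrow> 'b::real_normed_field"
  shows "(\<And>i. i \<in> A \<Longrightarrow> smooth (f i)) \<Longrightarrow> smooth (\<lambda>x. \<Prod>i\<in>A. f i x)"
  by (induction A rule: infinite_finite_induct) auto

lemma smooth_compose_real: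
  fixes h :: "real \<Rightarrow> real"
  shows "smooth h \<Longrightarrow> smooth g \<Longrightarrow> smooth (\<lambda>x. h (g x))"
  by (simp add: smooth_def cd_compose_real)

lemma smooth_exp: "smooth (exp :: real \<Rightarrow> real)"
  unfolding smooth_def
proof
  fix k show "continuously_differentiable k (exp :: real \<Rightarrow> real)"
  proof (induction k)
    case (Suc k)
    show ?case
      by (rule cd_SucI[OF DERIV_exp[unfolded has_field_derivative_def]])
        (intro cd_bilinear[OF bounded_bilinear_mult] Suc
          cd_const)
  qed (simp add: continuous_on_exp)
qed

text \<open>The family is closed under differentiation up to linear combinations, which gives smoothness by
  induction.\<close>

definition flat_power :: "nat \<Rightarrow> real \<Rightarrow> real" where
  "flat_power n x = (if x > 0 then (1 / x) ^ n * exp (- (1 / x)) else 0)"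

text \<open>Substituting y = 1/x turns this into the decay of y^n / exp y at infinity.\<close>

lemma flat_power_tendsto_0: "(flat_power n \<longlongrightarrow> 0) (at_right 0)"
proof -
  have "((\<lambda>x. (inverse x) ^ n / exp (inverse x)) \<longlongrightarrow> (0::real)) (at_right 0)"
    using filterlim_compose[OF tendsto_power_div_exp_0[of n] filterlim_inverse_at_top_right] .
  moreover have "\<forall>\<^sub>F x in at_right 0. (inverse x) ^ n / exp (inverse x) = flat_power n x"
    unfolding eventually_at_right_field
    by (intro exI[of _ 1]) (auto simp: flat_power_def exp_minus field_simps)
  ultimately show ?thesis by (rule Lim_transform_eventually)
qed

text \<open>With y = 1/x one has dy/dx = -y^2, so y^n exp(-y) has the derivative y^(n+2) exp(-y) - n
  y^(n+1) exp(-y). Flatness at 0 carries the formula across the origin.\<close>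

lemma flat_power_DERIV:
  "(flat_power n has_real_derivative flat_power (n + 2) x - real n * flat_power (n + 1) x) (at x)"
proof -
  consider "x < 0" | "x = 0" | "x > 0" by linarith
  then show ?thesis
  proof cases
    case 1
    have "((\<lambda>_. 0) has_real_derivative 0) (at x)" by simp
    then have "(flat_power n has_real_derivative 0) (at x)"
      by (rule has_field_derivative_transform_within[of _ _ _ _ "- x"])
        (use 1 in \<open>auto simp: flat_power_def dist_real_def\<close>)
    then show ?thesis using 1 by (simp add: flat_power_def)
  next
    case 2
    have "(\<lambda>h. flat_power n h / h) \<midarrow>0\<rightarrow> 0"
    proof (subst filterlim_at_split, intro conjI)
      have "\<forall>\<^sub>F h in at_left 0. 0 = flat_power n h / h"
        unfolding eventually_at_left_field by (intro exI[of _ "-1"]) (auto simp: flat_power_def)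
      then show "((\<lambda>h. flat_power n h / h) \<longlongrightarrow> 0) (at_left 0)"
        by (rule Lim_transform_eventually[rotated]) simp
      \<comment> \<open>From the right, the difference quotient at 0 is itself the next member of
        the family.\<close>
      have "\<forall>\<^sub>F h in at_right 0. flat_power (Suc n) h = flat_power n h / h"
        unfolding eventually_at_right_field by (intro exI[of _ 1]) (auto simp: flat_power_def)
      then show "((\<lambda>h. flat_power n h / h) \<longlongrightarrow> 0) (at_right 0)"
        by (rule Lim_transform_eventually[OF flat_power_tendsto_0])
    qed
    then show ?thesis using 2 by (simp add: has_field_derivative_iff flat_power_def)
  next
    case 3
    have "((\<lambda>y. y ^ n * exp (- y)) has_real_derivative
        (real n * y ^ (n - 1) - y ^ n) * exp (- y)) (at y)" for y
      by (auto intro!: derivative_eq_intros simp: algebra_simps)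
    moreover have "((\<lambda>x. 1 / x) has_real_derivative - ((1 / x)\<^sup>2)) (at x)"
      using 3 by (auto intro!: derivative_eq_intros simp: power2_eq_square)
    ultimately have "((\<lambda>x. (1 / x) ^ n * exp (- (1 / x))) has_real_derivative
        (real n * (1 / x) ^ (n - 1) - (1 / x) ^ n) * exp (- (1 / x)) * - ((1 / x)\<^sup>2)) (at x)"
      by (rule DERIV_chain2)
    \<comment> \<open>The later split on n takes care of the truncated exponent
      \<open>n - 1\<close>, which at n = 0 comes with the factor 0.\<close>
    moreover have "(real n * (1 / x) ^ (n - 1) - (1 / x) ^ n) * exp (- (1 / x)) * - ((1 / x)\<^sup>2) =
        flat_power (n + 2) x - real n * flat_power (n + 1) x"
      using 3 by (cases n) (auto simp: flat_power_def algebra_simps power2_eq_square add_divide_distrib)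
    ultimately have "((\<lambda>x. (1 / x) ^ n * exp (- (1 / x))) has_real_derivative
        flat_power (n + 2) x - real n * flat_power (n + 1) x) (at x)"
      by simp
    then show ?thesis
      by (rule has_field_derivative_transform_within[of _ _ _ _ x])
        (use 3 in \<open>auto simp: flat_power_def dist_real_def abs_if split: if_splits\<close>)
  qed
qed

lemma smooth_flat_power: "smooth (flat_power n)"
  unfolding smooth_def
proof
  fix k show "continuously_differentiable k (flat_power n)"
  proof (induction k arbitrary: n)
    case 0
    show ?case using DERIV_isCont[OF flat_power_DERIV] by (simp add: continuous_on_eq_continuous_at)
  next
    case (Suc k)
    have "continuously_differentiable k (\<lambda>x. (flat_power (n + 2) x + (- real n) * flat_power (n + 1) x) * v)" for v
      by (intro cd_bilinear[OF bounded_bilinear_mult] Suc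
          cd_add cd_const)
    then show ?case
      by (intro cd_SucI[OF flat_power_DERIV[unfolded has_field_derivative_def]])
        simp
  qed
qed

text \<open>For y = 1/x > 0, exp y dominates 1 + y + y^2/2. Exponents up to 2 are those that occur
  in the cutoff and in its derivative.\<close>

lemma flat_power_bounds:
  assumes "n \<le> 2"
  shows "0 \<le> flat_power n x" "flat_power n x \<le> 2"
proof -
  show "0 \<le> flat_power n x" by (simp add: flat_power_def)
  show "flat_power n x \<le> 2"
  proof (cases "x > 0")
    case True
    define y where "y = 1 / x"
    have y: "y > 0" using True by (simp add: y_def)
    have e: "1 + y + y\<^sup>2 / 2 \<le> exp y" using exp_lower_Taylor_quadratic[of y] y by simp
    have "n = 0 \<or> n = 1 \<or> n = 2" using assms by auto
    moreover have "1 \<le> 2 * exp y" "y \<le> 2 * exp y" "y\<^sup>2 \<le> 2 * exp y"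
      using e y zero_le_power2[of y] by linarith+
    ultimately have "y ^ n \<le> 2 * exp y" using exp_gt_zero[of y] by auto
    then have "y ^ n * exp (- y) \<le> 2" by (simp add: exp_minus field_simps)
    then show ?thesis using True by (simp add: flat_power_def y_def)
  qed (simp add: flat_power_def)
qed

section \<open>Symmetry of second derivatives\<close>

text \<open>The mean value theorem is applied twice, first along v and then along w. The second
  difference is symmetric in v and w while the derivative expression is not; this asymmetry is what
  proves that second derivatives commute.\<close>

lemma mixed_difference_mean_value:
  fixes f :: "'a::real_normed_vector \<Rightarrow> real"
  assumes f: "smooth f" and h: "h > 0"
  shows "\<exists>y. norm (y - x) \<le> h * (norm v + norm w) \<and>
    f (x + h *\<^sub>R v + h *\<^sub>R w) - f (x + h *\<^sub>R v) - f (x + h *\<^sub>R w) + f x =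
    h * h * fd (\<lambda>y. fd f y v) y w"
proof -
  have d: "((\<lambda>s. g (y + s *\<^sub>R u)) has_real_derivative fd g (y + s *\<^sub>R u) u) (at s)"
    if g: "smooth g" for g :: "'a \<Rightarrow> real" and y u s
  proof -
    have 1: "((\<lambda>s. y + s *\<^sub>R u) has_derivative (\<lambda>s. s *\<^sub>R u)) (at s)"
      by (auto intro!: derivative_eq_intros)
    have "((\<lambda>s. g (y + s *\<^sub>R u)) has_derivative (\<lambda>r. fd g (y + s *\<^sub>R u) (r *\<^sub>R u))) (at s)"
      by (rule has_derivative_compose[OF 1 smooth_has_derivative[OF g]])
    then show ?thesis
      unfolding has_field_derivative_def
      by (simp add: linear_cmul[OF has_derivative_linear[OF smooth_has_derivative[OF g]]]
          mult.commute[of _ "fd g (y + s *\<^sub>R u) u"] cong: if_cong)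
  qed
  define df where "df = (\<lambda>y. fd f y v)"
  have df: "smooth df" unfolding df_def by (rule smooth_fd[OF f])
  define G where "G = (\<lambda>s. f ((x + h *\<^sub>R w) + s *\<^sub>R v) - f (x + s *\<^sub>R v))"
  have "(G has_real_derivative df ((x + h *\<^sub>R w) + s *\<^sub>R v) - df (x + s *\<^sub>R v)) (at s)" for s
    unfolding G_def df_def by (intro DERIV_diff d f)
  then obtain s where s: "0 < s" "s < h" "G h - G 0 = h * (df ((x + h *\<^sub>R w) + s *\<^sub>R v) - df (x + s *\<^sub>R v))"
    using MVT2[of 0 h G "\<lambda>s. df ((x + h *\<^sub>R w) + s *\<^sub>R v) - df (x + s *\<^sub>R v)"] h by auto
  obtain t where t: "0 < t" "t < h"
    "df ((x + s *\<^sub>R v) + h *\<^sub>R w) - df ((x + s *\<^sub>R v) + 0 *\<^sub>R w)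
      = h * fd df ((x + s *\<^sub>R v) + t *\<^sub>R w) w"
    using MVT2[of 0 h "\<lambda>t. df ((x + s *\<^sub>R v) + t *\<^sub>R w)", OF h d[OF df]] by auto
  have "norm (s *\<^sub>R v + t *\<^sub>R w) \<le> norm (s *\<^sub>R v) + norm (t *\<^sub>R w)"
    by (rule norm_triangle_ineq)
  also have "\<dots> \<le> h * norm v + h * norm w"
    using s t by (intro add_mono) (auto intro!: mult_right_mono)
  finally have "norm ((x + s *\<^sub>R v + t *\<^sub>R w) - x) \<le> h * (norm v + norm w)"
    by (simp add: algebra_simps)
  moreover have "f (x + h *\<^sub>R v + h *\<^sub>R w) - f (x + h *\<^sub>R v) - f (x + h *\<^sub>R w) + f x = G h - G 0"
    unfolding G_def by (simp add: algebra_simps)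
  ultimately show ?thesis
    using s(3) t(3) unfolding df_def[symmetric]
    by (intro exI[of _ "x + s *\<^sub>R v + t *\<^sub>R w"]) (simp add: add.commute add.left_commute)
qed

text \<open>One and the same second difference equals both mixed derivatives, taken at points that
  approach x as the step tends to 0; continuity of the two derivatives does the rest.\<close>

lemma fd_commute_real:
  fixes f :: "'a::real_normed_vector \<Rightarrow> real"
  assumes f: "smooth f"
  shows "fd (\<lambda>y. fd f y v) x w =
    fd (\<lambda>y. fd f y w) x v"
proof -
  define A where "A = (\<lambda>z. fd (\<lambda>y. fd f y v) z w)"
  define B where "B = (\<lambda>z. fd (\<lambda>y. fd f y w) z v)"
  have smA: "smooth A" and smB: "smooth B"
    unfolding A_def B_def by (intro smooth_fd f)+
  have cont: "isCont A x" "isCont B x"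
    using smooth_continuous_on[OF smA, of UNIV] smooth_continuous_on[OF smB, of UNIV]
    by (auto simp: continuous_on_eq_continuous_at)
  define h where "h = (\<lambda>n. inverse (real (Suc n)))"
  have h: "h n > 0" for n by (simp add: h_def)
  have h0: "h \<longlonglongrightarrow> 0" unfolding h_def by (rule LIMSEQ_inverse_real_of_nat)
  have sum: "f (x + h n *\<^sub>R w + h n *\<^sub>R v) = f (x + h n *\<^sub>R v + h n *\<^sub>R w)" for n
    by (simp add: ac_simps)
  have "\<exists>y y'. norm (y - x) \<le> h n * (norm v + norm w) \<and> norm (y' - x) \<le> h n * (norm v + norm w) \<and> A y = B y'"
    for n
  proof -
    have hh: "h n * h n \<noteq> 0" using h[of n] by simp
    obtain y where y: "norm (y - x) \<le> h n * (norm v + norm w)"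
      "f (x + h n *\<^sub>R v + h n *\<^sub>R w) - f (x + h n *\<^sub>R v) - f (x + h n *\<^sub>R w) + f x = h n * h n * A y"
      using mixed_difference_mean_value[OF f h[of n], of x v w] unfolding A_def by blast
    obtain y' where y': "norm (y' - x) \<le> h n * (norm w + norm v)"
      "f (x + h n *\<^sub>R w + h n *\<^sub>R v) - f (x + h n *\<^sub>R w) - f (x + h n *\<^sub>R v) + f x = h n * h n * B y'"
      using mixed_difference_mean_value[OF f h[of n], of x w v] unfolding B_def by blast
    have "h n * h n * A y = h n * h n * B y'"
      unfolding y(2)[symmetric] y'(2)[symmetric] sum by simp
    then have "A y = B y'" using hh by simp
    then show ?thesis using y(1) y'(1) by (auto simp: add.commute)
  qed
  then obtain y y' where y: "\<And>n. norm (y n - x) \<le> h n * (norm v + norm w)"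
    "\<And>n. norm (y' n - x) \<le> h n * (norm v + norm w)" "\<And>n. A (y n) = B (y' n)"
    by metis
  have lim: "Y \<longlonglongrightarrow> x" if "\<And>n. norm (Y n - x) \<le> h n * (norm v + norm w)" for Y
  proof -
    have "(\<lambda>n. h n * (norm v + norm w)) \<longlonglongrightarrow> 0" using tendsto_mult_left_zero[OF h0] .
    then have "(\<lambda>n. Y n - x) \<longlonglongrightarrow> 0"
      by (rule Lim_null_comparison[rotated]) (use that in auto)
    then show ?thesis by (simp add: LIM_zero_cancel)
  qed
  have "(\<lambda>n. A (y n)) \<longlonglongrightarrow> A x" by (rule isCont_tendsto_compose[OF cont(1) lim[OF y(1)]])
  moreover have "(\<lambda>n. B (y' n)) \<longlonglongrightarrow> B x" by (rule isCont_tendsto_compose[OF cont(2) lim[OF y(2)]])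
  ultimately have "A x = B x" using y(3) LIMSEQ_unique by auto
  then show ?thesis by (simp add: A_def B_def)
qed

lemma fd_bounded_linear:
  assumes "bounded_linear L" "smooth f"
  shows "fd (\<lambda>y. L (f y)) x v = L (fd f x v)"
  using frechet_derivative_at[OF bounded_linear.has_derivative[OF assms(1) smooth_has_derivative[OF assms(2)]], of x]
  by metis

lemma fd_commute:
  fixes f :: "'a::real_normed_vector \<Rightarrow> complex"
  assumes f: "smooth f"
  shows "fd (\<lambda>y. fd f y v) x w =
    fd (\<lambda>y. fd f y w) x v"
proof (rule complex_eqI)
  note R = fd_bounded_linear[OF bounded_linear_Re]
    and I = fd_bounded_linear[OF bounded_linear_Im]
  show "Re (fd (\<lambda>y. fd f y v) x w) =
    Re (fd (\<lambda>y. fd f y w) x v)"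
    using fd_commute_real[OF smooth_Re[OF f], of v x w]
    by (simp add: R f smooth_fd)
  show "Im (fd (\<lambda>y. fd f y v) x w) =
    Im (fd (\<lambda>y. fd f y w) x v)"
    using fd_commute_real[OF smooth_Im[OF f], of v x w]
    by (simp add: I f smooth_fd)
qed

section \<open>Wirtinger calculus\<close>

lemma smooth_dz [intro]: "smooth g \<Longrightarrow> smooth (dz i g)"
  unfolding dz_def[abs_def]
  by (intro smooth_divide_const smooth_diff smooth_mult smooth_const smooth_fd)

lemma smooth_dzbar [intro]: "smooth g \<Longrightarrow> smooth (dzbar i g)"
  unfolding dzbar_def[abs_def]
  by (intro smooth_divide_const smooth_add smooth_mult smooth_const smooth_fd)

lemma fd_add:
  assumes "smooth f" "smooth g"
  shows "fd (\<lambda>z. f z + g z) p v = fd f p v + fd g p v"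
  using frechet_derivative_at[OF has_derivative_add[OF assms[THEN smooth_has_derivative]], of p] by metis

lemma fd_mult:
  fixes f g :: "'a::real_normed_vector \<Rightarrow> complex"
  assumes "smooth f" "smooth g"
  shows "fd (\<lambda>z. f z * g z) p v =
    f p * fd g p v + fd f p v * g p"
  using frechet_derivative_at[OF has_derivative_mult[OF assms[THEN smooth_has_derivative]], of p] by metis

lemma dz_add: "smooth f \<Longrightarrow> smooth g \<Longrightarrow> dz i (\<lambda>z. f z + g z) p = dz i f p + dz i g p"
  by (simp add: dz_def fd_add field_simps)

lemma dzbar_add: "smooth f \<Longrightarrow> smooth g \<Longrightarrow> dzbar i (\<lambda>z. f z + g z) p = dzbar i f p + dzbar i g p"
  by (simp add: dzbar_def fd_add field_simps)

lemma dz_mult: "smooth f \<Longrightarrow> smooth g \<Longrightarrow> dz i (\<lambda>z. f z * g z) p = dz i f p * g p + f p * dz i g p"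
  by (simp add: dz_def fd_mult field_simps)

lemma dzbar_mult:
  "smooth f \<Longrightarrow> smooth g \<Longrightarrow> dzbar i (\<lambda>z. f z * g z) p = dzbar i f p * g p + f p * dzbar i g p"
  by (simp add: dzbar_def fd_mult field_simps)

lemma dz_const [simp]: "dz i (\<lambda>z. c) p = 0"
  by (simp add: dz_def)

lemma dzbar_const [simp]: "dzbar i (\<lambda>z. c) p = 0"
  by (simp add: dzbar_def)

lemma dz_cmult: "smooth f \<Longrightarrow> dz i (\<lambda>z. c * f z) p = c * dz i f p"
  by (simp add: dz_mult smooth_const)

lemma dzbar_cmult: "smooth f \<Longrightarrow> dzbar i (\<lambda>z. c * f z) p = c * dzbar i f p"
  by (simp add: dzbar_mult smooth_const)

lemma dzbar_minus: "smooth f \<Longrightarrow> dzbar i (\<lambda>z. - f z) p = - dzbar i f p"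
  using dzbar_cmult[of f i "-1" p] by simp

lemma dz_minus: "smooth f \<Longrightarrow> dz i (\<lambda>z. - f z) p = - dz i f p"
  using dz_cmult[of f i "-1" p] by simp

lemma dzbar_sum:
  "(\<And>a. a \<in> A \<Longrightarrow> smooth (f a)) \<Longrightarrow> dzbar i (\<lambda>z. \<Sum>a\<in>A. f a z) p = (\<Sum>a\<in>A. dzbar i (f a) p)"
proof (induction A rule: infinite_finite_induct)
  case (insert x F)
  then have "smooth (f x)" "smooth (\<lambda>z. \<Sum>a\<in>F. f a z)" by (auto intro: smooth_sum)
  then show ?case using insert by (simp add: dzbar_add)
qed auto

lemma dzbar_prod:
  assumes "finite A" "\<And>a. a \<in> A \<Longrightarrow> smooth (f a)"
  shows "dzbar i (\<lambda>z. \<Prod>a\<in>A. f a z) p = (\<Sum>a\<in>A. dzbar i (f a) p * (\<Prod>b\<in>A - {a}. f b p))"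
  using assms
proof (induction A)
  case (insert x F)
  have s: "smooth (f x)" "smooth (\<lambda>z. \<Prod>a\<in>F. f a z)" using insert by (auto intro: smooth_prod)
  have "(\<Sum>a\<in>F. dzbar i (f a) p * (\<Prod>b\<in>insert x F - {a}. f b p)) =
      (\<Sum>a\<in>F. f x p * (dzbar i (f a) p * (\<Prod>b\<in>F - {a}. f b p)))"
  proof (rule sum.cong[OF refl])
    fix a assume "a \<in> F"
    then have "insert x F - {a} = insert x (F - {a})" using insert by auto
    then show "dzbar i (f a) p * (\<Prod>b\<in>insert x F - {a}. f b p) =
        f x p * (dzbar i (f a) p * (\<Prod>b\<in>F - {a}. f b p))"
      using insert by simp
  qed
  moreover have "insert x F - {x} = F" using insert by auto
  ultimately show ?case using insert s by (simp add: dzbar_mult sum_distrib_left)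
qed simp

lemma dzbar_cnj: "smooth g \<Longrightarrow> dzbar i (\<lambda>z. cnj (g z)) p = cnj (dz i g p)"
  by (simp add: dz_def dzbar_def fd_bounded_linear[OF bounded_linear_cnj])

lemma dzbar_of_real: "smooth \<rho> \<Longrightarrow> dzbar i (\<lambda>z. complex_of_real (\<rho> z)) p = cnj (dz i (\<lambda>z. complex_of_real (\<rho> z)) p)"
  using dzbar_cnj[of "\<lambda>z. complex_of_real (\<rho> z)" i p] by (simp add: smooth_of_real)

lemma fd_vec_nth: "fd (\<lambda>z::'a::real_normed_vector^'n. z $ k) p v = v $ k"
  using frechet_derivative_at[OF bounded_linear.has_derivative[OF bounded_linear_vec_nth has_derivative_ident]]
  by metis

lemma dz_vec_nth: "dz i (\<lambda>z. z $ k) p = (if i = k then 1 else 0)"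
  unfolding dz_def fd_vec_nth by (simp add: axis_def)

text \<open>Covers \<open>dzbar\<close> with c = i and \<open>dz\<close> with c = -i.\<close>

lemma fd_half_combination:
  fixes f g :: "'a::real_normed_vector \<Rightarrow> complex"
  assumes "smooth f" "smooth g"
  shows "fd (\<lambda>z. (f z + c * g z) / 2) p v =
    (fd f p v + c * fd g p v) / 2"
proof -
  have "((\<lambda>z. (f z + c * g z) / 2) has_derivative
      (\<lambda>v. (fd f p v + c * fd g p v) / 2)) (at p)"
    by (rule bounded_linear.has_derivative[OF bounded_linear_divide])
      (intro has_derivative_add assms[THEN smooth_has_derivative]
        bounded_linear.has_derivative[OF bounded_linear_mult_right])
  from frechet_derivative_at[OF this] show ?thesis by metis
qed

lemma fd_dzbar:
  "smooth g \<Longrightarrow> fd (dzbar k g) p v =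
    (fd (\<lambda>z. fd g z (axis k 1)) p v
      + \<i> * fd (\<lambda>z. fd g z (axis k \<i>)) p v) / 2"
  unfolding dzbar_def[abs_def]
  by (rule fd_half_combination) (auto intro: smooth_fd)

lemma fd_dz:
  assumes "smooth g"
  shows "fd (dz k g) p v =
    (fd (\<lambda>z. fd g z (axis k 1)) p v
      + (- \<i>) * fd (\<lambda>z. fd g z (axis k \<i>)) p v) / 2"
proof -
  have "dz k g = (\<lambda>z. (fd g z (axis k 1) + (- \<i>) * fd g z (axis k \<i>)) / 2)"
    by (simp add: fun_eq_iff dz_def)
  then show ?thesis
    using assms by (simp only:, intro fd_half_combination) (auto intro: smooth_fd)
qed

lemma
  assumes g: "smooth g"
  shows dzbar_commute: "dzbar i (dzbar j g) p = dzbar j (dzbar i g) p"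
    and dz_dzbar_commute: "dz i (dzbar j g) p = dzbar j (dz i g) p"
proof -
  note c = fd_commute[OF g, of "axis i 1" p "axis j 1"] fd_commute[OF g, of "axis i 1" p "axis j \<i>"]
    fd_commute[OF g, of "axis i \<i>" p "axis j 1"] fd_commute[OF g, of "axis i \<i>" p "axis j \<i>"]
  show "dzbar i (dzbar j g) p = dzbar j (dzbar i g) p"
    unfolding dzbar_def[of i "dzbar j g"] dzbar_def[of j "dzbar i g"] fd_dzbar[OF g]
    using c by (simp add: field_simps)
  show "dz i (dzbar j g) p = dzbar j (dz i g) p"
    unfolding dz_def[of i "dzbar j g"] dzbar_def[of j "dz i g"] fd_dzbar[OF g] fd_dz[OF g]
    using c by (simp add: field_simps)
qed

lemma dzbar_of_real_compose:
  assumes "(h has_real_derivative h') (at (g p))" "smooth g"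
  shows "dzbar j (\<lambda>z. complex_of_real (h (g z))) p = complex_of_real h' * dzbar j (\<lambda>z. complex_of_real (g z)) p"
proof -
  have g: "(g has_derivative fd g p) (at p)" using smooth_has_derivative[OF assms(2)] .
  have "((\<lambda>z. of_real (h (g z))) has_derivative (\<lambda>v. of_real (h' * fd g p v))) (at p)"
    by (rule bounded_linear.has_derivative[OF bounded_linear_of_real])
      (rule has_derivative_compose[OF g assms(1)[unfolded has_field_derivative_def]])
  from frechet_derivative_at[OF this]
  have 1: "fd (\<lambda>z. complex_of_real (h (g z))) p v = complex_of_real h' * complex_of_real (fd g p v)" for v
    by (metis of_real_mult)
  have 2: "fd (\<lambda>z. complex_of_real (g z)) p v = complex_of_real (fd g p v)" for v
    by (rule fd_bounded_linear[OF bounded_linear_of_real assms(2)])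
  show ?thesis by (simp add: dzbar_def 1 2 algebra_simps)
qed

text \<open>For the real inner product, the derivatives in the directions 1 and i of a coordinate
  are the real and imaginary part of the corresponding entry of g.\<close>

lemma dz_GDERIV:
  fixes \<rho> :: "'n::finite cspace \<Rightarrow> real"
  assumes "GDERIV \<rho> p :> g"
  shows "dz i (\<lambda>z. complex_of_real (\<rho> z)) p = cnj (g $ i) / 2"
proof -
  have "((\<lambda>z. complex_of_real (\<rho> z)) has_derivative (\<lambda>h. complex_of_real (inner h g))) (at p)"
    by (rule bounded_linear.has_derivative[OF bounded_linear_of_real assms[unfolded gderiv_def]])
  from frechet_derivative_at[OF this, symmetric] show ?thesis
    by (simp add: dz_def inner_axis' inner_complex_def complex_eq_iff)
qed

lemma smooth_quadratic_weight: "smooth (quadratic_weight a b (z0 :: 'n::finite cspace))"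
  unfolding quadratic_weight_def[abs_def] power2_norm_eq_inner
  by (intro smooth_diff smooth_mult smooth_const smooth_bilinear[OF bounded_bilinear_inner] smooth_id)

lemma dzbar_quadratic_weight:
  "dzbar j (\<lambda>z. complex_of_real (quadratic_weight a b z0 z)) w = complex_of_real a * (w $ j - z0 $ j)"
proof -
  have d: "((\<lambda>z. complex_of_real (quadratic_weight a b z0 z)) has_derivative
      (\<lambda>h. of_real (2 * a * inner (w - z0) h))) (at w)"
    unfolding quadratic_weight_def power2_norm_eq_inner
    by (auto intro!: derivative_eq_intros simp: inner_commute)
  show ?thesis
    unfolding dzbar_def frechet_derivative_at[OF d, symmetric]
    by (simp add: inner_axis complex_eq_iff inner_complex_def)
qed

lemma smooth_exp_weight: "smooth (\<lambda>z. complex_of_real (exp (- quadratic_weight a b (z0 :: 'n::finite cspace) z)))"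
  by (intro smooth_of_real smooth_compose_real[OF smooth_exp] smooth_minus smooth_quadratic_weight)

lemma dzbar_exp_weight:
  "dzbar j (\<lambda>z. complex_of_real (exp (- quadratic_weight a b (z0 :: 'n::finite cspace) z))) w =
    - (of_real a * (w $ j - z0 $ j)) * of_real (exp (- quadratic_weight a b z0 w))"
proof -
  have "((\<lambda>t. exp (- t)) has_real_derivative - exp (- t)) (at t)" for t :: real
    by (auto intro!: derivative_eq_intros)
  from dzbar_of_real_compose[OF this smooth_quadratic_weight]
  show ?thesis by (simp add: dzbar_quadratic_weight mult_ac)
qed

section \<open>Bounds on bounded sets\<close>

lemma smooth_bounded:
  fixes G :: "'a::euclidean_space \<Rightarrow> 'b::real_normed_vector"
  assumes "smooth G" "bounded S"
  shows "\<exists>C>0. \<forall>x\<in>S. norm (G x) \<le> C"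
proof -
  have "bounded (G ` closure S)"
    using assms by (intro compact_imp_bounded compact_continuous_image smooth_continuous_on) auto
  then obtain C where "C > 0" "\<forall>y\<in>G ` closure S. norm y \<le> C" by (auto simp: bounded_pos)
  then show ?thesis using closure_subset by (intro exI[of _ C]) blast
qed

lemma fd_Basis:
  fixes G :: "'a::euclidean_space \<Rightarrow> 'b::real_normed_vector"
  assumes "smooth G"
  shows "fd G x v = (\<Sum>b\<in>Basis. inner v b *\<^sub>R fd G x b)"
proof -
  have l: "linear (fd G x)"
    using smooth_has_derivative[OF assms] has_derivative_linear by blast
  have "fd G x v = fd G x (\<Sum>b\<in>Basis. inner v b *\<^sub>R b)"
    by (simp add: euclidean_representation)
  then show ?thesis using l by (simp add: linear_sum linear_cmul)
qed

lemma smooth_derivative_bounded: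
  fixes G :: "'a::euclidean_space \<Rightarrow> 'b::real_normed_vector"
  assumes "smooth G" "bounded S"
  shows "\<exists>C>0. \<forall>x\<in>S. \<forall>v. norm (fd G x v) \<le> C * norm v"
proof -
  have "\<forall>b. \<exists>C>0. \<forall>x\<in>S. norm (fd G x b) \<le> C"
    using smooth_bounded[OF smooth_fd[OF assms(1)] assms(2)] by blast
  then obtain C where C: "\<And>b. C b > 0" "\<And>b x. x \<in> S \<Longrightarrow> norm (fd G x b) \<le> C b"
    by metis
  have "norm (fd G x v) \<le> (\<Sum>b\<in>Basis. C b) * norm v" if "x \<in> S" for x v
  proof -
    have "norm (fd G x v) \<le> (\<Sum>b\<in>Basis. norm (inner v b *\<^sub>R fd G x b))"
      unfolding fd_Basis[OF assms(1), of x v] by (rule norm_sum)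
    also have "\<dots> \<le> (\<Sum>b\<in>Basis. norm v * C b)"
      using C(2)[OF that] by (intro sum_mono) (auto intro!: mult_mono Basis_le_norm)
    also have "\<dots> = (\<Sum>b\<in>Basis. C b) * norm v"
      by (simp add: sum_distrib_left mult.commute)
    finally show ?thesis .
  qed
  then show ?thesis using C(1) by (intro exI[of _ "\<Sum>b\<in>Basis. C b"]) (auto intro!: sum_pos)
qed

lemma smooth_lipschitz:
  fixes G :: "'a::euclidean_space \<Rightarrow> 'b::real_normed_vector"
  assumes "smooth G" "bounded S" "convex S"
  shows "\<exists>L>0. \<forall>x\<in>S. \<forall>y\<in>S. norm (G x - G y) \<le> L * norm (x - y)"
proof -
  obtain C where C: "C > 0" "\<forall>x\<in>S. \<forall>v. norm (fd G x v) \<le> C * norm v"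
    using smooth_derivative_bounded[OF assms(1,2)] by blast
  have "norm (G x - G y) \<le> C * norm (x - y)" if "x \<in> S" "y \<in> S" for x y
  proof (rule differentiable_bound[OF assms(3) _ _ that(1) that(2)])
    fix x assume x: "x \<in> S"
    show "(G has_derivative fd G x) (at x within S)"
      using smooth_has_derivative[OF assms(1)] has_derivative_at_withinI by blast
    show "onorm (fd G x) \<le> C"
      using C x by (intro onorm_le) auto
  qed
  then show ?thesis using C(1) by blast
qed

text \<open>By the mean value theorem the remainder is a difference of derivatives at two points of
  S, controlled by the Lipschitz constants of the derivatives along a basis. It is the second-order
  control behind \<open>near_frontier\<close> and \<open>exterior_ball\<close>.\<close>

lemma smooth_taylor_bound:
  fixes \<rho> :: "'a::euclidean_space \<Rightarrow> real"
  assumes "smooth \<rho>" "bounded S" "convex S"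
  shows "\<exists>C>0. \<forall>x\<in>S. \<forall>y\<in>S. \<bar>\<rho> y - \<rho> x - fd \<rho> x (y - x)\<bar> \<le> C * (norm (y - x))\<^sup>2"
proof -
  have "\<forall>b. \<exists>L>0. \<forall>x\<in>S. \<forall>y\<in>S. norm (fd \<rho> x b - fd \<rho> y b) \<le> L * norm (x - y)"
    using smooth_lipschitz[OF smooth_fd[OF assms(1)] assms(2,3)] by blast
  then obtain L where L: "\<And>b. L b > 0" "\<And>b x y. x \<in> S \<Longrightarrow> y \<in> S \<Longrightarrow>
      norm (fd \<rho> x b - fd \<rho> y b) \<le> L b * norm (x - y)"
    by metis
  let ?C = "\<Sum>b\<in>(Basis::'a set). L b"
  have "\<bar>\<rho> y - \<rho> x - fd \<rho> x (y - x)\<bar> \<le> ?C * (norm (y - x))\<^sup>2" if x: "x \<in> S" and y: "y \<in> S" for x y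
  proof -
    define \<gamma> where "\<gamma> = (\<lambda>t::real. x + t *\<^sub>R (y - x))"
    have d: "((\<lambda>t. \<rho> (\<gamma> t)) has_real_derivative fd \<rho> (\<gamma> t) (y - x)) (at t)" for t
    proof -
      have 1: "(\<gamma> has_derivative (\<lambda>s. s *\<^sub>R (y - x))) (at t)"
        unfolding \<gamma>_def by (auto intro!: derivative_eq_intros)
      have "((\<lambda>t. \<rho> (\<gamma> t)) has_derivative (\<lambda>r. fd \<rho> (\<gamma> t) (r *\<^sub>R (y - x)))) (at t)"
        by (rule has_derivative_compose[OF 1 smooth_has_derivative[OF assms(1)]])
      moreover have "(\<lambda>r. fd \<rho> (\<gamma> t) (r *\<^sub>R (y - x))) = (*) (fd \<rho> (\<gamma> t) (y - x))"
        by (simp only: linear_cmul[OF has_derivative_linear[OF smooth_has_derivative[OF assms(1)]]])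
          (simp add: fun_eq_iff mult.commute)
      ultimately show ?thesis unfolding has_field_derivative_def by simp
    qed
    obtain t where t: "0 < t" "t < 1" "\<rho> (\<gamma> 1) - \<rho> (\<gamma> 0) = (1 - 0) * fd \<rho> (\<gamma> t) (y - x)"
      using MVT2[of 0 1 "\<lambda>t. \<rho> (\<gamma> t)", OF _ d] by auto
    have "\<gamma> t = (1 - t) *\<^sub>R x + t *\<^sub>R y" by (simp add: \<gamma>_def algebra_simps)
    then have \<gamma>: "\<gamma> t \<in> S" using convexD_alt[OF assms(3) x y] t by simp
    have "\<bar>\<rho> y - \<rho> x - fd \<rho> x (y - x)\<bar> =
        \<bar>fd \<rho> (\<gamma> t) (y - x) - fd \<rho> x (y - x)\<bar>"
      using t(3) by (simp add: \<gamma>_def)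
    also have "\<dots> = \<bar>\<Sum>b\<in>Basis. inner (y - x) b * (fd \<rho> (\<gamma> t) b - fd \<rho> x b)\<bar>"
      unfolding fd_Basis[OF assms(1), of _ "y - x"]
      by (simp add: sum_subtractf right_diff_distrib)
    also have "\<dots> \<le> (\<Sum>b\<in>Basis. \<bar>inner (y - x) b * (fd \<rho> (\<gamma> t) b - fd \<rho> x b)\<bar>)"
      by (rule sum_abs)
    also have "\<dots> \<le> (\<Sum>b\<in>Basis. norm (y - x) * (L b * norm (y - x)))"
    proof (rule sum_mono)
      fix b :: 'a assume b: "b \<in> Basis"
      have "norm (\<gamma> t - x) \<le> norm (y - x)"
        using t mult_right_mono[of t 1 "norm (y - x)"] by (simp add: \<gamma>_def)
      then have "L b * norm (\<gamma> t - x) \<le> L b * norm (y - x)"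
        using L(1)[of b] by (intro mult_left_mono) auto
      then have "\<bar>fd \<rho> (\<gamma> t) b - fd \<rho> x b\<bar> \<le> L b * norm (y - x)"
        using L(2)[OF \<gamma> x, of b] by simp
      then show "\<bar>inner (y - x) b * (fd \<rho> (\<gamma> t) b - fd \<rho> x b)\<bar>
          \<le> norm (y - x) * (L b * norm (y - x))"
        unfolding abs_mult using Basis_le_norm[OF b] by (intro mult_mono) auto
    qed
    also have "\<dots> = ?C * (norm (y - x))\<^sup>2"
      by (simp add: sum_distrib_left sum_distrib_right power2_eq_square mult_ac)
    finally show ?thesis .
  qed
  then show ?thesis using L(1) by (intro exI[of _ ?C]) (auto intro!: sum_pos)
qed

section \<open>Bounded domains with a normalized defining function\<close>

locale defined_domain =
  fixes D :: "'n::{finite,linorder} cspace set" and \<rho> :: "'n cspace \<Rightarrow> real"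
  assumes bounded_domain: "bounded D"
    and defining: "normalized_defining_function \<rho> D"
begin

lemma smooth_rho: "smooth \<rho>"
  using defining by (simp add: normalized_defining_function_def)

lemma domain_eq: "D = {z. \<rho> z < 0}"
  using defining by (simp add: normalized_defining_function_def)

lemma open_domain: "open D"
  unfolding domain_eq
  by (intro open_Collect_less smooth_continuous_on[OF smooth_rho] continuous_on_const)

lemma domain_sets [measurable]: "D \<in> sets borel" "D \<in> sets lebesgue"
  using open_domain by auto

lemma closure_rho: "z \<in> closure D \<Longrightarrow> \<rho> z \<le> 0"
proof -
  have "closed {z. \<rho> z \<le> 0}"
    by (intro closed_Collect_le smooth_continuous_on[OF smooth_rho] continuous_on_const)
  then have "closure D \<subseteq> {z. \<rho> z \<le> 0}" by (intro closure_minimal) (auto simp: domain_eq)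
  then show "z \<in> closure D \<Longrightarrow> \<rho> z \<le> 0" by auto
qed

lemma frontier_rho: "z \<in> frontier D \<Longrightarrow> \<rho> z = 0"
  using closure_rho[of z] open_domain by (force simp: frontier_def interior_open domain_eq)

text \<open>Built from directional derivatives so that it is defined and smooth everywhere; the
  gradient in \<open>normalized_defining_function\<close> is only asserted to exist at boundary
  points.\<close>

definition grad :: "'n cspace \<Rightarrow> 'n cspace" where
  "grad z = (\<Sum>b\<in>Basis. fd \<rho> z b *\<^sub>R b)"

lemma fd_rho: "fd \<rho> z v = inner v (grad z)"
  unfolding grad_def fd_Basis[OF smooth_rho, of z v]
  by (simp add: inner_sum_right mult.commute)

lemma GDERIV_rho: "GDERIV \<rho> z :> grad z"
  unfolding gderiv_def using smooth_has_derivative[OF smooth_rho, of z]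
  by (simp add: fd_rho[abs_def])

lemma smooth_grad: "smooth grad"
  unfolding grad_def[abs_def]
  by (intro smooth_sum smooth_bounded_linear[OF bounded_linear_scaleR_left]
      smooth_fd[OF smooth_rho])

lemma norm_grad: "p \<in> frontier D \<Longrightarrow> norm (grad p) = 1"
proof -
  assume "p \<in> frontier D"
  then obtain g where g: "GDERIV \<rho> p :> g" "norm g = 1"
    using defining by (auto simp: normalized_defining_function_def)
  have "(\<lambda>h. inner h g) = (\<lambda>h. inner h (grad p))"
    using g(1) GDERIV_rho[of p] unfolding gderiv_def by (rule has_derivative_unique)
  then have "inner h g = inner h (grad p)" for h by metis
  then have "g = grad p" using vector_eq_ldot[of g "grad p"] by blast
  then show "norm (grad p) = 1" using g by simp
qed

abbreviation rho_z :: "'n \<Rightarrow> 'n cspace \<Rightarrow> complex" where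
  "rho_z i \<equiv> dz i (\<lambda>z. complex_of_real (\<rho> z))"

text \<open>Its vanishing on the boundary for all K is the condition that characterizes the smooth
  forms in the domain of the adjoint.\<close>

abbreviation contraction :: "'n form \<Rightarrow> 'n list \<Rightarrow> 'n cspace \<Rightarrow> complex" where
  "contraction F K z \<equiv> \<Sum>i\<in>UNIV. rho_z i z * F z (i # K)"

lemma smooth_rho_z [intro]: "smooth (rho_z i)"
  by (intro smooth_dz smooth_of_real smooth_rho)

lemma rho_z: "rho_z i z = cnj (grad z $ i) / 2"
  by (rule dz_GDERIV[OF GDERIV_rho])

lemma sum_rho_z_sq: "(\<Sum>i\<in>UNIV. rho_z i z * cnj (rho_z i z)) = complex_of_real ((norm (grad z))\<^sup>2 / 4)"
proof -
  have "(norm (grad z))\<^sup>2 = (\<Sum>i\<in>UNIV. (cmod (grad z $ i))\<^sup>2)"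
    by (simp add: norm_vec_def L2_set_def sum_nonneg)
  then show ?thesis
    by (simp add: rho_z complex_norm_square[symmetric] sum_divide_distrib mult.commute[of "cnj _"])
qed

text \<open>On the compact part of the closure where the gradient is short, \<open>\<rho>\<close> is
  negative and therefore bounded away from 0 by its maximum there.\<close>

lemma grad_near_frontier: "\<exists>\<delta>>0. \<forall>z\<in>D. \<rho> z > - \<delta> \<longrightarrow> norm (grad z) \<ge> 1 / 2"
proof -
  let ?K = "closure D \<inter> {z. norm (grad z) \<le> 1 / 2}"
  have "closed {z. norm (grad z) \<le> 1 / 2}"
    by (intro closed_Collect_le continuous_on_norm smooth_continuous_on[OF smooth_grad] continuous_on_const)
  then have K: "compact ?K"
    using bounded_domain by (intro compact_Int_closed) auto
  have neg: "\<rho> z < 0" if "z \<in> ?K" for z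
  proof (rule ccontr)
    assume "\<not> \<rho> z < 0"
    then have "z \<in> frontier D" using that open_domain by (auto simp: frontier_def interior_open domain_eq)
    then show False using norm_grad[of z] that by auto
  qed
  show ?thesis
  proof (cases "?K = {}")
    case True
    have "norm (grad z) \<ge> 1 / 2" if "z \<in> D" for z
    proof (rule ccontr)
      assume "\<not> norm (grad z) \<ge> 1 / 2"
      then have "z \<in> ?K" using that subsetD[OF closure_subset] by auto
      then show False using True by blast
    qed
    then show ?thesis by (intro exI[of _ 1]) auto
  next
    case False
    obtain m where m: "m \<in> ?K" "\<forall>z\<in>?K. \<rho> z \<le> \<rho> m"
      using continuous_attains_sup[OF K False smooth_continuous_on[OF smooth_rho]] by auto
    have "norm (grad z) \<ge> 1 / 2" if "z \<in> D" "\<rho> z > \<rho> m" for z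
    proof (rule ccontr)
      assume "\<not> norm (grad z) \<ge> 1 / 2"
      then have "z \<in> ?K" using that subsetD[OF closure_subset] by auto
      from bspec[OF m(2) this] show False using that(2) by linarith
    qed
    then show ?thesis using neg[OF m(1)] by (intro exI[of _ "- \<rho> m"]) auto
  qed
qed

text \<open>Moving from an interior point z along the gradient by a multiple of the negative of \<open>\<rho> z\<close> leaves D.\<close>

lemma near_frontier:
  "\<exists>t\<^sub>0>0. \<exists>M>0. \<forall>z\<in>D. - \<rho> z < t\<^sub>0 \<longrightarrow> (\<exists>x\<in>frontier D. norm (z - x) \<le> M * \<bar>\<rho> z\<bar>)"
proof -
  obtain \<delta> where \<delta>: "\<delta> > 0" "\<And>z. z \<in> D \<Longrightarrow> \<rho> z > - \<delta> \<Longrightarrow> norm (grad z) \<ge> 1 / 2"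
    using grad_near_frontier by blast
  obtain N where N: "N > 0" "\<And>z. z \<in> D \<Longrightarrow> norm (grad z) \<le> N"
    using smooth_bounded[OF smooth_grad bounded_domain] by blast
  obtain R where R: "\<And>z. z \<in> D \<Longrightarrow> norm z \<le> R"
    using bounded_domain by (auto simp: bounded_iff)
  define S where "S = cball (0::'n cspace) (R + 8 * N)"
  obtain C where C: "C > 0" "\<And>x y. x \<in> S \<Longrightarrow> y \<in> S \<Longrightarrow>
      \<bar>\<rho> y - \<rho> x - fd \<rho> x (y - x)\<bar> \<le> C * (norm (y - x))\<^sup>2"
    using smooth_taylor_bound[OF smooth_rho, of S] unfolding S_def by (auto simp: convex_cball)
  \<comment> \<open>A step of length 8t along a gradient of norm at least 1/2 gains 2t to first
    order, twice the deficit t = \<open>- \<rho> z\<close>. The bound 1 / (64 C N^2) keeps the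
    quadratic error C (8tN)^2 below t, and the bound 1 keeps the end point in the ball S.\<close>
  define t0 where "t0 = min 1 (min \<delta> (1 / (64 * C * N\<^sup>2)))"
  have t0: "t0 > 0" using \<delta> C N by (simp add: t0_def)
  have "\<exists>x\<in>frontier D. norm (z - x) \<le> (8 * N) * \<bar>\<rho> z\<bar>" if z: "z \<in> D" and small: "- \<rho> z < t0" for z
  proof -
    define t where "t = - \<rho> z"
    have t: "t > 0" "t < 1" "t < \<delta>" "t < 1 / (64 * C * N\<^sup>2)"
      using z small by (auto simp: t_def t0_def domain_eq)
    have g: "norm (grad z) \<ge> 1 / 2" using \<delta>(2)[OF z] t by (simp add: t_def)
    define y where "y = z + (8 * t) *\<^sub>R grad z"
    have yz: "norm (y - z) \<le> 8 * t * N"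
      using t N(2)[OF z] by (simp add: y_def)
    have "8 * t * N \<le> 8 * N" using t N by simp
    then have "norm (y - z) \<le> 8 * N" using yz by linarith
    then have yS: "y \<in> S" using R[OF z] norm_triangle_ineq[of z "y - z"] by (simp add: S_def)
    have zS: "z \<in> S" using R[OF z] N by (simp add: S_def)
    have "fd \<rho> z (y - z) = 8 * t * (norm (grad z))\<^sup>2"
      by (simp add: fd_rho y_def power2_norm_eq_inner)
    moreover have "(norm (grad z))\<^sup>2 \<ge> (1 / 2)\<^sup>2" using g by (intro power_mono) auto
    ultimately have d: "fd \<rho> z (y - z) \<ge> 2 * t"
      using t mult_left_mono[of "1/4" "(norm (grad z))\<^sup>2" "8 * t"] by (simp add: power2_eq_square)
    have "C * (norm (y - z))\<^sup>2 \<le> C * (8 * t * N)\<^sup>2"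
      using yz C(1) by (intro mult_left_mono power_mono) auto
    also have "\<dots> = t * (t * (64 * C * N\<^sup>2))" by (simp add: power2_eq_square)
    also have "\<dots> < t * 1"
      using t C(1) N(1) by (intro mult_strict_left_mono) (auto simp: field_simps)
    finally have "C * (norm (y - z))\<^sup>2 < t" by simp
    moreover have "\<rho> y \<ge> \<rho> z + fd \<rho> z (y - z) - C * (norm (y - z))\<^sup>2"
      using C(2)[OF zS yS] by linarith
    ultimately have "\<rho> y > 0" using d unfolding t_def by linarith
    then have "y \<notin> D" by (simp add: domain_eq)
    then have "closed_segment z y \<inter> frontier D \<noteq> {}"
      using z by (intro connected_Int_frontier) auto
    then obtain x where x: "x \<in> closed_segment z y" "x \<in> frontier D" by blast
    have "norm (z - x) \<le> norm (y - z)"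
      using segment_bound(1)[OF x(1)] by (simp add: norm_minus_commute)
    then have "norm (z - x) \<le> (8 * N) * \<bar>\<rho> z\<bar>" using yz t(1) by (simp add: t_def mult_ac)
    then show ?thesis using x by blast
  qed
  then show ?thesis using t0 N(1) by (intro exI[of _ t0] conjI exI[of _ "8 * N"]) auto
qed

text \<open>Near the boundary, G is compared with its value 0 at a boundary point at distance
  O(\<open>\<rho>\<close>) by a Lipschitz estimate; in the rest of D, \<open>\<rho>\<close> is
  bounded away from 0 and boundedness of G suffices.\<close>

lemma vanishing_on_frontier_bound:
  fixes G :: "'n cspace \<Rightarrow> complex"
  assumes G: "smooth G" and zero: "\<And>z. z \<in> frontier D \<Longrightarrow> G z = 0"
  shows "\<exists>C>0. \<forall>z\<in>D. cmod (G z) \<le> C * \<bar>\<rho> z\<bar>"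
proof -
  obtain t0 M where tM: "t0 > 0" "M > 0"
      "\<And>z. z \<in> D \<Longrightarrow> - \<rho> z < t0 \<Longrightarrow> \<exists>x\<in>frontier D. norm (z - x) \<le> M * \<bar>\<rho> z\<bar>"
    using near_frontier by blast
  obtain R where R: "closure D \<subseteq> cball 0 R"
    using bounded_closure[OF bounded_domain] by (auto simp: bounded_iff subset_iff)
  obtain L where L: "L > 0" "\<And>x y. x \<in> cball 0 R \<Longrightarrow> y \<in> cball 0 R \<Longrightarrow> cmod (G x - G y) \<le> L * norm (x - y)"
    using smooth_lipschitz[OF G bounded_cball convex_cball] by blast
  obtain B where B: "B > 0" "\<And>z. z \<in> D \<Longrightarrow> cmod (G z) \<le> B"
    using smooth_bounded[OF G bounded_domain] by blast
  define C where "C = max (L * M) (B / t0)"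
  have C: "C > 0" using L tM by (simp add: C_def less_max_iff_disj)
  have "cmod (G z) \<le> C * \<bar>\<rho> z\<bar>" if z: "z \<in> D" for z
  proof (cases "- \<rho> z < t0")
    case True
    then obtain x where x: "x \<in> frontier D" "norm (z - x) \<le> M * \<bar>\<rho> z\<bar>" using tM(3) z by blast
    have "x \<in> cball 0 R" "z \<in> cball 0 R"
      using x(1) subsetD[OF closure_subset z] R unfolding frontier_def by blast+
    then have "cmod (G z) \<le> L * norm (z - x)" using L(2)[of z x] zero[OF x(1)] by simp
    also have "\<dots> \<le> L * (M * \<bar>\<rho> z\<bar>)" using x L by simp
    also have "\<dots> = (L * M) * \<bar>\<rho> z\<bar>" by simp
    also have "\<dots> \<le> C * \<bar>\<rho> z\<bar>" by (intro mult_right_mono) (auto simp: C_def)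
    finally show ?thesis .
  next
    case False
    have "B = (B / t0) * t0" using tM(1) by simp
    also have "\<dots> \<le> (B / t0) * \<bar>\<rho> z\<bar>"
      using False B(1) tM(1) by (intro mult_left_mono) auto
    finally have "B \<le> (B / t0) * \<bar>\<rho> z\<bar>" .
    moreover have "\<dots> \<le> C * \<bar>\<rho> z\<bar>" by (intro mult_right_mono) (auto simp: C_def)
    ultimately show ?thesis using B(2)[OF z] by linarith
  qed
  then show ?thesis using C by blast
qed

text \<open>Since \<open>\<rho>\<close> is negative on D and 0 at p, Taylor's bound makes the normal
  component of z - p at most C |z - p|^2. The surplus |z - p|^2 / 2 is kept because the
  concentration argument needs a quantitative gap away from p, not just that p is nearest.\<close>

lemma exterior_ball:
  assumes p: "p \<in> frontier D"
  shows "\<exists>r>0. \<forall>z\<in>D. (norm (z - (p + r *\<^sub>R grad p)))\<^sup>2 \<ge> r\<^sup>2 + (norm (z - p))\<^sup>2 / 2"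
proof -
  obtain R where R: "closure D \<subseteq> cball 0 R"
    using bounded_closure[OF bounded_domain] by (auto simp: bounded_iff subset_iff)
  obtain C where C: "C > 0" "\<And>x y. x \<in> cball 0 R \<Longrightarrow> y \<in> cball 0 R \<Longrightarrow>
      \<bar>\<rho> y - \<rho> x - fd \<rho> x (y - x)\<bar> \<le> C * (norm (y - x))\<^sup>2"
    using smooth_taylor_bound[OF smooth_rho bounded_cball convex_cball] by blast
  \<comment> \<open>This radius bounds the cross term 2r times the normal component by half of |z -
    p|^2.\<close>
  define r where "r = 1 / (4 * C)"
  have r: "r > 0" using C by (simp add: r_def)
  have "(norm (z - (p + r *\<^sub>R grad p)))\<^sup>2 \<ge> r\<^sup>2 + (norm (z - p))\<^sup>2 / 2" if z: "z \<in> D" for z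
  proof -
    have "p \<in> cball 0 R" "z \<in> cball 0 R"
      using p subsetD[OF closure_subset z] R unfolding frontier_def by blast+
    from C(2)[OF this] have "inner (z - p) (grad p) \<le> C * (norm (z - p))\<^sup>2"
      using frontier_rho[OF p] z by (simp add: fd_rho domain_eq abs_le_iff)
    then have "2 * r * inner (z - p) (grad p) \<le> 2 * r * (C * (norm (z - p))\<^sup>2)"
      using r by (intro mult_left_mono) auto
    also have "\<dots> = (norm (z - p))\<^sup>2 / 2" using C(1) by (simp add: r_def field_simps)
    finally have 1: "2 * r * inner (z - p) (grad p) \<le> (norm (z - p))\<^sup>2 / 2" .
    have "(norm (z - (p + r *\<^sub>R grad p)))\<^sup>2 = (norm ((z - p) - r *\<^sub>R grad p))\<^sup>2" by (simp add: algebra_simps)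
    also have "\<dots> = (norm (z - p))\<^sup>2 - 2 * r * inner (z - p) (grad p) + r\<^sup>2 * (norm (grad p))\<^sup>2"
      by (simp only: power2_norm_eq_inner)
        (simp add: inner_diff_left inner_diff_right inner_commute power2_eq_square algebra_simps)
    finally show ?thesis using 1 norm_grad[OF p] by simp
  qed
  then show ?thesis using r by blast
qed

end

section \<open>Combinatorics of multi-indices\<close>

lemma finite_multi_indices [simp]: "finite (multi_indices q :: 'n::{finite,linorder} list set)"
  by (rule finite_subset[OF _ finite_lists_length_eq[of UNIV q]]) (auto simp: multi_indices_def)

lemma delete_nth_strict_sorted:
  fixes J :: "'a::linorder list"
  assumes "sorted_wrt (<) J" "k < length J"
  shows "sorted_wrt (<) (delete_nth k J)" "set (delete_nth k J) = set J - {J ! k}"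
    "length (delete_nth k J) = length J - 1"
proof -
  have J: "J = take k J @ J ! k # drop (Suc k) J" using assms(2) by (rule id_take_nth_drop)
  have s: "sorted_wrt (<) (take k J @ J ! k # drop (Suc k) J)" using assms(1) J by simp
  then show "sorted_wrt (<) (delete_nth k J)"
    unfolding delete_nth_def sorted_wrt_append by auto
  have "set J = insert (J ! k) (set (delete_nth k J))"
    by (subst (1) J) (auto simp: delete_nth_def)
  moreover have "J ! k \<notin> set (delete_nth k J)"
    using s unfolding delete_nth_def sorted_wrt_append by fastforce
  ultimately show "set (delete_nth k J) = set J - {J ! k}" by auto
  show "length (delete_nth k J) = length J - 1" using assms(2) by (simp add: delete_nth_def)
qed

lemma covectors_delete_nth:
  assumes "\<alpha> \<in> covectors q" "k < length J"
  shows "(-1) ^ k * \<alpha> J = \<alpha> (J ! k # delete_nth k J)"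
proof -
  have "\<alpha> (take k J @ J ! k # drop (Suc k) J) = (-1) ^ k * \<alpha> (J ! k # delete_nth k J)"
    using covectors_move[OF assms(1), of "take k J" "J ! k" "drop (Suc k) J"] assms(2)
    by (simp add: delete_nth_def)
  then have "\<alpha> J = (-1) ^ k * \<alpha> (J ! k # delete_nth k J)"
    using id_take_nth_drop[OF assms(2)] by simp
  moreover have "(-1) ^ k * (-1) ^ k = (1::complex)" by (simp flip: power_mult_distrib)
  ultimately show ?thesis by (metis mult.assoc mult_1)
qed

text \<open>Removing the k-th entry of J and inserting j into K in order are inverse bijections; the
  pairs with j already in K contribute 0 by skew-symmetry, so the sum over j may run over all
  indices. The covector may depend on j because in the adjoint identity j is also the direction of
  differentiation.\<close>

lemma sum_delete_nth:
  fixes A :: "'n::{finite,linorder} \<Rightarrow> 'n list \<Rightarrow> complex"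
  assumes A: "\<And>j. A j \<in> covectors (Suc q)"
  shows "(\<Sum>J\<in>multi_indices (Suc q). \<Sum>k<Suc q. (-1) ^ k * (X (delete_nth k J) (J ! k) * A (J ! k) J)) =
    (\<Sum>K\<in>multi_indices q. \<Sum>j\<in>UNIV. X K j * A j (j # K))"
proof -
  define S where "S = (multi_indices (Suc q) :: 'n list set) \<times> {..<Suc q}"
  define T where "T = {(K, j). K \<in> (multi_indices q :: 'n list set) \<and> j \<notin> set K}"
  define h where "h = (\<lambda>(J::'n list, k). (delete_nth k J, J ! k))"
  have S: "sorted_wrt (<) J" "length J = Suc q" "k < length J" if "(J, k) \<in> S" for J k
    using that by (auto simp: S_def multi_indices_def)
  have inj: "inj_on h S"
  proof (rule inj_onI)
    fix x y assume "x \<in> S" "y \<in> S" and e: "h x = h y"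
    moreover obtain J k J' k' where x: "x = (J, k)" and y: "y = (J', k')" by (cases x, cases y)
    ultimately have J: "sorted_wrt (<) J" "k < length J" and J': "sorted_wrt (<) J'" "k' < length J'"
      using S by blast+
    have e': "delete_nth k J = delete_nth k' J'" "J ! k = J' ! k'" using e by (auto simp: h_def x y)
    have "set J = insert (J ! k) (set (delete_nth k J))" "set J' = insert (J' ! k') (set (delete_nth k' J'))"
      using delete_nth_strict_sorted(2)[OF J] delete_nth_strict_sorted(2)[OF J'] J(2) J'(2) by auto
    then have "J = J'" using J(1) J'(1) e' by (auto simp: strict_sorted_iff intro: sorted_distinct_set_unique)
    moreover have "k = k'"
      using e'(2) J J' \<open>J = J'\<close> by (simp add: strict_sorted_iff nth_eq_iff_index_eq)
    ultimately show "x = y" by (simp add: x y)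
  qed
  have img: "h ` S = T"
  proof (intro equalityI subsetI)
    fix y assume "y \<in> h ` S"
    then obtain J k where Jk: "(J, k) \<in> S" "y = (delete_nth k J, J ! k)" by (auto simp: h_def)
    then show "y \<in> T"
      using delete_nth_strict_sorted[OF S(1) S(3), OF Jk(1) Jk(1)] S(2)[OF Jk(1)]
      by (auto simp: T_def multi_indices_def)
  next
    fix y assume "y \<in> T"
    then obtain K j where y: "y = (K, j)" "sorted_wrt (<) K" "length K = q" "j \<notin> set K"
      by (auto simp: T_def multi_indices_def)
    define J where "J = insort j K"
    have J: "sorted_wrt (<) J" "length J = Suc q" "set J = insert j (set K)"
      using y by (auto simp: J_def strict_sorted_iff set_insort_key sorted_insort distinct_insort)
    obtain k where k: "k < length J" "J ! k = j" using J(3) by (metis in_set_conv_nth insertI1)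
    have "set (delete_nth k J) = set K"
      using delete_nth_strict_sorted(2)[OF J(1) k(1)] k J(3) y(4) by auto
    then have "delete_nth k J = K"
      using delete_nth_strict_sorted(1)[OF J(1) k(1)] y(2)
      by (auto simp: strict_sorted_iff intro: sorted_distinct_set_unique)
    then have "h (J, k) = y" "(J, k) \<in> S"
      using J k y by (auto simp: S_def h_def multi_indices_def)
    then show "y \<in> h ` S" by force
  qed
  define F where "F = (\<lambda>(K, j). X K j * A j (j # K))"
  have "(\<Sum>J\<in>multi_indices (Suc q). \<Sum>k<Suc q. (-1) ^ k * (X (delete_nth k J) (J ! k) * A (J ! k) J)) =
      (\<Sum>(J, k)\<in>S. (-1) ^ k * (X (delete_nth k J) (J ! k) * A (J ! k) J))"
    unfolding S_def by (rule sum.cartesian_product)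
  also have "\<dots> = (\<Sum>x\<in>S. F (h x))"
  proof (rule sum.cong[OF refl])
    fix x assume "x \<in> S"
    moreover obtain J k where x: "x = (J, k)" by (cases x)
    ultimately have k: "k < length J" using S by blast
    have "(-1) ^ k * (X (delete_nth k J) (J ! k) * A (J ! k) J) = X (delete_nth k J) (J ! k) * ((-1) ^ k * A (J ! k) J)"
      by simp
    also have "\<dots> = F (h x)" unfolding covectors_delete_nth[OF A k] by (simp add: F_def h_def x)
    finally show "(case x of (J, k) \<Rightarrow> (-1) ^ k * (X (delete_nth k J) (J ! k) * A (J ! k) J)) = F (h x)"
      by (simp add: x)
  qed
  also have "\<dots> = sum F T" using sum.reindex[OF inj, of F] img by simp
  also have "\<dots> = sum F (multi_indices q \<times> UNIV)"
  proof (rule sum.mono_neutral_left)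
    show "\<forall>x\<in>multi_indices q \<times> UNIV - T. F x = 0"
      using covectors_repeated[OF A] by (auto simp: T_def F_def)
  qed (auto simp: T_def)
  also have "\<dots> = (\<Sum>K\<in>multi_indices q. \<Sum>j\<in>UNIV. X K j * A j (j # K))"
    unfolding F_def by (rule sum.cartesian_product[symmetric])
  finally show ?thesis .
qed

text \<open>Following only whether a coefficient vanishes avoids tracking the signs of sorting; the
  prefix P lets the induction exchange entries in the middle of a list.\<close>

lemma covectors_insort:
  assumes \<alpha>: "\<alpha> \<in> covectors q"
  shows "\<alpha> (P @ insort x xs) = 0 \<Longrightarrow> \<alpha> (P @ x # xs) = 0"
proof (induction xs arbitrary: P)
  case (Cons y xs)
  show ?case
  proof (cases "x \<le> y")
    case False
    then have "\<alpha> ((P @ [y]) @ x # xs) = 0" using Cons.IH[of "P @ [y]"] Cons.prems by simp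
    then show ?thesis using covectors_swap[OF \<alpha>, of P x y xs] by simp
  qed (use Cons.prems in simp)
qed simp

lemma covectors_sort:
  assumes \<alpha>: "\<alpha> \<in> covectors q"
  shows "\<alpha> (P @ sort xs) = 0 \<Longrightarrow> \<alpha> (P @ xs) = 0"
proof (induction xs arbitrary: P)
  case (Cons x xs)
  have "\<alpha> (P @ x # sort xs) = 0" by (rule covectors_insort[OF \<alpha>]) (use Cons.prems in simp)
  then show ?case using Cons.IH[of "P @ [x]"] by simp
qed simp

text \<open>Lists of distinct entries are sorted into increasing ones; with a repeated entry the
  coefficient vanishes by skew-symmetry anyway.\<close>

lemma covectors_eq_0:
  fixes \<alpha> :: "'n::{finite,linorder} list \<Rightarrow> complex"
  assumes \<alpha>: "\<alpha> \<in> covectors q" and zero: "\<And>I. I \<in> multi_indices q \<Longrightarrow> \<alpha> I = 0"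
  shows "\<alpha> I = 0"
proof (cases "length I = q \<and> distinct I")
  case True
  then have "\<alpha> ([] @ sort I) = 0" by (auto intro!: zero simp: multi_indices_def strict_sorted_iff)
  from covectors_sort[OF \<alpha> this] show ?thesis by simp
next
  case False
  then consider "length I \<noteq> q" | "\<not> distinct I" by blast
  then show ?thesis
  proof cases
    case 1
    then show ?thesis by (rule covectors_length[OF \<alpha>])
  next
    case 2
    then obtain xs ys zs y where "I = xs @ y # ys @ y # zs"
      using not_distinct_decomp[of I] by auto
    then show ?thesis
      using covectors_move[OF \<alpha>, of xs y "ys @ y # zs"] covectors_repeated[OF \<alpha>, of y "xs @ ys @ y # zs"] by simp
  qed
qed

section \<open>Exterior products of (0,1)-forms\<close>

text \<open>The Leibniz expansion of the minor with columns I: the coefficients of the exterior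
  product of the \<open>\<omega> l\<close>. The explicit sum over permutations is convenient for
  differentiating products and for exchanging entries.\<close>

definition wedge :: "nat \<Rightarrow> (nat \<Rightarrow> 'n \<Rightarrow> complex) \<Rightarrow> 'n list \<Rightarrow> complex" where
  "wedge q \<omega> I = (if length I = q
     then \<Sum>\<sigma> | \<sigma> permutes {..<q}. of_int (sign \<sigma>) * (\<Prod>l<q. \<omega> (\<sigma> l) (I ! l)) else 0)"

lemma sign_compose_transpose:
  assumes "\<sigma> permutes {..<q::nat}" "j \<noteq> k"
  shows "sign (\<sigma> \<circ> Transposition.transpose j k) = - sign \<sigma>"
  using sign_compose[OF permutes_imp_permutation[OF finite_lessThan assms(1)] permutation_swap_id[of j k]]
    assms(2) by (simp add: sign_swap_id)

lemma nth_swap: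
  assumes "j < length I" "k < length I" "l < length I"
  shows "I[j := I ! k, k := I ! j] ! l = I ! Transposition.transpose j k l"
  using assms by (auto simp: nth_list_update Transposition.transpose_def)

lemma wedge_covector:
  fixes \<omega> :: "nat \<Rightarrow> 'n \<Rightarrow> complex"
  shows "wedge q \<omega> \<in> covectors q"
  unfolding covectors_def
proof (intro CollectI conjI allI impI)
  fix I :: "'n list" and j k assume I: "length I = q" "j < k" "k < q"
  let ?t = "Transposition.transpose j k"
  let ?I = "I[j := I ! k, k := I ! j]"
  have t: "?t permutes {..<q}" using I by (auto intro: permutes_swap_id)
  have nth: "?I ! l = I ! ?t l" if "l < q" for l
    using that I by (intro nth_swap) auto
  have "wedge q \<omega> ?I = (\<Sum>\<sigma> | \<sigma> permutes {..<q}. of_int (sign \<sigma>) * (\<Prod>l<q. \<omega> (\<sigma> l) (?I ! l)))"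
    using I by (simp add: wedge_def)
  also have "\<dots> = (\<Sum>\<sigma> | \<sigma> permutes {..<q}. of_int (sign (\<sigma> \<circ> ?t)) * (\<Prod>l<q. \<omega> ((\<sigma> \<circ> ?t) l) (?I ! l)))"
    by (rule sum_permutations_compose_right[OF t])
  also have "\<dots> = (\<Sum>\<sigma> | \<sigma> permutes {..<q}. - (of_int (sign \<sigma>) * (\<Prod>l<q. \<omega> (\<sigma> l) (I ! l))))"
  proof (rule sum.cong[OF refl])
    fix \<sigma> assume "\<sigma> \<in> {\<sigma>. \<sigma> permutes {..<q}}"
    then have s: "sign (\<sigma> \<circ> ?t) = - sign \<sigma>" using I by (intro sign_compose_transpose) auto
    have "(\<Prod>l<q. \<omega> ((\<sigma> \<circ> ?t) l) (?I ! l)) = (\<Prod>l<q. ((\<lambda>l. \<omega> (\<sigma> l) (I ! l)) \<circ> ?t) l)"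
      by (rule prod.cong) (auto simp: nth)
    also have "\<dots> = (\<Prod>l<q. \<omega> (\<sigma> l) (I ! l))"
      using prod.permute[OF t, of "\<lambda>l. \<omega> (\<sigma> l) (I ! l)"] by simp
    finally show "of_int (sign (\<sigma> \<circ> ?t)) * (\<Prod>l<q. \<omega> ((\<sigma> \<circ> ?t) l) (?I ! l)) =
        - (of_int (sign \<sigma>) * (\<Prod>l<q. \<omega> (\<sigma> l) (I ! l)))"
      by (simp add: s)
  qed
  also have "\<dots> = - wedge q \<omega> I" using I by (simp add: wedge_def sum_negf)
  finally show "wedge q \<omega> ?I = - wedge q \<omega> I" .
qed (simp add: wedge_def)

text \<open>Only the factor in position 0 sees the contracted index, so the sum over i moves onto
  it. The arbitrary coefficients c serve both the gradient of \<open>\<rho>\<close> and the rows of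
  a Levi matrix.\<close>

lemma wedge_contraction:
  fixes c :: "'n::finite \<Rightarrow> complex"
  assumes "length K = q"
  shows "(\<Sum>i\<in>UNIV. c i * wedge (Suc q) \<omega> (i # K)) =
    (\<Sum>\<sigma> | \<sigma> permutes {..<Suc q}. of_int (sign \<sigma>) * (\<Sum>i\<in>UNIV. c i * \<omega> (\<sigma> 0) i) *
      (\<Prod>l<q. \<omega> (\<sigma> (Suc l)) (K ! l)))"
proof -
  have "(\<Sum>i\<in>UNIV. c i * wedge (Suc q) \<omega> (i # K)) =
    (\<Sum>i\<in>UNIV. \<Sum>\<sigma> | \<sigma> permutes {..<Suc q}. of_int (sign \<sigma>) * (c i * \<omega> (\<sigma> 0) i) *
      (\<Prod>l<q. \<omega> (\<sigma> (Suc l)) (K ! l)))"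
    using assms
    by (intro sum.cong refl) (simp add: wedge_def sum_distrib_left prod.lessThan_Suc_shift mult_ac del: prod.lessThan_Suc)
  also have "\<dots> = (\<Sum>\<sigma> | \<sigma> permutes {..<Suc q}. \<Sum>i\<in>UNIV. of_int (sign \<sigma>) * (c i * \<omega> (\<sigma> 0) i) *
      (\<Prod>l<q. \<omega> (\<sigma> (Suc l)) (K ! l)))"
    by (rule sum.swap)
  finally show ?thesis by (simp add: sum_distrib_left sum_distrib_right)
qed

text \<open>The operator is a derivation: it acts on one position at a time and there produces the
  eigenvalue of the factor that the permutation puts in this position. Summed over all positions,
  the eigenvalues no longer depend on the permutation.\<close>

lemma levi_op_wedge:
  fixes H :: "'n::finite \<Rightarrow> 'n \<Rightarrow> complex"
  assumes eig: "\<And>l j. l < q \<Longrightarrow> (\<Sum>i\<in>UNIV. H i j * \<omega> l i) = \<mu> l * \<omega> l j"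
  shows "levi_op H (wedge q \<omega>) J = (\<Sum>l<q. \<mu> l) * wedge q \<omega> J"
proof (cases "length J = q")
  case False
  then show ?thesis by (simp add: levi_op_def wedge_def)
next
  case True
  let ?P = "{\<sigma>. \<sigma> permutes {..<q}}"
  let ?r = "\<lambda>\<sigma> k. \<Prod>l\<in>{..<q} - {k}. \<omega> (\<sigma> l) (J ! l)"
  let ?t = "\<lambda>\<sigma>. of_int (sign \<sigma>) * (\<Prod>l<q. \<omega> (\<sigma> l) (J ! l))"
  have 1: "(\<Sum>i\<in>UNIV. H i (J ! k) * wedge q \<omega> (J[k := i])) =
      (\<Sum>\<sigma>\<in>?P. \<mu> (\<sigma> k) * (?t \<sigma>))" if k: "k < q" for k
  proof -
    have p: "(\<Prod>l<q. \<omega> (\<sigma> l) (J[k := i] ! l)) = \<omega> (\<sigma> k) i * (?r \<sigma> k)" for \<sigma> i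
      using k True by (subst prod.remove[of _ k]) (auto intro!: prod.cong)
    have "(\<Sum>i\<in>UNIV. H i (J ! k) * wedge q \<omega> (J[k := i])) =
        (\<Sum>i\<in>UNIV. \<Sum>\<sigma>\<in>?P. of_int (sign \<sigma>) * (H i (J ! k) * \<omega> (\<sigma> k) i) * (?r \<sigma> k))"
      using True by (simp add: wedge_def p sum_distrib_left mult_ac)
    also have "\<dots> = (\<Sum>\<sigma>\<in>?P. \<Sum>i\<in>UNIV. of_int (sign \<sigma>) * (H i (J ! k) * \<omega> (\<sigma> k) i) * (?r \<sigma> k))"
      by (rule sum.swap)
    also have "\<dots> = (\<Sum>\<sigma>\<in>?P. \<mu> (\<sigma> k) * (?t \<sigma>))"
    proof (rule sum.cong[OF refl])
      fix \<sigma> assume "\<sigma> \<in> ?P"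
      then have "\<sigma> k < q" using k permutes_in_image[of \<sigma> "{..<q}" k] by simp
      then have e: "(\<Sum>i\<in>UNIV. H i (J ! k) * \<omega> (\<sigma> k) i) = \<mu> (\<sigma> k) * \<omega> (\<sigma> k) (J ! k)" by (rule eig)
      have "(\<Sum>i\<in>UNIV. of_int (sign \<sigma>) * (H i (J ! k) * \<omega> (\<sigma> k) i) * (?r \<sigma> k)) =
        of_int (sign \<sigma>) * (\<Sum>i\<in>UNIV. H i (J ! k) * \<omega> (\<sigma> k) i) * (?r \<sigma> k)"
        by (simp add: sum_distrib_left sum_distrib_right)
      also have "\<dots> = \<mu> (\<sigma> k) * (of_int (sign \<sigma>) * (\<omega> (\<sigma> k) (J ! k) * (?r \<sigma> k)))"
        unfolding e by (simp add: mult_ac)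
      also have "\<omega> (\<sigma> k) (J ! k) * (?r \<sigma> k) = (\<Prod>l<q. \<omega> (\<sigma> l) (J ! l))"
        using k by (intro prod.remove[symmetric]) auto
      finally show "(\<Sum>i\<in>UNIV. of_int (sign \<sigma>) * (H i (J ! k) * \<omega> (\<sigma> k) i) * (?r \<sigma> k)) =
          \<mu> (\<sigma> k) * (?t \<sigma>)" .
    qed
    finally show ?thesis .
  qed
  have "levi_op H (wedge q \<omega>) J = (\<Sum>k<q. \<Sum>\<sigma>\<in>?P. \<mu> (\<sigma> k) * (?t \<sigma>))"
    using True 1 by (simp add: levi_op_def)
  also have "\<dots> = (\<Sum>\<sigma>\<in>?P. (\<Sum>k<q. \<mu> (\<sigma> k)) * (?t \<sigma>))"
    by (subst sum.swap) (simp add: sum_distrib_right)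
  also have "\<dots> = (\<Sum>\<sigma>\<in>?P. (\<Sum>l<q. \<mu> l) * (?t \<sigma>))"
  proof (rule sum.cong[OF refl])
    fix \<sigma> assume "\<sigma> \<in> ?P"
    then have "(\<Sum>k<q. \<mu> (\<sigma> k)) = (\<Sum>l<q. \<mu> l)"
      using sum.permute[of \<sigma> "{..<q}" \<mu>] by (simp add: comp_def)
    then show "(\<Sum>k<q. \<mu> (\<sigma> k)) * (?t \<sigma>) =
        (\<Sum>l<q. \<mu> l) * (?t \<sigma>)" by simp
  qed
  finally show ?thesis using True by (simp add: wedge_def sum_distrib_left)
qed

lemma sum_lists_prod:
  fixes g :: "nat \<Rightarrow> 'n::finite \<Rightarrow> complex"
  shows "(\<Sum>I | length I = q. \<Prod>l<q. g l (I ! l)) = (\<Prod>l<q. \<Sum>i\<in>UNIV. g l i)"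
proof (induction q arbitrary: g)
  case (Suc q)
  have e: "{I::'n list. length I = Suc q} = (\<lambda>(i, I). i # I) ` (UNIV \<times> {I. length I = q})"
    by (auto simp: length_Suc_conv)
  have "(\<Sum>I | length I = Suc q. \<Prod>l<Suc q. g l (I ! l)) =
      (\<Sum>(i, I)\<in>UNIV \<times> {I. length I = q}. g 0 i * (\<Prod>l<q. g (Suc l) (I ! l)))"
    unfolding e by (subst sum.reindex)
      (auto simp: inj_on_def prod.lessThan_Suc_shift split_beta simp del: prod.lessThan_Suc)
  also have "\<dots> = (\<Sum>i\<in>UNIV. \<Sum>I | length I = q. g 0 i * (\<Prod>l<q. g (Suc l) (I ! l)))"
    by (rule sum.cartesian_product[symmetric])
  also have "\<dots> = (\<Sum>i\<in>UNIV. g 0 i) * (\<Sum>I | length I = q. \<Prod>l<q. g (Suc l) (I ! l))"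
    by (simp add: sum_product)
  finally show ?case
    unfolding Suc.IH[of "\<lambda>l. g (Suc l)"] prod.lessThan_Suc_shift by simp
qed simp

text \<open>Pairing with the product of the dual vectors \<open>\<eta> l\<close> gives the
  determinant of the matrix of pairings, which is the identity; so the coefficients cannot all
  vanish.\<close>

lemma wedge_nonzero:
  fixes \<omega> :: "nat \<Rightarrow> 'n::finite \<Rightarrow> complex"
  assumes dual: "\<And>k l. k < q \<Longrightarrow> l < q \<Longrightarrow> (\<Sum>i\<in>UNIV. \<omega> k i * \<eta> l i) = (if k = l then 1 else 0)"
  shows "\<exists>I. wedge q \<omega> I \<noteq> 0"
proof (rule ccontr)
  assume "\<nexists>I. wedge q \<omega> I \<noteq> 0"
  then have z: "wedge q \<omega> I = 0" for I by blast
  let ?P = "{\<sigma>. \<sigma> permutes {..<q}}"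
  have distr: "(\<Sum>I | length I = q. \<Prod>l<q. \<omega> (\<sigma> l) (I ! l) * \<eta> l (I ! l)) =
      (\<Prod>l<q. \<Sum>i\<in>UNIV. \<omega> (\<sigma> l) i * \<eta> l i)" for \<sigma>
    by (rule sum_lists_prod)
  have "(\<Sum>I | length I = q. wedge q \<omega> I * (\<Prod>l<q. \<eta> l (I ! l))) =
      (\<Sum>I | length I = q. \<Sum>\<sigma>\<in>?P. of_int (sign \<sigma>) * (\<Prod>l<q. \<omega> (\<sigma> l) (I ! l) * \<eta> l (I ! l)))"
    by (intro sum.cong refl) (simp add: wedge_def sum_distrib_right prod.distrib mult.assoc)
  also have "\<dots> = (\<Sum>\<sigma>\<in>?P. \<Sum>I | length I = q. of_int (sign \<sigma>) * (\<Prod>l<q. \<omega> (\<sigma> l) (I ! l) * \<eta> l (I ! l)))"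
    by (rule sum.swap)
  also have "\<dots> = (\<Sum>\<sigma>\<in>?P. of_int (sign \<sigma>) * (\<Prod>l<q. \<Sum>i\<in>UNIV. \<omega> (\<sigma> l) i * \<eta> l i))"
    by (simp only: sum_distrib_left[symmetric] distr)
  also have "\<dots> = (\<Sum>\<sigma>\<in>?P. if \<sigma> = id then 1 else 0)"
  proof (rule sum.cong[OF refl])
    fix \<sigma> assume "\<sigma> \<in> ?P"
    then have \<sigma>: "\<sigma> permutes {..<q}" by simp
    have "(\<Prod>l<q. \<Sum>i\<in>UNIV. \<omega> (\<sigma> l) i * \<eta> l i) = (\<Prod>l<q. if \<sigma> l = l then 1 else 0)"
      using permutes_in_image[OF \<sigma>] by (intro prod.cong refl dual) auto
    also have "\<dots> = (if \<sigma> = id then 1 else 0)"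
    proof (cases "\<sigma> = id")
      case False
      then obtain l where "\<sigma> l \<noteq> l" by (auto simp: fun_eq_iff)
      moreover from this have "l < q" using permutes_not_in[OF \<sigma>, of l] by auto
      ultimately show ?thesis using False by (auto intro!: prod_zero)
    qed simp
    finally show "of_int (sign \<sigma>) * (\<Prod>l<q. \<Sum>i\<in>UNIV. \<omega> (\<sigma> l) i * \<eta> l i) = (if \<sigma> = id then 1 else 0 :: complex)"
      by auto
  qed
  also have "\<dots> = 1" by (simp add: permutes_id finite_permutations)
  finally show False by (simp add: z)
qed

lemma smooth_wedge [intro]:
  assumes "\<And>l i. smooth (\<lambda>z. \<omega> z l i)"
  shows "smooth (\<lambda>z. wedge q (\<omega> z) I)"
proof (cases "length I = q")
  case True
  then show ?thesis
    using assms by (simp add: wedge_def) (intro smooth_sum smooth_mult smooth_const smooth_prod)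
next
  case False
  then show ?thesis by (simp add: wedge_def smooth_const)
qed

lemma wedge_cong:
  assumes "\<And>l i. l < q \<Longrightarrow> \<omega> l i = \<omega>' l i"
  shows "wedge q \<omega> = wedge q \<omega>'"
proof
  fix I
  have "(\<Prod>l<q. \<omega> (\<sigma> l) (I ! l)) = (\<Prod>l<q. \<omega>' (\<sigma> l) (I ! l))" if "\<sigma> permutes {..<q}" for \<sigma>
    using permutes_in_image[OF that] by (intro prod.cong refl assms) auto
  then show "wedge q \<omega> I = wedge q \<omega>' I" by (simp add: wedge_def)
qed

text \<open>Laplace expansion of the determinant along a column that is a unit vector.\<close>

lemma wedge_delete_nth:
  assumes "k \<le> q" "length J = Suc q"
  shows "(-1) ^ k * wedge q \<omega> (delete_nth k J) =
    (-1) ^ q * (\<Sum>\<tau> | \<tau> permutes {..<Suc q}. if \<tau> k = q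
      then of_int (sign \<tau>) * (\<Prod>r\<in>{..<Suc q} - {k}. \<omega> (\<tau> r) (J ! r)) else 0)"
  using assms
proof (induction k arbitrary: J rule: inc_induct)
  case base
  \<comment> \<open>At k = q the removed position is the last one, and permutations of q elements
    are the permutations of q + 1 elements that fix q. The extra row q marks the position of the
    unit column.\<close>
  have P: "{\<tau>. \<tau> permutes {..<q}} = {\<tau> \<in> {\<tau>. \<tau> permutes {..<Suc q}}. \<tau> q = q}"
  proof (intro equalityI subsetI)
    fix \<tau> assume "\<tau> \<in> {\<tau>. \<tau> permutes {..<q}}"
    then show "\<tau> \<in> {\<tau> \<in> {\<tau>. \<tau> permutes {..<Suc q}}. \<tau> q = q}"
      using permutes_subset[of \<tau> "{..<q}" "{..<Suc q}"] permutes_not_in[of \<tau> "{..<q}" q] by auto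
  next
    fix \<tau> assume \<tau>: "\<tau> \<in> {\<tau> \<in> {\<tau>. \<tau> permutes {..<Suc q}}. \<tau> q = q}"
    have "\<tau> permutes {..<q}"
      by (rule permutes_superset[of \<tau> "{..<Suc q}"]) (use \<tau> in \<open>auto simp: less_Suc_eq\<close>)
    then show "\<tau> \<in> {\<tau>. \<tau> permutes {..<q}}" by simp
  qed
  have d: "{..<Suc q} - {q} = {..<q}" by auto
  have n: "delete_nth q J ! r = J ! r" if "r < q" for r
    using that base by (simp add: delete_nth_def nth_append)
  have l: "length (delete_nth q J) = q" using base by (simp add: delete_nth_def)
  show ?case
    unfolding wedge_def P sum.inter_filter[OF finite_permutations[OF finite_lessThan], symmetric] d
    by (simp add: l n)
next
  case (step k)
  let ?t = "Transposition.transpose k (Suc k)"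
  define J' where "J' = J[k := J ! Suc k, Suc k := J ! k]"
  have len: "length J' = Suc q" using step by (simp add: J'_def)
  have t: "?t permutes {..<Suc q}" using step by (intro permutes_swap_id) auto
  have nth: "J' ! r = J ! ?t r" if "r < Suc q" for r
    unfolding J'_def using that step by (intro nth_swap) auto
  \<comment> \<open>Once the entries k and k + 1 are exchanged, deleting position k + 1 leaves the
    same list as before. Thus the induction descends from k = q, with one change of sign per
    exchange.\<close>
  have del: "delete_nth (Suc k) J' = delete_nth k J"
  proof (rule nth_equalityI)
    show "length (delete_nth (Suc k) J') = length (delete_nth k J)"
      using len step by (simp add: delete_nth_def)
    fix i assume "i < length (delete_nth (Suc k) J')"
    then show "delete_nth (Suc k) J' ! i = delete_nth k J ! i"
      using len step by (auto simp: delete_nth_def nth_append J'_def nth_list_update min_def less_Suc_eq)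
  qed
  let ?f = "\<lambda>k J \<tau>. if \<tau> k = q then of_int (sign \<tau>) * (\<Prod>r\<in>{..<Suc q} - {k}. \<omega> (\<tau> r) (J ! r)) else 0"
  have "(\<Sum>\<tau> | \<tau> permutes {..<Suc q}. ?f (Suc k) J' \<tau>) = (\<Sum>\<tau> | \<tau> permutes {..<Suc q}. ?f (Suc k) J' (\<tau> \<circ> ?t))"
    by (rule sum_permutations_compose_right[OF t])
  also have "\<dots> = (\<Sum>\<tau> | \<tau> permutes {..<Suc q}. - ?f k J \<tau>)"
  proof (rule sum.cong[OF refl])
    fix \<tau> assume "\<tau> \<in> {\<tau>. \<tau> permutes {..<Suc q}}"
    then have s: "sign (\<tau> \<circ> ?t) = - sign \<tau>" by (intro sign_compose_transpose) auto
    have "(\<Prod>r\<in>{..<Suc q} - {Suc k}. \<omega> ((\<tau> \<circ> ?t) r) (J' ! r)) = (\<Prod>r\<in>{..<Suc q} - {Suc k}. \<omega> (\<tau> (?t r)) (J ! ?t r))"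
      by (intro prod.cong refl) (auto simp: nth)
    also have "\<dots> = (\<Prod>r\<in>{..<Suc q} - {k}. \<omega> (\<tau> r) (J ! r))"
      by (rule prod.reindex_bij_witness[of _ ?t ?t])
        (use step in \<open>auto simp: Transposition.transpose_def split: if_splits\<close>)
    finally show "?f (Suc k) J' (\<tau> \<circ> ?t) = - ?f k J \<tau>" by (simp add: s)
  qed
  finally have e: "(\<Sum>\<tau> | \<tau> permutes {..<Suc q}. ?f (Suc k) J' \<tau>) = - (\<Sum>\<tau> | \<tau> permutes {..<Suc q}. ?f k J \<tau>)"
    by (simp only: sum_negf)
  from step.IH[OF len, unfolded del e] show ?case by simp
qed

text \<open>After the Laplace expansion, transposing the position of the exterior derivative with the position
  of the differentiated factor pairs off the second derivatives with opposite signs.\<close>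

lemma wedge_dzbar_closed:
  fixes G :: "nat \<Rightarrow> 'n::finite cspace \<Rightarrow> complex"
  assumes G: "\<And>l. smooth (G l)" and J: "length J = Suc q"
  shows "(\<Sum>k<Suc q. (-1) ^ k * dzbar (J ! k) (\<lambda>z. wedge q (\<lambda>l i. dzbar i (G l) z) (delete_nth k J)) p) = 0"
proof -
  let ?w = "\<lambda>k. \<lambda>z. wedge q (\<lambda>l i. dzbar i (G l) z) (delete_nth k J)"
  let ?P = "{\<tau>. \<tau> permutes {..<Suc q}}"
  let ?S = "\<lambda>k z. \<Sum>\<tau>\<in>?P. if \<tau> k = q
      then of_int (sign \<tau>) * (\<Prod>r\<in>{..<Suc q} - {k}. dzbar (J ! r) (G (\<tau> r)) z) else 0"
  \<comment> \<open>The contribution of the permutation \<open>\<tau>\<close> in which the exterior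
    derivative occupies position k and hits the factor in position m.\<close>
  define U where "U = (\<lambda>k m \<tau>. if m \<noteq> k \<and> \<tau> k = q
      then of_int (sign \<tau>) * (dzbar (J ! k) (dzbar (J ! m) (G (\<tau> m))) p *
        (\<Prod>r\<in>{..<Suc q} - {k} - {m}. dzbar (J ! r) (G (\<tau> r)) p)) else 0)"
  have "(-1) ^ k * dzbar (J ! k) (?w k) p =
      (-1) ^ q * (\<Sum>m<Suc q. \<Sum>\<tau>\<in>?P. U k m \<tau>)" if k: "k < Suc q" for k
  proof -
    have sm: "smooth (?w k)"
      by (intro smooth_wedge smooth_dzbar G)
    have smt: "smooth (\<lambda>z. if \<tau> k = q
      then of_int (sign \<tau>) * (\<Prod>r\<in>{..<Suc q} - {k}. dzbar (J ! r) (G (\<tau> r)) z) else 0)" for \<tau>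
      by (cases "\<tau> k = q") (auto intro!: smooth_mult smooth_prod smooth_dzbar G)
    have smp: "smooth (\<lambda>z. \<Prod>r\<in>A. dzbar (J ! r) (G (\<tau> r)) z)" for A \<tau>
      by (intro smooth_prod smooth_dzbar G)
    have "(-1) ^ k * dzbar (J ! k) (?w k) p =
        dzbar (J ! k) (\<lambda>z. (-1) ^ k * wedge q (\<lambda>l i. dzbar i (G l) z) (delete_nth k J)) p"
      by (rule dzbar_cmult[OF sm, symmetric])
    also have "\<dots> = dzbar (J ! k) (\<lambda>z. (-1) ^ q * ?S k z) p"
      using k by (subst wedge_delete_nth[OF _ J]) auto
    also have "\<dots> = (-1) ^ q * dzbar (J ! k) (?S k) p"
      by (rule dzbar_cmult) (intro smooth_sum smt)
    also have "dzbar (J ! k) (?S k) p = (\<Sum>\<tau>\<in>?P. dzbar (J ! k) (\<lambda>z. if \<tau> k = q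
      then of_int (sign \<tau>) * (\<Prod>r\<in>{..<Suc q} - {k}. dzbar (J ! r) (G (\<tau> r)) z) else 0) p)"
      by (rule dzbar_sum[OF smt])
    also have "\<dots> = (\<Sum>\<tau>\<in>?P. \<Sum>m<Suc q. U k m \<tau>)"
    proof (rule sum.cong[OF refl])
      fix \<tau> assume "\<tau> \<in> ?P"
      show "dzbar (J ! k) (\<lambda>z. if \<tau> k = q
        then of_int (sign \<tau>) * (\<Prod>r\<in>{..<Suc q} - {k}. dzbar (J ! r) (G (\<tau> r)) z) else 0) p = (\<Sum>m<Suc q. U k m \<tau>)"
      proof (cases "\<tau> k = q")
        case True
        have "(\<Sum>m<Suc q. U k m \<tau>) = (\<Sum>m\<in>{..<Suc q} - {k}. U k m \<tau>)"
          by (rule sum.mono_neutral_right) (auto simp: U_def)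
        also have "\<dots> = (\<Sum>m\<in>{..<Suc q} - {k}. of_int (sign \<tau>) * (dzbar (J ! k) (dzbar (J ! m) (G (\<tau> m))) p *
            (\<Prod>r\<in>{..<Suc q} - {k} - {m}. dzbar (J ! r) (G (\<tau> r)) p)))"
          by (rule sum.cong) (auto simp: U_def True)
        also have "\<dots> = of_int (sign \<tau>) * dzbar (J ! k) (\<lambda>z. \<Prod>r\<in>{..<Suc q} - {k}. dzbar (J ! r) (G (\<tau> r)) z) p"
          by (subst dzbar_prod) (auto simp: sum_distrib_left intro!: smooth_dzbar G)
        finally show ?thesis using True by (simp only: refl if_True dzbar_cmult[OF smp])
      qed (simp add: U_def)
    qed
    finally show ?thesis by (subst (asm) sum.swap)
  qed
  then have total: "(\<Sum>k<Suc q. (-1) ^ k * dzbar (J ! k) (?w k) p) =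
      (-1) ^ q * (\<Sum>k<Suc q. \<Sum>m<Suc q. \<Sum>\<tau>\<in>?P. U k m \<tau>)"
    unfolding sum_distrib_left[of "(-1) ^ q"] by (intro sum.cong refl) (simp only: lessThan_iff sum_distrib_left)
  have anti: "(\<Sum>\<tau>\<in>?P. U k m \<tau>) = - (\<Sum>\<tau>\<in>?P. U m k \<tau>)" if km: "k < Suc q" "m < Suc q" for k m
  proof (cases "k = m")
    case False
    let ?t = "Transposition.transpose k m"
    have t: "?t permutes {..<Suc q}" using km by (intro permutes_swap_id) auto
    have "(\<Sum>\<tau>\<in>?P. U k m \<tau>) = (\<Sum>\<tau>\<in>?P. U k m (\<tau> \<circ> ?t))"
      by (rule sum_permutations_compose_right[OF t])
    also have "\<dots> = (\<Sum>\<tau>\<in>?P. - U m k \<tau>)"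
    proof (rule sum.cong[OF refl])
      fix \<tau> assume "\<tau> \<in> ?P"
      then have s: "sign (\<tau> \<circ> ?t) = - sign \<tau>" using False by (intro sign_compose_transpose) auto
      have "(\<Prod>r\<in>{..<Suc q} - {k} - {m}. dzbar (J ! r) (G ((\<tau> \<circ> ?t) r)) p) =
          (\<Prod>r\<in>{..<Suc q} - {m} - {k}. dzbar (J ! r) (G (\<tau> r)) p)"
        by (rule prod.cong) (auto simp: Transposition.transpose_def)
      moreover have "dzbar (J ! k) (dzbar (J ! m) (G (\<tau> k))) p = dzbar (J ! m) (dzbar (J ! k) (G (\<tau> k))) p"
        by (rule dzbar_commute[OF G])
      ultimately show "U k m (\<tau> \<circ> ?t) = - U m k \<tau>" using False by (simp add: U_def s)
    qed
    finally show ?thesis by (simp add: sum_negf)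
  qed (simp add: U_def)
  define X where "X = (\<Sum>k<Suc q. \<Sum>m<Suc q. \<Sum>\<tau>\<in>?P. U k m \<tau>)"
  have "X = (\<Sum>k<Suc q. \<Sum>m<Suc q. - (\<Sum>\<tau>\<in>?P. U m k \<tau>))"
    unfolding X_def by (intro sum.cong refl anti) auto
  also have "\<dots> = - (\<Sum>k<Suc q. \<Sum>m<Suc q. \<Sum>\<tau>\<in>?P. U m k \<tau>)"
    by (simp only: sum_negf)
  also have "(\<Sum>k<Suc q. \<Sum>m<Suc q. \<Sum>\<tau>\<in>?P. U m k \<tau>) = X"
    unfolding X_def by (rule sum.swap)
  finally have "X = 0" by simp
  then show ?thesis unfolding total X_def[symmetric] by simp
qed

section \<open>Integration by parts\<close>

lemma lborel_integral_translate:
  fixes g :: "'a::euclidean_space \<Rightarrow> 'b::{banach, second_countable_topology}"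
  assumes "g \<in> borel_measurable borel"
  shows "(LINT x|lborel. g (c + x)) = (LINT x|lborel. g x)"
proof -
  have "(LINT x|lborel. g x) = (LINT x|distr lborel borel ((+) c). g x)"
    by (simp add: lborel_distr_plus)
  also have "\<dots> = (LINT x|lborel. g (c + x))"
    using assms by (intro integral_distr) auto
  finally show ?thesis by simp
qed

lemma integrable_continuous_compact_support:
  fixes g :: "'a::euclidean_space \<Rightarrow> 'b::{banach, second_countable_topology}"
  assumes "continuous_on UNIV g" "\<And>x. x \<notin> cball 0 R \<Longrightarrow> g x = 0"
  shows "integrable lborel g"
proof -
  have "set_integrable lborel (cball 0 R) g"
    unfolding set_integrable_def
    using assms(1) by (intro borel_integrable_compact) (auto intro: continuous_on_subset)
  moreover have "(\<lambda>x. indicat_real (cball 0 R) x *\<^sub>R g x) = g"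
    using assms(2) by (force simp: indicator_def)
  ultimately show ?thesis unfolding set_integrable_def by simp
qed

text \<open>Difference quotients have integral 0 by translation invariance, and dominated
  convergence passes this on to the derivative.\<close>

lemma integral_derivative_eq_0:
  fixes g :: "'a::euclidean_space \<Rightarrow> 'b::{banach, second_countable_topology}"
  assumes g: "smooth g" and supp: "\<And>x. x \<notin> cball 0 R \<Longrightarrow> g x = 0"
  shows "(LINT x|lborel. fd g x v) = 0"
proof -
  let ?q = "\<lambda>t x. (g (t *\<^sub>R v + x) - g x - t *\<^sub>R fd g x v) /\<^sub>R \<bar>t\<bar>"
  let ?e = "\<lambda>t x. (1 / t) *\<^sub>R (g (t *\<^sub>R v + x) - g x) - fd g x v"
  \<comment> \<open>Steps are at most v. Outside the ball of radius R + |v| both terms of the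
    quotient vanish; inside, the shifted point stays within R + 2|v|, where the Lipschitz constant
    applies.\<close>
  let ?B = "cball (0::'a) (R + 2 * norm v)"
  obtain L where L: "L > 0" "\<And>x y. x \<in> ?B \<Longrightarrow> y \<in> ?B \<Longrightarrow> norm (g x - g y) \<le> L * norm (x - y)"
    using smooth_lipschitz[OF g bounded_cball convex_cball] by blast
  define h where "h = (\<lambda>n. inverse (real (Suc n)))"
  have h: "0 < h n" "h n \<le> 1" for n by (auto simp: h_def field_simps)
  have h0: "h \<longlonglongrightarrow> 0" unfolding h_def by (rule LIMSEQ_inverse_real_of_nat)
  define Q where "Q = (\<lambda>n x. (1 / h n) *\<^sub>R (g (h n *\<^sub>R v + x) - g x))"
  have cont: "continuous_on UNIV g" by (rule smooth_continuous_on[OF g])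
  have ig: "integrable lborel g" by (rule integrable_continuous_compact_support[OF cont supp])
  have bm: "g \<in> borel_measurable borel" by (rule borel_measurable_continuous_onI[OF cont])
  have igt: "integrable lborel (\<lambda>x. g (c + x))" for c
  proof (rule integrable_continuous_compact_support)
    show "continuous_on UNIV (\<lambda>x. g (c + x))"
      by (intro continuous_on_compose2[OF cont] continuous_intros) auto
    show "g (c + x) = 0" if "x \<notin> cball 0 (R + norm c)" for x
      using that norm_triangle_ineq4[of "c + x" c] by (intro supp) auto
  qed
  have "(LINT x|lborel. Q n x) = 0" for n
    unfolding Q_def using igt[of "h n *\<^sub>R v"] ig lborel_integral_translate[OF bm, of "h n *\<^sub>R v"] by simp
  moreover have "(\<lambda>n. LINT x|lborel. Q n x) \<longlonglongrightarrow> (LINT x|lborel. fd g x v)"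
  proof (rule integral_dominated_convergence[where w = "\<lambda>x. indicat_real ?B x * (L * norm v)"])
    show "(\<lambda>x. fd g x v) \<in> borel_measurable lborel"
      using smooth_continuous_on[OF smooth_fd[OF g], of UNIV v]
      by (simp add: borel_measurable_continuous_onI)
    show "Q n \<in> borel_measurable lborel" for n
      unfolding Q_def using igt ig by (intro borel_measurable_scaleR borel_measurable_diff) auto
    show "integrable lborel (\<lambda>x. indicat_real ?B x * (L * norm v))"
      by (intro integrable_mult_left) (auto intro!: integrable_real_indicator emeasure_bounded_finite)
    show "AE x in lborel. (\<lambda>n. Q n x) \<longlonglongrightarrow> fd g x v"
    proof (rule AE_I2)
      fix x
      have 1: "((\<lambda>t::real. t *\<^sub>R v + x) has_derivative (\<lambda>t. t *\<^sub>R v)) (at 0)"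
        by (auto intro!: derivative_eq_intros)
      have 2: "(g has_derivative fd g x) (at (0 *\<^sub>R v + x))"
        using smooth_has_derivative[OF g] by simp
      have "((\<lambda>t. g (t *\<^sub>R v + x)) has_derivative (\<lambda>t. fd g x (t *\<^sub>R v))) (at 0)"
        by (rule has_derivative_compose[OF 1 2])
      then have "((\<lambda>t. g (t *\<^sub>R v + x)) has_vector_derivative fd g x v) (at 0)"
        unfolding has_vector_derivative_def
        by (simp add: linear_cmul[OF has_derivative_linear[OF smooth_has_derivative[OF g]]])
      then have "((\<lambda>t. ?q t x) \<longlongrightarrow> 0) (at 0)"
        by (simp add: has_vector_derivative_def has_derivative_at_within)
      then have "((\<lambda>t. norm (?q t x)) \<longlongrightarrow> 0) (at 0)"
        by (rule tendsto_norm_zero)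
      moreover have "norm (?q t x) =
          norm (?e t x)" if "t \<noteq> 0" for t
      proof -
        have "(1 / t) *\<^sub>R (g (t *\<^sub>R v + x) - g x) - fd g x v =
            (1 / t) *\<^sub>R (g (t *\<^sub>R v + x) - g x - t *\<^sub>R fd g x v)"
          using that by (simp add: scaleR_diff_right)
        then show ?thesis by (simp add: divide_inverse)
      qed
      then have "\<forall>\<^sub>F t in at 0. norm (?q t x) =
          norm (?e t x)"
        by (auto simp: eventually_at_filter)
      ultimately have "((\<lambda>t. norm (?e t x)) \<longlongrightarrow> 0) (at 0)"
        by (rule Lim_transform_eventually)
      then have "((\<lambda>t. (1 / t) *\<^sub>R (g (t *\<^sub>R v + x) - g x)) \<longlongrightarrow> fd g x v) (at 0)"
        by (rule LIM_zero_cancel[OF tendsto_norm_zero_cancel])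
      moreover have "filterlim h (at 0) sequentially"
        unfolding filterlim_at using h0 h(1) by (auto intro!: always_eventually simp: less_imp_neq[symmetric])
      ultimately show "(\<lambda>n. Q n x) \<longlonglongrightarrow> fd g x v"
        unfolding Q_def by (rule filterlim_compose)
    qed
    show "AE x in lborel. norm (Q n x) \<le> indicat_real ?B x * (L * norm v)" for n
    proof (rule AE_I2)
      fix x
      have hv: "norm (h n *\<^sub>R v) \<le> norm v"
        using h[of n] mult_right_mono[OF h(2), of "norm v" n] by simp
      show "norm (Q n x) \<le> indicat_real ?B x * (L * norm v)"
      proof (cases "x \<in> cball 0 (R + norm v)")
        case True
        then have x: "x \<in> ?B" "h n *\<^sub>R v + x \<in> ?B"
          using hv norm_triangle_ineq[of "h n *\<^sub>R v" x] norm_ge_zero[of v]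
          by (auto simp del: norm_scaleR norm_ge_zero)
        have "norm (Q n x) = (1 / h n) * norm (g (h n *\<^sub>R v + x) - g x)"
          using h[of n] by (simp add: Q_def)
        also have "\<dots> \<le> (1 / h n) * (L * norm (h n *\<^sub>R v))"
          using L(2)[OF x(2) x(1)] h(1)[of n] by (intro mult_left_mono) auto
        also have "\<dots> = L * norm v" using h(1)[of n] by simp
        finally show ?thesis using x by simp
      next
        case False
        have "g x = 0" by (rule supp) (use False norm_ge_zero[of v] in \<open>auto simp del: norm_ge_zero\<close>)
        moreover have "g (h n *\<^sub>R v + x) = 0"
        proof (rule supp)
          show "h n *\<^sub>R v + x \<notin> cball 0 R"
            using False hv norm_triangle_ineq4[of "h n *\<^sub>R v + x" "h n *\<^sub>R v"]
            by (auto simp del: norm_scaleR)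
        qed
        ultimately show ?thesis using L(1) by (simp add: Q_def)
      qed
    qed
  qed
  ultimately show ?thesis using LIMSEQ_unique[OF _ tendsto_const[of "0::'b"]] by simp
qed

context defined_domain
begin

abbreviation LD where "LD \<equiv> lebesgue_on D"

lemma domain_lmeasurable: "D \<in> lmeasurable"
  using bounded_domain open_domain by (rule lmeasurable_open)

lemma finite_measure_LD: "finite_measure LD"
  by (rule finite_measure_lebesgue_on[OF domain_lmeasurable])

lemma continuous_measurable_LD:
  fixes g :: "'n cspace \<Rightarrow> 'b::topological_space"
  shows "continuous_on UNIV g \<Longrightarrow> g \<in> borel_measurable LD"
  by (intro measurable_restrict_space1 measurable_completion) (simp add: borel_measurable_continuous_onI)

lemma smooth_measurable_LD: "smooth g \<Longrightarrow> g \<in> borel_measurable LD"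
  by (rule continuous_measurable_LD[OF smooth_continuous_on])

lemma integrable_mult_bounded:
  fixes u g :: "'n cspace \<Rightarrow> complex"
  assumes "integrable LD u" "g \<in> borel_measurable LD" "\<And>z. z \<in> D \<Longrightarrow> cmod (g z) \<le> C"
  shows "integrable LD (\<lambda>z. u z * g z)"
proof (rule Bochner_Integration.integrable_bound)
  show "integrable LD (\<lambda>z. C * cmod (u z))" using assms(1) by auto
  show "(\<lambda>z. u z * g z) \<in> borel_measurable LD" using assms by auto
  show "AE z in LD. norm (u z * g z) \<le> norm (C * cmod (u z))"
  proof (rule AE_I2)
    fix z assume "z \<in> space LD"
    then have "z \<in> D" by (simp add: space_restrict_space)
    then have "cmod (g z) \<le> \<bar>C\<bar>" using assms(3)[of z] by linarith
    then show "norm (u z * g z) \<le> norm (C * cmod (u z))"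
      by (simp add: norm_mult abs_mult mult.commute[of "cmod (u z)"] mult_right_mono)
  qed
qed

lemma integrable_mult_smooth:
  fixes u g :: "'n cspace \<Rightarrow> complex"
  assumes "integrable LD u" "smooth g"
  shows "integrable LD (\<lambda>z. u z * g z)"
proof -
  obtain C where "\<forall>z\<in>D. cmod (g z) \<le> C" using smooth_bounded[OF assms(2) bounded_domain] by blast
  then show ?thesis using integrable_mult_bounded[OF assms(1) smooth_measurable_LD[OF assms(2)]] by blast
qed

lemma integrable_smooth:
  fixes g :: "'n cspace \<Rightarrow> complex"
  assumes "smooth g"
  shows "integrable LD g"
proof -
  have "integrable LD (\<lambda>z. 1::complex)"
    by (rule finite_measure.integrable_const[OF finite_measure_LD])
  from integrable_mult_smooth[OF this assms] show ?thesis by simp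
qed

lemma integral_LD_eq_lborel:
  fixes g :: "'n cspace \<Rightarrow> complex"
  assumes "continuous_on UNIV g" "\<And>z. z \<notin> D \<Longrightarrow> g z = 0"
  shows "(LINT z|LD. g z) = (LINT z|lborel. g z)"
proof -
  have "(LINT z|LD. g z) = (LINT z|lebesgue. indicat_real D z *\<^sub>R g z)"
    by (rule integral_restrict_space) auto
  also have "(\<lambda>z. indicat_real D z *\<^sub>R g z) = g"
    using assms(2) by (force simp: indicator_def)
  also have "(LINT z|lebesgue. g z) = (LINT z|lborel. g z)"
    by (rule integral_completion) (simp add: borel_measurable_continuous_onI[OF assms(1)])
  finally show ?thesis .
qed

lemma test_function_smooth: "test_function D \<psi> \<Longrightarrow> smooth \<psi>"
  by (simp add: test_function_def)

lemma integral_dzbar_test_function: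
  assumes "test_function D \<psi>"
  shows "(LINT z|LD. dzbar j \<psi> z) = 0"
proof -
  obtain K where K: "smooth \<psi>" "compact K" "K \<subseteq> D" "\<And>z. z \<notin> K \<Longrightarrow> \<psi> z = 0"
    using assms by (auto simp: test_function_def)
  obtain R where R: "K \<subseteq> cball 0 R"
    using compact_imp_bounded[OF K(2)] by (auto simp: bounded_iff subset_iff)
  have fd: "fd \<psi> z v = 0" if "z \<notin> K" for z v
  proof -
    have o: "open (- K)" using compact_imp_closed[OF K(2)] by auto
    have "((\<lambda>z. 0) has_derivative (\<lambda>v. 0)) (at z)" by simp
    then have "(\<psi> has_derivative (\<lambda>v. 0)) (at z)"
      by (rule has_derivative_transform_within_open[OF _ o]) (use that K(4) in auto)
    from frechet_derivative_at[OF this] show ?thesis by metis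
  qed
  have "(LINT z|LD. dzbar j \<psi> z) = (LINT z|lborel. dzbar j \<psi> z)"
  proof (rule integral_LD_eq_lborel)
    show "continuous_on UNIV (dzbar j \<psi>)" by (intro smooth_continuous_on smooth_dzbar K(1))
    show "dzbar j \<psi> z = 0" if "z \<notin> D" for z
    proof -
      have "z \<notin> K" using that K(3) by blast
      then show ?thesis by (simp add: dzbar_def fd)
    qed
  qed
  also have "\<dots> = 0"
  proof -
    have 0: "(LINT z|lborel. fd \<psi> z v) = 0" for v
      by (rule integral_derivative_eq_0[OF K(1), of R]) (use K(4) R in blast)
    have i: "integrable lborel (\<lambda>z. fd \<psi> z v)" for v
      by (rule integrable_continuous_compact_support[of _ R])
        (use R in \<open>auto intro!: fd smooth_continuous_on smooth_fd K(1)\<close>)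
    show ?thesis using i 0 by (simp add: dzbar_def)
  qed
  finally show ?thesis .
qed

lemma integral_by_parts:
  assumes u: "smooth u" and \<psi>: "test_function D \<psi>"
  shows "(LINT z|LD. u z * dzbar j \<psi> z) = - (LINT z|LD. dzbar j u z * \<psi> z)"
proof -
  have s: "smooth \<psi>" by (rule test_function_smooth[OF \<psi>])
  have "test_function D (\<lambda>z. u z * \<psi> z)"
    using \<psi> u unfolding test_function_def by (metis mult_zero_right smooth_mult)
  from integral_dzbar_test_function[OF this, of j]
  have "(LINT z|LD. dzbar j u z * \<psi> z + u z * dzbar j \<psi> z) = 0"
    by (simp add: dzbar_mult[OF u s])
  moreover have "(LINT z|LD. dzbar j u z * \<psi> z + u z * dzbar j \<psi> z) =
      (LINT z|LD. dzbar j u z * \<psi> z) + (LINT z|LD. u z * dzbar j \<psi> z)"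
    using u s by (intro Bochner_Integration.integral_add integrable_smooth) auto
  ultimately show ?thesis by (simp add: eq_neg_iff_add_eq_0 add.commute)
qed

text \<open>For smooth coefficients the distributional operator is the classical one, by integration
  by parts in each term.\<close>

lemma dbar_eq_smooth:
  assumes u: "\<And>K. smooth (\<lambda>z. u z K)"
  shows "dbar_eq D q u (\<lambda>z J. \<Sum>k<Suc q. (-1) ^ k * dzbar (J ! k) (\<lambda>z. u z (delete_nth k J)) z)"
  unfolding dbar_eq_def
proof (intro allI impI ballI)
  fix \<psi> :: "'n cspace \<Rightarrow> complex" and J :: "'n list" assume \<psi>: "test_function D \<psi>"
  let ?d = "\<lambda>k z. dzbar (J ! k) (\<lambda>z. u z (delete_nth k J)) z"
  have s: "smooth \<psi>" by (rule test_function_smooth[OF \<psi>])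
  have "(LINT z|LD. (\<Sum>k<Suc q. (-1) ^ k * ?d k z) * \<psi> z) =
      (LINT z|LD. (\<Sum>k<Suc q. (-1) ^ k * (?d k z * \<psi> z)))"
    by (simp only: sum_distrib_right mult.assoc)
  also have "\<dots> = (\<Sum>k<Suc q. (LINT z|LD. (-1) ^ k * (?d k z * \<psi> z)))"
    by (intro Bochner_Integration.integral_sum integrable_smooth smooth_mult smooth_const smooth_dzbar u s)
  also have "\<dots> = (\<Sum>k<Suc q. (-1) ^ k * (LINT z|LD. ?d k z * \<psi> z))"
    by (simp only: integral_mult_right_zero)
  also have "\<dots> = (\<Sum>k<Suc q. - ((-1) ^ k * (LINT z|LD. u z (delete_nth k J) * dzbar (J ! k) \<psi> z)))"
    by (simp only: integral_by_parts[OF u \<psi>]) simp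
  also have "\<dots> = - (\<Sum>k<Suc q. (-1) ^ k * (LINT z|LD. u z (delete_nth k J) * dzbar (J ! k) \<psi> z))"
    by (simp only: sum_negf)
  finally show "(LINT z|LD. (\<Sum>k<Suc q. (-1) ^ k * ?d k z) * \<psi> z) =
    - (\<Sum>k<Suc q. (-1) ^ k * (LINT z|LD. u z (delete_nth k J) * dzbar (J ! k) \<psi> z))" .
qed

end

section \<open>The adjoint on smooth forms\<close>

lemma covectors_dzbar:
  assumes "\<And>z. \<alpha> z \<in> covectors q" "\<And>I. smooth (\<lambda>z. \<alpha> z I)"
  shows "(\<lambda>I. dzbar j (\<lambda>z. \<alpha> z I) p) \<in> covectors q"
  using assms by (simp add: covectors_def dzbar_minus)

lemma covectors_cnj: "\<alpha> \<in> covectors q \<Longrightarrow> (\<lambda>I. cnj (\<alpha> I)) \<in> covectors q"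
  by (simp add: covectors_def)

lemma covectors_scale: "\<alpha> \<in> covectors q \<Longrightarrow> (\<lambda>I. c * \<alpha> I) \<in> covectors q"
  by (simp add: covectors_def)

lemma covectors_exchange:
  "\<alpha> \<in> covectors q \<Longrightarrow> length I = q \<Longrightarrow> j < k \<Longrightarrow> k < q \<Longrightarrow> \<alpha> (I[j := I ! k, k := I ! j]) = - \<alpha> I"
  by (simp add: covectors_def)

lemma covectors_Cons_swap:
  assumes "\<alpha> \<in> covectors (Suc q)" "length K = q" "j < k" "k < q"
  shows "\<alpha> (i # K[j := K ! k, k := K ! j]) = - \<alpha> (i # K)"
proof -
  have "\<alpha> ((i # K)[Suc j := (i # K) ! Suc k, Suc k := (i # K) ! Suc j]) = - \<alpha> (i # K)"
    by (rule covectors_exchange[OF assms(1)]) (use assms in auto)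
  then show ?thesis by simp
qed

text \<open>The formal adjoint of dbar for the weight exp(-\<open>\<phi>\<close>) with
  \<open>\<phi>\<close> = a |z - z0|^2 - b: its coefficients are minus exp(\<open>\<phi>\<close>)
  times the divergence of exp(-\<open>\<phi>\<close>) F in the z_i. The constant b cancels, and q is
  the degree of the result, one less than that of F.\<close>

definition weighted_adjoint :: "real \<Rightarrow> 'n::finite cspace \<Rightarrow> nat \<Rightarrow> 'n form \<Rightarrow> 'n form" where
  "weighted_adjoint a z0 q F z K = (if length K = q
     then - (\<Sum>i\<in>UNIV. dz i (\<lambda>z. F z (i # K)) z - of_real a * cnj (z $ i - z0 $ i) * F z (i # K)) else 0)"

lemma weighted_adjoint_covector:
  fixes F :: "'n::finite form"
  assumes cov: "\<And>z. F z \<in> covectors (Suc q)" and sm: "\<And>I. smooth (\<lambda>z. F z I)"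
  shows "weighted_adjoint a z0 q F z \<in> covectors q"
  unfolding covectors_def
proof (intro CollectI conjI allI impI)
  fix K :: "'n list" and j k assume K: "length K = q" "j < k" "k < q"
  show "weighted_adjoint a z0 q F z (K[j := K ! k, k := K ! j]) = - weighted_adjoint a z0 q F z K"
    using K by (simp add: weighted_adjoint_def covectors_Cons_swap[OF cov K] dz_minus sm
        sum_negf[symmetric] del: sum_negf)
qed (simp add: weighted_adjoint_def)

lemma smooth_weighted_adjoint:
  assumes sm: "\<And>I. smooth (\<lambda>z. F z I)"
  shows "smooth (\<lambda>z. weighted_adjoint a z0 q F z K)"
proof (cases "length K = q")
  case True
  then show ?thesis
    unfolding weighted_adjoint_def
    by simp (intro smooth_minus smooth_sum smooth_diff smooth_mult smooth_const smooth_cnj smooth_vec_nth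
        smooth_dz sm)
next
  case False
  then show ?thesis by (simp add: weighted_adjoint_def smooth_const)
qed

section \<open>Limits and bounds of the cutoff profile\<close>

lemma flat_power_at_top: "((\<lambda>x. flat_power n x) \<longlongrightarrow> (if n = 0 then 1 else 0)) at_top"
proof -
  have i: "((\<lambda>x::real. 1 / x) \<longlongrightarrow> 0) at_top"
    using tendsto_inverse_0_at_top[OF filterlim_ident] by (simp add: divide_inverse)
  have "((\<lambda>x::real. (1 / x) ^ n * exp (- (1 / x))) \<longlongrightarrow> 0 ^ n * exp (- 0)) at_top"
    by (intro tendsto_mult tendsto_power tendsto_exp tendsto_minus i)
  moreover have "\<forall>\<^sub>F x in at_top. (1 / x) ^ n * exp (- (1 / x)) = flat_power n x"
    using eventually_gt_at_top[of 0] by eventually_elim (simp add: flat_power_def)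
  ultimately have "(flat_power n \<longlongrightarrow> 0 ^ n * exp (- 0)) at_top" by (rule Lim_transform_eventually)
  then show ?thesis by (simp add: power_0_left)
qed

lemma flat_power_Suc_mult: "x * flat_power (Suc n) x = flat_power n x"
  by (simp add: flat_power_def)

text \<open>With x = \<open>- n * \<rho>\<close> this is the product of the size n of the derivative
  of the cutoff and of the factor |\<open>\<rho>\<close>| supplied by the boundary condition.
  Writing x as (x - 1) + 1 splits it into two bounded members of the family.\<close>

lemma weight_cutoff_bound:
  assumes "0 \<le> x"
  shows "0 \<le> x * flat_power 2 (x - 1)" "x * flat_power 2 (x - 1) \<le> 4"
proof -
  have e: "x * flat_power 2 (x - 1) = flat_power 1 (x - 1) + flat_power 2 (x - 1)"
    using flat_power_Suc_mult[of "x - 1" 1] by (simp add: numeral_2_eq_2 algebra_simps)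
  show "0 \<le> x * flat_power 2 (x - 1)" "x * flat_power 2 (x - 1) \<le> 4"
    unfolding e using flat_power_bounds[of 1 "x - 1"] flat_power_bounds[of 2 "x - 1"] by auto
qed

lemma weight_cutoff_tendsto: "((\<lambda>x. x * flat_power 2 (x - 1)) \<longlongrightarrow> 0) at_top"
proof -
  have f: "filterlim (\<lambda>x::real. x - 1) at_top at_top"
    using filterlim_tendsto_add_at_top[OF tendsto_const[of "-1::real"] filterlim_ident] by simp
  have "((\<lambda>x. flat_power 1 (x - 1) + flat_power 2 (x - 1)) \<longlongrightarrow> 0 + 0) at_top"
    by (intro tendsto_add filterlim_compose[OF _ f])
      (use flat_power_at_top[of 1] flat_power_at_top[of 2] in auto)
  moreover have "x * flat_power 2 (x - 1) = flat_power 1 (x - 1) + flat_power 2 (x - 1)" for x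
    using flat_power_Suc_mult[of "x - 1" 1] by (simp add: numeral_2_eq_2 algebra_simps)
  ultimately show ?thesis by simp
qed

context defined_domain
begin

text \<open>The shift by 1 makes the function vanish where \<open>- \<rho>\<close> is at most 1/n,
  hence compactly supported in D. It tends to 1 at each point of D, because
  \<open>flat_power 0\<close> tends to 1 at infinity.\<close>

abbreviation cutoff :: "nat \<Rightarrow> 'n cspace \<Rightarrow> real" where
  "cutoff n z \<equiv> flat_power 0 (- real n * \<rho> z - 1)"

lemma smooth_cutoff: "smooth (cutoff n)"
  by (intro smooth_compose_real[OF smooth_flat_power] smooth_diff smooth_mult smooth_const smooth_rho)

lemma cutoff_bounds: "0 \<le> cutoff n z" "cutoff n z \<le> 2"
  by (auto intro: flat_power_bounds)

lemma test_function_cutoff: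
  assumes "smooth g"
  shows "test_function D (\<lambda>z. complex_of_real (cutoff n z) * g z)"
  unfolding test_function_def
\<comment> \<open>Taking n + 1 instead of n in the threshold gives a valid compact set for n = 0 as
  well.\<close>
proof (intro conjI exI[of _ "{z. \<rho> z \<le> - (1 / (real n + 1))}"] allI impI)
  let ?K = "{z. \<rho> z \<le> - (1 / (real n + 1))}"
  show "smooth (\<lambda>z. complex_of_real (cutoff n z) * g z)"
    by (intro smooth_mult smooth_of_real smooth_cutoff assms)
  have "0 < 1 / (real n + 1)" by simp
  then have "\<rho> z < 0" if "\<rho> z \<le> - (1 / (real n + 1))" for z using that by linarith
  then show sub: "?K \<subseteq> D" unfolding domain_eq by blast
  have "closed ?K"
    by (intro closed_Collect_le smooth_continuous_on[OF smooth_rho] continuous_on_const)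
  then show "compact ?K" using bounded_subset[OF bounded_domain sub] by (simp add: compact_eq_bounded_closed)
  fix z assume "z \<notin> ?K"
  then have "\<rho> z > - (1 / (real n + 1))" by simp
  then have "(real n + 1) * \<rho> z > (real n + 1) * - (1 / (real n + 1))"
    by (intro mult_strict_left_mono) auto
  then have 1: "(real n + 1) * \<rho> z > - 1" by simp
  have "- real n * \<rho> z - 1 \<le> 0"
  proof (cases "\<rho> z \<ge> 0")
    case True
    then have "real n * \<rho> z \<ge> 0" by simp
    then show ?thesis by simp
  next
    case False
    then show ?thesis using 1 by (simp add: algebra_simps)
  qed
  then show "of_real (cutoff n z) * g z = 0" by (simp add: flat_power_def)
qed

lemma dzbar_cutoff:
  "dzbar j (\<lambda>z. complex_of_real (cutoff n z)) z =
    - of_real (real n * flat_power 2 (- real n * \<rho> z - 1)) * cnj (rho_z j z)"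
proof -
  have "((\<lambda>t. - real n * t - 1) has_real_derivative - real n) (at t)" for t
    by (auto intro!: derivative_eq_intros)
  from DERIV_chain2[OF flat_power_DERIV[of 0] this]
  have "((\<lambda>t. flat_power 0 (- real n * t - 1)) has_real_derivative - (real n * flat_power 2 (- real n * t - 1))) (at t)" for t
    by (simp add: mult.commute numeral_2_eq_2)
  from dzbar_of_real_compose[OF this smooth_rho, of j] show ?thesis
    by (simp add: dzbar_of_real[OF smooth_rho])
qed

abbreviation weight :: "real \<Rightarrow> real \<Rightarrow> 'n cspace \<Rightarrow> 'n cspace \<Rightarrow> complex" where
  "weight a b z0 z \<equiv> complex_of_real (exp (- quadratic_weight a b z0 z))"

text \<open>On the bounded domain the weight is bounded below, and t is at most 1 + t^2; so weighted
  square integrability implies integrability.\<close>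

lemma L2_forms_integrable:
  assumes "\<alpha> \<in> L2_forms D (quadratic_weight a b z0) q" "I \<in> multi_indices q"
  shows "integrable LD (\<lambda>z. \<alpha> z I)"
proof -
  obtain C where C: "C > 0" "\<And>z. z \<in> D \<Longrightarrow> norm (exp (quadratic_weight a b z0 z)) \<le> C"
    using smooth_bounded[OF smooth_compose_real[OF smooth_exp smooth_quadratic_weight] bounded_domain] by blast
  have i: "integrable LD (\<lambda>z. (cmod (\<alpha> z I))\<^sup>2 * exp (- quadratic_weight a b z0 z))"
    using assms by (simp add: L2_forms_def)
  have "integrable LD (\<lambda>z. 1 + C * ((cmod (\<alpha> z I))\<^sup>2 * exp (- quadratic_weight a b z0 z)))"
    using finite_measure.integrable_const[OF finite_measure_LD, of "1::real"] i by auto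
  moreover have "(\<lambda>z. \<alpha> z I) \<in> borel_measurable LD" using assms by (simp add: L2_forms_def)
  moreover have "AE z in LD. norm (\<alpha> z I) \<le> norm (1 + C * ((cmod (\<alpha> z I))\<^sup>2 * exp (- quadratic_weight a b z0 z)))"
  proof (rule AE_I2)
    fix z assume "z \<in> space LD"
    then have z: "z \<in> D" by (simp add: space_restrict_space)
    let ?t = "cmod (\<alpha> z I)" and ?e = "exp (- quadratic_weight a b z0 z)"
    have "1 = exp (quadratic_weight a b z0 z) * ?e" by (simp flip: exp_add)
    also have "\<dots> \<le> C * ?e" using C(2)[OF z] by (intro mult_right_mono) auto
    finally have "?t\<^sup>2 * 1 \<le> ?t\<^sup>2 * (C * ?e)" by (intro mult_left_mono) auto
    moreover have "2 * ?t \<le> 1 + ?t\<^sup>2"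
      using zero_le_power2[of "?t - 1"] unfolding power2_diff by simp
    then have "?t \<le> 1 + ?t\<^sup>2" using norm_ge_zero[of "\<alpha> z I"] by linarith
    ultimately have "?t \<le> 1 + C * (?t\<^sup>2 * ?e)" by (simp add: mult_ac)
    then show "norm (\<alpha> z I) \<le> norm (1 + C * (?t\<^sup>2 * ?e))" by simp
  qed
  ultimately show ?thesis by (rule Bochner_Integration.integrable_bound)
qed

lemma smooth_L2_forms:
  assumes "\<And>z. F z \<in> covectors q" "\<And>I. smooth (\<lambda>z. F z I)"
  shows "F \<in> L2_forms D (quadratic_weight a b z0) q"
proof -
  have "integrable LD (\<lambda>z. (cmod (F z I))\<^sup>2 * exp (- quadratic_weight a b z0 z))" for I
  proof -
    have "integrable LD (\<lambda>z. Re (F z I * cnj (F z I) * weight a b z0 z))"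
      by (intro integrable_Re integrable_smooth smooth_mult smooth_cnj smooth_exp_weight assms(2))
    then show ?thesis by (simp add: complex_norm_square[symmetric] flip: of_real_power)
  qed
  then show ?thesis using assms smooth_measurable_LD by (auto simp: L2_forms_def)
qed

lemma integrable_form_inner_smooth:
  assumes "\<And>I. I \<in> multi_indices q \<Longrightarrow> integrable LD (\<lambda>z. u z I)" "\<And>I. smooth (\<lambda>z. F z I)"
  shows "integrable LD (\<lambda>z. form_inner q (u z) (F z) * weight a b z0 z)"
proof -
  have "integrable LD (\<lambda>z. \<Sum>I\<in>multi_indices q. u z I * (cnj (F z I) * weight a b z0 z))"
    by (intro Bochner_Integration.integrable_sum integrable_mult_smooth assms smooth_mult smooth_cnj smooth_exp_weight)
  then show ?thesis by (simp add: form_inner_def sum_distrib_right mult.assoc)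
qed

text \<open>Conjugation turns \<open>dz\<close> into \<open>dzbar\<close>, and the factor produced
  by differentiating the weight is the zero-order term of the formal adjoint.\<close>

lemma sum_dzbar_weighted:
  assumes sm: "\<And>I. smooth (\<lambda>z. F z I)" and K: "length K = q"
  shows "(\<Sum>j\<in>UNIV. dzbar j (\<lambda>z. cnj (F z (j # K)) * weight a b z0 z) z) =
    - (cnj (weighted_adjoint a z0 q F z K) * weight a b z0 z)"
proof -
  have "dzbar j (\<lambda>z. cnj (F z (j # K)) * weight a b z0 z) z =
      cnj (dz j (\<lambda>z. F z (j # K)) z - of_real a * cnj (z $ j - z0 $ j) * F z (j # K)) * weight a b z0 z" for j
    by (subst dzbar_mult)
      (auto intro!: smooth_cnj sm smooth_exp_weight simp: dzbar_cnj[OF sm] dzbar_exp_weight algebra_simps)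
  then show ?thesis using K by (simp add: weighted_adjoint_def sum_distrib_right[symmetric])
qed

lemma sum_dzbar_cutoff:
  assumes sm: "\<And>I. smooth (\<lambda>z. F z I)" and K: "length K = q"
  shows "(\<Sum>j\<in>UNIV. dzbar j (\<lambda>z. complex_of_real (cutoff n z) * (cnj (F z (j # K)) * weight a b z0 z)) z) =
    - (of_real (cutoff n z) * (cnj (weighted_adjoint a z0 q F z K) * weight a b z0 z)
     + of_real (real n * flat_power 2 (- real n * \<rho> z - 1)) *
       (cnj (contraction F K z) * weight a b z0 z))"
proof -
  have "dzbar j (\<lambda>z. of_real (cutoff n z) * (cnj (F z (j # K)) * weight a b z0 z)) z =
      of_real (cutoff n z) * dzbar j (\<lambda>z. cnj (F z (j # K)) * weight a b z0 z) z
      - of_real (real n * flat_power 2 (- real n * \<rho> z - 1)) * (cnj (rho_z j z * F z (j # K)) * weight a b z0 z)" for j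
    unfolding dzbar_mult[OF smooth_of_real[OF smooth_cutoff] smooth_mult[OF smooth_cnj[OF sm] smooth_exp_weight]]
      dzbar_cutoff
    by (simp only: complex_cnj_mult) (simp add: mult_ac)
  then have "(\<Sum>j\<in>UNIV. dzbar j (\<lambda>z. of_real (cutoff n z) * (cnj (F z (j # K)) * weight a b z0 z)) z) =
      of_real (cutoff n z) * (\<Sum>j\<in>UNIV. dzbar j (\<lambda>z. cnj (F z (j # K)) * weight a b z0 z) z)
      - of_real (real n * flat_power 2 (- real n * \<rho> z - 1)) * (cnj (\<Sum>j\<in>UNIV. rho_z j z * F z (j # K)) * weight a b z0 z)"
    by (simp only: sum_subtractf sum_distrib_left[symmetric] sum_distrib_right[symmetric] cnj_sum)
  then show ?thesis
    unfolding sum_dzbar_weighted[of F, OF sm K] by simp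
qed

text \<open>The error term produced by differentiating the cutoff is controlled because the contraction of F
  with the gradient of \<open>\<rho>\<close> vanishes to first order on the boundary.\<close>

lemma adjoint_identity:
  assumes cov: "\<And>z. F z \<in> covectors (Suc q)" and sm: "\<And>I. smooth (\<lambda>z. F z I)"
    and bd: "\<And>K. length K = q \<Longrightarrow> \<exists>C. \<forall>z\<in>D. cmod (contraction F K z) \<le> C * \<bar>\<rho> z\<bar>"
    and u: "\<And>K. K \<in> multi_indices q \<Longrightarrow> integrable LD (\<lambda>z. u z K)"
    and v: "\<And>J. J \<in> multi_indices (Suc q) \<Longrightarrow> integrable LD (\<lambda>z. v z J)"
    and eq: "dbar_eq D q u v"
  shows "(LINT z|LD. form_inner (Suc q) (v z) (F z) * weight a b z0 z) =
    (LINT z|LD. form_inner q (u z) (weighted_adjoint a z0 q F z) * weight a b z0 z)"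
proof -
  let ?N = "multi_indices (Suc q) :: 'n list set"
  let ?M = "multi_indices q :: 'n list set"
  let ?\<beta> = "weighted_adjoint a z0 q F" and ?w = "weight a b z0"
  define c where "c = (\<lambda>n z. complex_of_real (cutoff n z))"
  \<comment> \<open>These are the functions to be inserted into the distributional equation; the
    cutoff supplies their compact support.\<close>
  define \<Psi> where "\<Psi> = (\<lambda>n z J. c n z * (cnj (F z J) * ?w z))"
  define E where "E = (\<lambda>n z K. of_real (real n * flat_power 2 (- real n * \<rho> z - 1)) *
       (cnj (contraction F K z) * ?w z))"
  let ?H = "\<lambda>n z K. c n z * (cnj (?\<beta> z K) * ?w z) + E n z K"
  let ?f = "\<lambda>z. form_inner (Suc q) (v z) (F z) * ?w z"
  have sw: "smooth (\<lambda>z. cnj (F z J) * ?w z)" for J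
    by (intro smooth_mult smooth_cnj sm smooth_exp_weight)
  have s\<Psi>: "smooth (\<lambda>z. \<Psi> n z J)" for n J
    unfolding \<Psi>_def c_def by (intro smooth_mult smooth_of_real smooth_cutoff sw)
  have cov\<Psi>: "\<Psi> n z \<in> covectors (Suc q)" for n z
  proof -
    have "(\<lambda>J. (c n z * ?w z) * cnj (F z J)) \<in> covectors (Suc q)"
      by (intro covectors_scale covectors_cnj cov)
    then show ?thesis by (simp add: \<Psi>_def mult_ac)
  qed
  have div: "(\<Sum>j\<in>UNIV. dzbar j (\<lambda>z. \<Psi> n z (j # K)) z) = - (?H n z K)"
    if "length K = q" for n z K
    unfolding \<Psi>_def c_def E_def by (rule sum_dzbar_cutoff[OF sm that])
  \<comment> \<open>The distributional equation tested with \<open>\<Psi>\<close>, regrouped over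
    pairs (K, j), so that u meets the divergence of \<open>\<Psi>\<close>: the cut-off formal
    adjoint plus the error E.\<close>
  have step: "(LINT z|LD. c n z * (?f z)) =
      (LINT z|LD. (\<Sum>K\<in>?M. u z K * ?H n z K))" for n
  proof -
    have iu: "integrable LD (\<lambda>z. u z (delete_nth k J) * dzbar (J ! k) (\<lambda>z. \<Psi> n z J) z)"
      if "J \<in> ?N" "k < Suc q" for J k
    proof -
      have "delete_nth k J \<in> ?M"
        using delete_nth_strict_sorted[of J k] that by (auto simp: multi_indices_def)
      then show ?thesis by (intro integrable_mult_smooth u smooth_dzbar s\<Psi>)
    qed
    have "(LINT z|LD. c n z * (?f z)) =
        (LINT z|LD. (\<Sum>J\<in>?N. v z J * \<Psi> n z J))"
      by (intro Bochner_Integration.integral_cong refl)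
        (simp add: form_inner_def \<Psi>_def sum_distrib_left sum_distrib_right mult_ac)
    also have "\<dots> = (\<Sum>J\<in>?N. (LINT z|LD. v z J * \<Psi> n z J))"
      by (intro Bochner_Integration.integral_sum integrable_mult_smooth v s\<Psi>)
    also have "\<dots> = (\<Sum>J\<in>?N. - (\<Sum>k<Suc q. (-1) ^ k *
        (LINT z|LD. u z (delete_nth k J) * dzbar (J ! k) (\<lambda>z. \<Psi> n z J) z)))"
    proof (rule sum.cong[OF refl])
      fix J :: "'n list" assume J: "J \<in> ?N"
      have "test_function D (\<lambda>z. \<Psi> n z J)"
        unfolding \<Psi>_def c_def by (rule test_function_cutoff[OF sw])
      then show "(LINT z|LD. v z J * \<Psi> n z J) = - (\<Sum>k<Suc q. (-1) ^ k *
        (LINT z|LD. u z (delete_nth k J) * dzbar (J ! k) (\<lambda>z. \<Psi> n z J) z))"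
        using eq J unfolding dbar_eq_def by blast
    qed
    also have "\<dots> = - (\<Sum>J\<in>?N. (\<Sum>k<Suc q. (LINT z|LD. (-1) ^ k *
        (u z (delete_nth k J) * dzbar (J ! k) (\<lambda>z. \<Psi> n z J) z))))"
      by (simp only: sum_negf integral_mult_right_zero)
    also have "(\<Sum>J\<in>?N. (\<Sum>k<Suc q. (LINT z|LD. (-1) ^ k *
        (u z (delete_nth k J) * dzbar (J ! k) (\<lambda>z. \<Psi> n z J) z)))) =
        (\<Sum>J\<in>?N. (LINT z|LD. (\<Sum>k<Suc q. (-1) ^ k *
        (u z (delete_nth k J) * dzbar (J ! k) (\<lambda>z. \<Psi> n z J) z))))"
      by (intro sum.cong refl Bochner_Integration.integral_sum[symmetric] integrable_mult_right) (auto intro: iu)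
    also have "\<dots> = (LINT z|LD. (\<Sum>J\<in>?N. \<Sum>k<Suc q. (-1) ^ k *
        (u z (delete_nth k J) * dzbar (J ! k) (\<lambda>z. \<Psi> n z J) z)))"
      by (intro Bochner_Integration.integral_sum[symmetric] Bochner_Integration.integrable_sum integrable_mult_right)
        (auto intro: iu)
    also have "\<dots> = (LINT z|LD. (\<Sum>K\<in>?M. \<Sum>j\<in>UNIV. u z K * dzbar j (\<lambda>z. \<Psi> n z (j # K)) z))"
      by (subst sum_delete_nth[where X = "\<lambda>K j. u _ K" and A = "\<lambda>j J. dzbar j (\<lambda>z. \<Psi> n z J) _"])
        (auto intro: covectors_dzbar cov\<Psi> s\<Psi>)
    also have "\<dots> = (LINT z|LD. - (\<Sum>K\<in>?M. u z K * ?H n z K))"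
      unfolding sum_negf[symmetric]
      by (intro Bochner_Integration.integral_cong refl sum.cong)
        (simp only: sum_distrib_left[symmetric], subst div, auto simp: multi_indices_def algebra_simps)
    finally show ?thesis by simp
  qed
  have c2: "cmod (c n z) \<le> 2" for n z using cutoff_bounds[of n z] by (simp add: c_def)
  \<comment> \<open>At a fixed z in D, \<open>- n * \<rho> z\<close> tends to infinity; pointwise
    limits suffice, since domination is provided separately by the uniform bounds.\<close>
  have c1: "(\<lambda>n. c n z) \<longlonglongrightarrow> 1" and E0: "(\<lambda>n. E n z K) \<longlonglongrightarrow> 0" if "z \<in> D" for z K
  proof -
    have t: "- \<rho> z > 0" using that by (simp add: domain_eq)
    have f: "filterlim (\<lambda>n. real n * - \<rho> z) at_top sequentially"
      using filterlim_at_top_mult_tendsto_pos[OF tendsto_const t filterlim_real_sequentially] .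
    have e: "- real n * \<rho> z - 1 = - 1 + real n * - \<rho> z" for n by simp
    have f': "filterlim (\<lambda>n. - real n * \<rho> z - 1) at_top sequentially"
      unfolding e by (rule filterlim_tendsto_add_at_top[OF tendsto_const f])
    have "(\<lambda>n. cutoff n z) \<longlonglongrightarrow> 1"
      using filterlim_compose[OF flat_power_at_top[of 0] f'] by simp
    then show "(\<lambda>n. c n z) \<longlonglongrightarrow> 1" unfolding c_def using tendsto_of_real by fastforce
    have "(\<lambda>n. real n * - \<rho> z * flat_power 2 (real n * - \<rho> z - 1)) \<longlonglongrightarrow> 0"
      by (rule filterlim_compose[OF weight_cutoff_tendsto f])
    then have "(\<lambda>n. (real n * - \<rho> z * flat_power 2 (real n * - \<rho> z - 1)) / (- \<rho> z)) \<longlonglongrightarrow> 0"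
      by (intro tendsto_divide_zero)
    then have "(\<lambda>n. real n * flat_power 2 (- real n * \<rho> z - 1)) \<longlonglongrightarrow> 0" using t by simp
    then have "(\<lambda>n. complex_of_real (real n * flat_power 2 (- real n * \<rho> z - 1))) \<longlonglongrightarrow> 0"
      using tendsto_of_real[of _ 0] by fastforce
    then show "(\<lambda>n. E n z K) \<longlonglongrightarrow> 0" unfolding E_def by (rule tendsto_mult_left_zero)
  qed
  obtain W where W: "W > 0" "\<And>z. z \<in> D \<Longrightarrow> cmod (?w z) \<le> W"
    using smooth_bounded[OF smooth_exp_weight bounded_domain] by blast
  have Ebd: "\<exists>C. \<forall>n. \<forall>z\<in>D. cmod (E n z K) \<le> C" if K: "length K = q" for K
  proof -
    obtain C where C: "\<And>z. z \<in> D \<Longrightarrow> cmod (contraction F K z) \<le> C * \<bar>\<rho> z\<bar>"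
      using bd[OF K] by blast
    have "cmod (E n z K) \<le> 4 * \<bar>C\<bar> * W" if z: "z \<in> D" for n z
    proof -
      let ?f = "flat_power 2 (- real n * \<rho> z - 1)" and ?S = "\<Sum>i\<in>UNIV. rho_z i z * F z (i # K)"
      have f0: "?f \<ge> 0" by (rule flat_power_bounds) simp
      have t: "\<bar>\<rho> z\<bar> = - \<rho> z" "- \<rho> z > 0" using z by (auto simp: domain_eq)
      have "cmod ?S \<le> \<bar>C\<bar> * \<bar>\<rho> z\<bar>"
        using C[OF z] mult_right_mono[of C "\<bar>C\<bar>" "\<bar>\<rho> z\<bar>"] by linarith
      then have 1: "real n * ?f * cmod ?S \<le> real n * ?f * (\<bar>C\<bar> * \<bar>\<rho> z\<bar>)"
        using f0 by (intro mult_left_mono) auto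
      have "(real n * - \<rho> z) * flat_power 2 ((real n * - \<rho> z) - 1) \<le> 4"
        using t by (intro weight_cutoff_bound mult_nonneg_nonneg) auto
      then have "\<bar>C\<bar> * ((real n * - \<rho> z) * flat_power 2 ((real n * - \<rho> z) - 1)) \<le> \<bar>C\<bar> * 4"
        by (intro mult_left_mono) auto
      then have 2: "real n * ?f * (\<bar>C\<bar> * \<bar>\<rho> z\<bar>) \<le> \<bar>C\<bar> * 4" using t by (simp add: mult_ac)
      have "cmod (E n z K) = (real n * ?f * cmod ?S) * cmod (?w z)"
        unfolding E_def norm_mult complex_mod_cnj norm_of_real using f0 by simp
      also have "\<dots> \<le> (\<bar>C\<bar> * 4) * W"
        by (rule mult_mono[OF order_trans[OF 1 2] W(2)[OF z]]) auto
      finally show ?thesis by (simp add: mult_ac)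
    qed
    then show ?thesis by blast
  qed
  have ms_c: "c n \<in> borel_measurable LD" for n
    unfolding c_def by (intro smooth_measurable_LD smooth_of_real smooth_cutoff)
  have ms_E: "(\<lambda>z. E n z K) \<in> borel_measurable LD" for n K
  proof -
    have "smooth (\<lambda>z. E n z K)"
      unfolding E_def
      by (intro smooth_mult smooth_of_real smooth_const smooth_compose_real[OF smooth_flat_power] smooth_diff
          smooth_rho smooth_cnj smooth_sum smooth_rho_z sm smooth_exp_weight)
    then show ?thesis by (rule smooth_measurable_LD)
  qed
  have sG: "smooth (\<lambda>z. cnj (?\<beta> z K) * ?w z)" for K
    by (intro smooth_mult smooth_cnj smooth_weighted_adjoint sm smooth_exp_weight)
  have il: "integrable LD (\<lambda>z. form_inner (Suc q) (v z) (F z) * ?w z)"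
    by (rule integrable_form_inner_smooth[OF v sm])
  have L: "(\<lambda>n. LINT z|LD. c n z * (?f z)) \<longlonglongrightarrow>
      (LINT z|LD. form_inner (Suc q) (v z) (F z) * ?w z)"
  proof (rule integral_dominated_convergence[where w = "\<lambda>z. 2 * cmod (?f z)"])
    show "(\<lambda>z. form_inner (Suc q) (v z) (F z) * ?w z) \<in> borel_measurable LD" using il by auto
    then show "(\<lambda>z. c n z * (?f z)) \<in> borel_measurable LD" for n
      by (rule borel_measurable_times[OF ms_c])
    show "integrable LD (\<lambda>z. 2 * cmod (?f z))" using il by auto
    show "AE z in LD. (\<lambda>n. c n z * (?f z)) \<longlonglongrightarrow>
        form_inner (Suc q) (v z) (F z) * ?w z"
      using tendsto_mult_right[OF c1] by (intro AE_I2) (fastforce simp: space_restrict_space)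
    show "AE z in LD. norm (c n z * (?f z)) \<le>
        2 * cmod (?f z)" for n
      unfolding norm_mult[of "c n _"] by (intro AE_I2 mult_right_mono c2) auto
  qed
  have "\<forall>K. \<exists>C. \<forall>n. \<forall>z\<in>D. length K = q \<longrightarrow> cmod (?H n z K) \<le> C"
  proof
    fix K show "\<exists>C. \<forall>n. \<forall>z\<in>D. length K = q \<longrightarrow> cmod (?H n z K) \<le> C"
    proof (cases "length K = q")
      case True
      obtain C1 where C1: "\<And>n z. z \<in> D \<Longrightarrow> cmod (E n z K) \<le> C1" using Ebd[OF True] by blast
      obtain C2 where C2: "\<And>z. z \<in> D \<Longrightarrow> cmod (cnj (?\<beta> z K) * ?w z) \<le> C2"
        using smooth_bounded[OF sG bounded_domain] by blast
      have "cmod (?H n z K) \<le> 2 * C2 + C1" if z: "z \<in> D" for n z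
      proof -
        have "cmod (c n z * (cnj (?\<beta> z K) * ?w z)) \<le> 2 * C2"
          unfolding norm_mult[of "c n z"] using c2 C2[OF z] by (intro mult_mono) auto
        then show ?thesis using C1[OF z, of n] norm_triangle_ineq[of "c n z * (cnj (?\<beta> z K) * ?w z)" "E n z K"] by linarith
      qed
      then show ?thesis by blast
    qed auto
  qed
  then obtain C where C: "\<And>K n z. z \<in> D \<Longrightarrow> length K = q \<Longrightarrow> cmod (?H n z K) \<le> C K"
    by metis
  have R: "(\<lambda>n. LINT z|LD. (\<Sum>K\<in>?M. u z K * ?H n z K)) \<longlonglongrightarrow>
      (LINT z|LD. (\<Sum>K\<in>?M. u z K * (1 * (cnj (?\<beta> z K) * ?w z) + 0)))"
  proof (rule integral_dominated_convergence[where w = "\<lambda>z. \<Sum>K\<in>?M. cmod (u z K) * C K"])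
    show "(\<lambda>z. \<Sum>K\<in>?M. u z K * (1 * (cnj (?\<beta> z K) * ?w z) + 0)) \<in> borel_measurable LD"
      by (intro borel_measurable_sum borel_measurable_times[OF borel_measurable_integrable[OF u]])
        (simp_all add: smooth_measurable_LD[OF sG])
    show "(\<lambda>z. \<Sum>K\<in>?M. u z K * ?H n z K) \<in> borel_measurable LD" for n
      by (intro borel_measurable_sum borel_measurable_times[OF borel_measurable_integrable[OF u]]
          borel_measurable_add[OF borel_measurable_times[OF ms_c smooth_measurable_LD[OF sG]] ms_E])
    show "integrable LD (\<lambda>z. \<Sum>K\<in>?M. cmod (u z K) * C K)"
      using u by (intro Bochner_Integration.integrable_sum integrable_mult_left integrable_norm)
    show "AE z in LD. (\<lambda>n. \<Sum>K\<in>?M. u z K * ?H n z K) \<longlonglongrightarrow>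
        (\<Sum>K\<in>?M. u z K * (1 * (cnj (?\<beta> z K) * ?w z) + 0))"
    proof (rule AE_I2)
      fix z assume "z \<in> space LD"
      then have z: "z \<in> D" by (simp add: space_restrict_space)
      show "(\<lambda>n. \<Sum>K\<in>?M. u z K * ?H n z K) \<longlonglongrightarrow>
        (\<Sum>K\<in>?M. u z K * (1 * (cnj (?\<beta> z K) * ?w z) + 0))"
        by (intro tendsto_sum tendsto_mult tendsto_add tendsto_const c1[OF z] E0[OF z])
    qed
    show "AE z in LD. norm (\<Sum>K\<in>?M. u z K * ?H n z K) \<le>
        (\<Sum>K\<in>?M. cmod (u z K) * C K)" for n
    proof (rule AE_I2)
      fix z assume "z \<in> space LD"
      then have z: "z \<in> D" by (simp add: space_restrict_space)
      show "norm (\<Sum>K\<in>?M. u z K * ?H n z K) \<le>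
        (\<Sum>K\<in>?M. cmod (u z K) * C K)"
        using C[OF z] by (intro sum_norm_le) (auto simp: norm_mult[of "u z _"] multi_indices_def intro!: mult_left_mono)
    qed
  qed
  have "(LINT z|LD. form_inner (Suc q) (v z) (F z) * ?w z) =
      (LINT z|LD. (\<Sum>K\<in>?M. u z K * (1 * (cnj (?\<beta> z K) * ?w z) + 0)))"
    using L R unfolding step by (rule LIMSEQ_unique)
  then show ?thesis by (simp add: form_inner_def sum_distrib_right mult.assoc)
qed

end

context defined_domain
begin

lemma smooth_in_adjoint_dom:
  assumes cov: "\<And>z. F z \<in> covectors (Suc q)" and sm: "\<And>I. smooth (\<lambda>z. F z I)"
    and bd: "\<And>K. length K = q \<Longrightarrow> \<exists>C. \<forall>z\<in>D. cmod (contraction F K z) \<le> C * \<bar>\<rho> z\<bar>"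
  shows "F \<in> dbar_adjoint_dom D (quadratic_weight a b z0) q"
proof -
  let ?\<phi> = "quadratic_weight a b z0" and ?\<beta> = "weighted_adjoint a z0 q F"
  have "F \<in> L2_forms D ?\<phi> (Suc q)" by (rule smooth_L2_forms[OF cov sm])
  moreover have "?\<beta> \<in> L2_forms D ?\<phi> q"
    by (rule smooth_L2_forms[OF weighted_adjoint_covector[OF cov sm] smooth_weighted_adjoint[OF sm]])
  moreover have "L2_inner D ?\<phi> (Suc q) v F = L2_inner D ?\<phi> q u ?\<beta>"
    if u: "u \<in> L2_forms D ?\<phi> q" and v: "v \<in> L2_forms D ?\<phi> (Suc q)" and eq: "dbar_eq D q u v" for u v
    unfolding L2_inner_def
    by (rule adjoint_identity[OF cov sm bd L2_forms_integrable[OF u] L2_forms_integrable[OF v] eq])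
  ultimately show ?thesis unfolding dbar_adjoint_dom_def by blast
qed

end

section \<open>The basic inequality\<close>

text \<open>Each increasing J of length q + 1 is counted once for each entry that can be removed,
  and the signs of moving that entry cancel in the product. This is the origin of the factor q in
  the estimate.\<close>

lemma sum_contractions:
  fixes \<alpha> :: "'n::{finite,linorder} list \<Rightarrow> complex"
  assumes \<alpha>: "\<alpha> \<in> covectors (Suc q)"
  shows "(\<Sum>K\<in>multi_indices q. \<Sum>j\<in>UNIV. \<alpha> (j # K) * cnj (\<alpha> (j # K))) =
    of_nat (Suc q) * form_inner (Suc q) \<alpha> \<alpha>"
proof -
  have "(\<Sum>K\<in>multi_indices q. \<Sum>j\<in>UNIV. \<alpha> (j # K) * cnj (\<alpha> (j # K))) =
    (\<Sum>J\<in>multi_indices (Suc q). \<Sum>k<Suc q. (-1) ^ k * (\<alpha> (J ! k # delete_nth k J) * cnj (\<alpha> J)))"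
    by (rule sum_delete_nth[symmetric, where X = "\<lambda>K j. \<alpha> (j # K)" and A = "\<lambda>j J. cnj (\<alpha> J)"])
      (rule covectors_cnj[OF \<alpha>])
  also have "\<dots> = (\<Sum>J\<in>multi_indices (Suc q). \<Sum>k<Suc q. \<alpha> J * cnj (\<alpha> J))"
  proof (intro sum.cong refl)
    fix J :: "'n list" and k assume "J \<in> multi_indices (Suc q)" "k \<in> {..<Suc q}"
    then have "k < length J" by (simp add: multi_indices_def)
    from covectors_delete_nth[OF \<alpha> this, symmetric]
    have "(-1) ^ k * (\<alpha> (J ! k # delete_nth k J) * cnj (\<alpha> J)) = ((-1) ^ k * (-1) ^ k) * (\<alpha> J * cnj (\<alpha> J))"
      by simp
    also have "(-1) ^ k * (-1) ^ k = (1::complex)" by (simp flip: power_mult_distrib)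
    finally show "(-1) ^ k * (\<alpha> (J ! k # delete_nth k J) * cnj (\<alpha> J)) = \<alpha> J * cnj (\<alpha> J)" by simp
  qed
  finally show ?thesis by (simp add: form_inner_def sum_distrib_left)
qed

text \<open>This is C of the overview and \<open>boundary_density\<close> is S. In both, q is one
  less than the degree of F.\<close>

definition curvature_rest :: "nat \<Rightarrow> 'n::{finite,linorder} form \<Rightarrow> 'n cspace \<Rightarrow> complex" where
  "curvature_rest q F z = - (\<Sum>K\<in>multi_indices q. \<Sum>j\<in>UNIV. \<Sum>i\<in>UNIV.
     dzbar j (dz i (\<lambda>z. F z (i # K))) z * cnj (F z (j # K)))"

definition boundary_density :: "'n::{finite,linorder} cspace \<Rightarrow> nat \<Rightarrow> 'n form \<Rightarrow> 'n cspace \<Rightarrow> complex" where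
  "boundary_density z0 q F z = (\<Sum>K\<in>multi_indices q. \<Sum>j\<in>UNIV. \<Sum>i\<in>UNIV.
     cnj (z $ i - z0 $ i) * dzbar j (\<lambda>z. F z (i # K)) z * cnj (F z (j # K)))"

lemma smooth_curvature_rest: "(\<And>I. smooth (\<lambda>z. F z I)) \<Longrightarrow> smooth (curvature_rest q F)"
  unfolding curvature_rest_def[abs_def]
  by (intro smooth_minus smooth_sum smooth_mult smooth_dzbar smooth_dz smooth_cnj)

lemma smooth_boundary_density: "(\<And>I. smooth (\<lambda>z. F z I)) \<Longrightarrow> smooth (boundary_density z0 q F)"
  unfolding boundary_density_def[abs_def]
  by (intro smooth_sum smooth_mult smooth_dzbar smooth_cnj smooth_diff smooth_vec_nth smooth_const)

text \<open>The term a F_jK is the commutator of the \<open>dzbar j\<close> derivative with the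
  zero-order term: differentiating the conjugate of z_i - z0_i gives 1 for i = j and 0
  otherwise.\<close>

lemma dzbar_weighted_adjoint:
  fixes F :: "'n::{finite,linorder} form"
  assumes sm: "\<And>I. smooth (\<lambda>z. F z I)" and K: "length K = q"
  shows "dzbar j (\<lambda>z. weighted_adjoint a z0 q F z K) z =
    of_real a * F z (j # K) - (\<Sum>i\<in>UNIV. dzbar j (dz i (\<lambda>z. F z (i # K))) z)
    + of_real a * (\<Sum>i\<in>UNIV. cnj (z $ i - z0 $ i) * dzbar j (\<lambda>z. F z (i # K)) z)"
proof -
  let ?A = "\<lambda>i z. dz i (\<lambda>z. F z (i # K)) z" and ?z = "\<lambda>i z. cnj (z $ i - z0 $ i)"
  have sz: "smooth (?z i)" for i by (intro smooth_cnj smooth_diff smooth_vec_nth smooth_const)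
  have d0: "smooth (\<lambda>z. z $ i - z0 $ i)" for i by (intro smooth_diff smooth_vec_nth smooth_const)
  have dz: "dzbar j (?z i) z = (if i = j then 1 else 0)" for i
  proof -
    have "dz j (\<lambda>z. z $ i + - (z0 $ i)) z = dz j (\<lambda>z. z $ i) z + dz j (\<lambda>z. - (z0 $ i)) z"
      by (rule dz_add[OF smooth_vec_nth smooth_const])
    then have "dz j (\<lambda>z. z $ i - z0 $ i) z = (if j = i then 1 else 0)" by (simp add: dz_vec_nth)
    then show ?thesis unfolding dzbar_cnj[OF d0] by auto
  qed
  have sP: "smooth (\<lambda>z. complex_of_real a * (?z i z * F z (i # K)))" for i
    by (intro smooth_mult smooth_const sz sm)
  have sA: "smooth (?A i)" for i by (intro smooth_dz sm)
  have eq: "(\<lambda>z. weighted_adjoint a z0 q F z K) =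
      (\<lambda>z. \<Sum>i\<in>UNIV. of_real a * (?z i z * F z (i # K)) + - ?A i z)"
    using K by (simp add: weighted_adjoint_def fun_eq_iff sum_negf[symmetric] mult.assoc del: sum_negf)
  have "dzbar j (\<lambda>z. weighted_adjoint a z0 q F z K) z =
      (\<Sum>i\<in>UNIV. dzbar j (\<lambda>z. of_real a * (?z i z * F z (i # K)) + - ?A i z) z)"
    unfolding eq by (rule dzbar_sum) (intro smooth_add sP smooth_minus sA)
  also have "\<dots> = (\<Sum>i\<in>UNIV. of_real a * ((if i = j then 1 else 0) * F z (i # K) + ?z i z * dzbar j (\<lambda>z. F z (i # K)) z)
      - dzbar j (?A i) z)"
    by (intro sum.cong refl)
      (simp only: dzbar_add[OF sP smooth_minus[OF sA]] dzbar_minus[OF sA]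
        dzbar_cmult[OF smooth_mult[OF sz sm]] dzbar_mult[OF sz sm] dz, simp)
  also have "\<dots> = complex_of_real a * (\<Sum>i\<in>UNIV. (if i = j then 1 else 0) * F z (i # K)) +
      of_real a * (\<Sum>i\<in>UNIV. ?z i z * dzbar j (\<lambda>z. F z (i # K)) z) - (\<Sum>i\<in>UNIV. dzbar j (?A i) z)"
    by (simp only: sum_subtractf sum_distrib_left sum.distrib distrib_left)
  also have "(\<Sum>i\<in>UNIV. (if i = j then 1 else 0) * F z (i # K)) = F z (j # K)"
    by (simp add: if_distrib[of "\<lambda>x. x * _"] cong: if_cong)
  finally show ?thesis by simp
qed

text \<open>A pointwise identity: nothing is integrated, all derivatives stay on one factor, and so
  no boundary term can arise.\<close>

lemma pairing_dbar_adjoint: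
  fixes F :: "'n::{finite,linorder} form"
  assumes cov: "\<And>z. F z \<in> covectors (Suc q)" and sm: "\<And>I. smooth (\<lambda>z. F z I)"
  shows "form_inner (Suc q) (\<lambda>J. \<Sum>k<Suc q. (-1) ^ k * dzbar (J ! k) (\<lambda>z. weighted_adjoint a z0 q F z (delete_nth k J)) z) (F z) =
    of_real (a * real (Suc q)) * form_inner (Suc q) (F z) (F z) +
    (curvature_rest q F z + of_real a * boundary_density z0 q F z)"
proof -
  let ?M = "multi_indices q :: 'n list set"
  have "form_inner (Suc q) (\<lambda>J. \<Sum>k<Suc q. (-1) ^ k * dzbar (J ! k) (\<lambda>z. weighted_adjoint a z0 q F z (delete_nth k J)) z) (F z) =
    (\<Sum>J\<in>multi_indices (Suc q). \<Sum>k<Suc q. (-1) ^ k * (dzbar (J ! k) (\<lambda>z. weighted_adjoint a z0 q F z (delete_nth k J)) z * cnj (F z J)))"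
    by (simp only: form_inner_def sum_distrib_right mult.assoc)
  also have "\<dots> = (\<Sum>K\<in>?M. \<Sum>j\<in>UNIV. dzbar j (\<lambda>z. weighted_adjoint a z0 q F z K) z * cnj (F z (j # K)))"
    by (rule sum_delete_nth[where X = "\<lambda>K j. dzbar j (\<lambda>z. weighted_adjoint a z0 q F z K) z" and A = "\<lambda>j J. cnj (F z J)"])
      (rule covectors_cnj[OF cov])
  also have "\<dots> = (\<Sum>K\<in>?M. \<Sum>j\<in>UNIV. of_real a * (F z (j # K) * cnj (F z (j # K)))
      - (\<Sum>i\<in>UNIV. dzbar j (dz i (\<lambda>z. F z (i # K))) z * cnj (F z (j # K)))
      + of_real a * (\<Sum>i\<in>UNIV. cnj (z $ i - z0 $ i) * dzbar j (\<lambda>z. F z (i # K)) z * cnj (F z (j # K))))"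
    by (intro sum.cong refl, subst dzbar_weighted_adjoint[OF sm])
      (auto simp: multi_indices_def algebra_simps sum_distrib_left sum_distrib_right)
  also have "\<dots> = complex_of_real a * (\<Sum>K\<in>?M. \<Sum>j\<in>UNIV. F z (j # K) * cnj (F z (j # K)))
    + (curvature_rest q F z + of_real a * boundary_density z0 q F z)"
    unfolding curvature_rest_def boundary_density_def
    by (simp only: sum.distrib sum_subtractf sum_distrib_left[symmetric]) simp
  finally show ?thesis unfolding sum_contractions[OF cov] by simp
qed

lemma form_normsq_eq: "form_normsq q \<alpha> = (\<Sum>I\<in>multi_indices q. (cmod (\<alpha> I))\<^sup>2)"
proof -
  have "form_inner q \<alpha> \<alpha> = complex_of_real (\<Sum>I\<in>multi_indices q. (cmod (\<alpha> I))\<^sup>2)"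
    by (simp add: form_inner_def complex_norm_square[symmetric])
  then show ?thesis by (simp add: form_normsq_def)
qed

lemma form_inner_self: "form_inner q \<alpha> \<alpha> = complex_of_real (form_normsq q \<alpha>)"
  by (simp add: form_inner_def complex_norm_square[symmetric] form_normsq_eq)

text \<open>Young's inequality with a parameter, summed over the coefficients.\<close>

lemma form_inner_Re_le:
  assumes t: "t > 0"
  shows "2 * Re (form_inner q \<alpha> \<beta>) \<le> t * form_normsq q \<alpha> + form_normsq q \<beta> / t"
proof -
  have "2 * Re (x * cnj y) \<le> t * (cmod x)\<^sup>2 + (cmod y)\<^sup>2 / t" for x y :: complex
  proof -
    have "2 * Re (x * cnj y) \<le> 2 * (cmod x * cmod y)"
      using complex_Re_le_cmod[of "x * cnj y"] by (simp add: norm_mult)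
    also have "\<dots> \<le> t * (cmod x)\<^sup>2 + (cmod y)\<^sup>2 / t"
    proof -
      have "0 \<le> (t * cmod x - cmod y)\<^sup>2 / t" using t by simp
      also have "\<dots> = t * (cmod x)\<^sup>2 + (cmod y)\<^sup>2 / t - 2 * (cmod x * cmod y)"
        using t by (simp add: power2_eq_square field_simps)
      finally show ?thesis by simp
    qed
    finally show ?thesis .
  qed
  then have "(\<Sum>I\<in>multi_indices q. 2 * Re (\<alpha> I * cnj (\<beta> I))) \<le>
      (\<Sum>I\<in>multi_indices q. t * (cmod (\<alpha> I))\<^sup>2 + (cmod (\<beta> I))\<^sup>2 / t)"
    by (intro sum_mono)
  then show ?thesis
    by (simp only: form_inner_def form_normsq_eq Re_sum sum_distrib_left sum.distrib sum_divide_distrib)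
qed

context defined_domain
begin

lemma form_normsq_integrable:
  assumes "u \<in> L2_forms D (quadratic_weight a b z0) q"
  shows "integrable LD (\<lambda>z. form_normsq q (u z) * exp (- quadratic_weight a b z0 z))"
  unfolding form_normsq_eq sum_distrib_right
  using assms by (intro Bochner_Integration.integrable_sum) (simp add: L2_forms_def)

lemma form_normsq_integral_eq:
  "integrable LD (\<lambda>z. form_inner q (F z) (F z) * weight a b z0 z) \<Longrightarrow>
    (LINT z|LD. form_normsq q (F z) * exp (- quadratic_weight a b z0 z)) =
    Re (LINT z|LD. form_inner q (F z) (F z) * weight a b z0 z)"
  by (subst integral_Re[symmetric]) (simp_all add: form_inner_self)

lemma basic_inequality:
  assumes cov: "\<And>z. F z \<in> covectors (Suc q)" and sm: "\<And>I. smooth (\<lambda>z. F z I)"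
    and bd: "\<And>K. length K = q \<Longrightarrow> \<exists>C. \<forall>z\<in>D. cmod (contraction F K z) \<le> C * \<bar>\<rho> z\<bar>"
    and a: "a > 0"
    and u: "u \<in> L2_forms D (quadratic_weight a b z0) q" "dbar_eq D q u F"
    and le: "(LINT z|LD. form_normsq q (u z) * exp (- quadratic_weight a b z0 z)) \<le>
      1 / (a * real (Suc q)) * (LINT z|LD. form_normsq (Suc q) (F z) * exp (- quadratic_weight a b z0 z))"
  shows "0 \<le> (LINT z|LD. (Re (curvature_rest q F z) + a * Re (boundary_density z0 q F z)) *
      exp (- quadratic_weight a b z0 z))"
proof -
  let ?\<beta> = "weighted_adjoint a z0 q F" and ?w = "weight a b z0"
  let ?e = "\<lambda>z. exp (- quadratic_weight a b z0 z)"
  \<comment> \<open>With this parameter the assumed bound on u absorbs exactly half of 2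
    \<open>NF\<close>, which leaves \<open>t * NF\<close> at most \<open>NB\<close>.\<close>
  define t where "t = a * real (Suc q)"
  have t: "t > 0" using a by (simp add: t_def)
  have cov\<beta>: "?\<beta> z \<in> covectors q" for z by (rule weighted_adjoint_covector[OF cov sm])
  have sm\<beta>: "smooth (\<lambda>z. ?\<beta> z K)" for K by (rule smooth_weighted_adjoint[OF sm])
  define NF where "NF = (LINT z|LD. form_normsq (Suc q) (F z) * ?e z)"
  define NB where "NB = (LINT z|LD. form_normsq q (?\<beta> z) * ?e z)"
  define Nu where "Nu = (LINT z|LD. form_normsq q (u z) * ?e z)"
  have iFF: "integrable LD (\<lambda>z. form_inner (Suc q) (F z) (F z) * ?w z)"
    by (intro integrable_form_inner_smooth integrable_smooth sm)
  have iBB: "integrable LD (\<lambda>z. form_inner q (?\<beta> z) (?\<beta> z) * ?w z)"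
    by (intro integrable_form_inner_smooth integrable_smooth sm\<beta>)
  have iuB: "integrable LD (\<lambda>z. form_inner q (u z) (?\<beta> z) * ?w z)"
    by (rule integrable_form_inner_smooth[OF L2_forms_integrable[OF u(1)] sm\<beta>])
  have NF: "NF = Re (LINT z|LD. form_inner (Suc q) (F z) (F z) * ?w z)"
    unfolding NF_def by (rule form_normsq_integral_eq[OF iFF])
  have NB: "NB = Re (LINT z|LD. form_inner q (?\<beta> z) (?\<beta> z) * ?w z)"
    unfolding NB_def by (rule form_normsq_integral_eq[OF iBB])
  have "(LINT z|LD. form_inner (Suc q) (F z) (F z) * ?w z) = (LINT z|LD. form_inner q (u z) (?\<beta> z) * ?w z)"
    by (rule adjoint_identity[OF cov sm bd L2_forms_integrable[OF u(1)] integrable_smooth[OF sm] u(2)])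
  then have "2 * NF = (LINT z|LD. 2 * Re (form_inner q (u z) (?\<beta> z) * ?w z))"
    unfolding NF by (simp only: integral_mult_right_zero integral_Re[OF iuB])
  also have "\<dots> \<le> (LINT z|LD. t * (form_normsq q (u z) * ?e z) + form_normsq q (?\<beta> z) * ?e z / t)"
  proof (rule integral_mono)
    show "integrable LD (\<lambda>z. 2 * Re (form_inner q (u z) (?\<beta> z) * ?w z))"
      by (intro integrable_mult_right integrable_Re iuB)
    show "integrable LD (\<lambda>z. t * (form_normsq q (u z) * ?e z) + form_normsq q (?\<beta> z) * ?e z / t)"
      by (intro Bochner_Integration.integrable_add integrable_mult_right integrable_divide
          form_normsq_integrable u smooth_L2_forms cov\<beta> sm\<beta>)
    fix z
    have "2 * Re (form_inner q (u z) (?\<beta> z)) * ?e z \<le> (t * form_normsq q (u z) + form_normsq q (?\<beta> z) / t) * ?e z"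
      by (rule mult_right_mono[OF form_inner_Re_le[OF t]]) simp
    then show "2 * Re (form_inner q (u z) (?\<beta> z) * ?w z) \<le>
        t * (form_normsq q (u z) * ?e z) + form_normsq q (?\<beta> z) * ?e z / t"
      by (simp add: algebra_simps)
  qed
  also have "\<dots> = t * Nu + NB / t"
    unfolding Nu_def NB_def
    by (subst Bochner_Integration.integral_add)
      (auto intro!: integrable_mult_right integrable_divide form_normsq_integrable u smooth_L2_forms cov\<beta> sm\<beta>)
  finally have "2 * NF \<le> t * Nu + NB / t" .
  moreover have "t * Nu \<le> t * (1 / t * NF)"
    using le t unfolding Nu_def NF_def t_def by (intro mult_left_mono) auto
  ultimately have "NF \<le> NB / t" using t by simp
  then have 1: "t * NF \<le> NB" using t by (simp add: field_simps)
  \<comment> \<open>The second use of the adjoint identity, with dbar* F in the place of u and v its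
    classical dbar. The boundary condition is again required of F alone.\<close>
  define v where "v = (\<lambda>z J. \<Sum>k<Suc q. (-1) ^ k * dzbar (J ! k) (\<lambda>z. ?\<beta> z (delete_nth k J)) z)"
  have smv: "smooth (\<lambda>z. v z J)" for J
    unfolding v_def by (intro smooth_sum smooth_mult smooth_const smooth_dzbar sm\<beta>)
  have "dbar_eq D q ?\<beta> v" unfolding v_def by (rule dbar_eq_smooth[OF sm\<beta>])
  from adjoint_identity[OF cov sm bd integrable_smooth[OF sm\<beta>] integrable_smooth[OF smv] this, of a b z0]
  have "NB = Re (LINT z|LD. form_inner (Suc q) (v z) (F z) * ?w z)" unfolding NB by simp
  also have "\<dots> = Re (LINT z|LD. of_real t * (form_inner (Suc q) (F z) (F z) * ?w z) +
      (curvature_rest q F z + of_real a * boundary_density z0 q F z) * ?w z)"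
    unfolding v_def pairing_dbar_adjoint[OF cov sm] t_def by (simp only: distrib_right mult.assoc)
  also have "\<dots> = t * NF + Re (LINT z|LD. (curvature_rest q F z + of_real a * boundary_density z0 q F z) * ?w z)"
    unfolding NF
    by (subst Bochner_Integration.integral_add[OF integrable_mult_right[OF iFF] integrable_smooth])
      (auto intro!: smooth_mult smooth_add smooth_const
        smooth_exp_weight smooth_curvature_rest smooth_boundary_density sm)
  also have "Re (LINT z|LD. (curvature_rest q F z + of_real a * boundary_density z0 q F z) * ?w z) =
      (LINT z|LD. Re ((curvature_rest q F z + of_real a * boundary_density z0 q F z) * ?w z))"
    by (rule integral_Re[symmetric], intro integrable_smooth smooth_mult smooth_add smooth_const
        smooth_exp_weight smooth_curvature_rest smooth_boundary_density sm)
  finally show ?thesis using 1 by simp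
qed

section \<open>Concentration at a boundary point\<close>

text \<open>If B were negative at p, a small piece of D near p would contribute about -a exp(-a
  \<open>\<eta>\<close>), while everything outside a neighbourhood of p contributes at most a
  multiple of (1 + a) exp(-2 a \<open>\<eta>\<close>); after division by exp(-a
  \<open>\<eta>\<close>) the negative term wins for large a. The bounded function A cannot
  compensate the factor a.\<close>

lemma concentration:
  fixes A B :: "'n cspace \<Rightarrow> real"
  assumes p: "p \<in> frontier D" and r: "r \<ge> 0" "norm (p - z0) = r"
    and ext: "\<And>z. z \<in> D \<Longrightarrow> (norm (z - z0))\<^sup>2 \<ge> r\<^sup>2 + (norm (z - p))\<^sup>2 / 2"
    and A: "smooth A" and B: "smooth B"
    and nonneg: "\<And>a. a > 0 \<Longrightarrow> 0 \<le> (LINT z|LD. (A z + a * B z) * exp (- quadratic_weight a 1 z0 z))"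
  shows "0 \<le> B p"
proof (rule ccontr)
  assume "\<not> 0 \<le> B p"
  define c where "c = - B p / 2"
  have c: "c > 0" using \<open>\<not> 0 \<le> B p\<close> by (simp add: c_def)
  have "isCont B p" using smooth_continuous_on[OF B, of UNIV] by (simp add: continuous_on_eq_continuous_at)
  then obtain \<epsilon> where \<epsilon>: "\<epsilon> > 0" "\<And>z. dist z p < \<epsilon> \<Longrightarrow> dist (B z) (B p) < c"
    using c unfolding continuous_at_eps_delta by (metis dist_real_def dist_norm)
  have Bneg: "B z \<le> - c" if "dist z p < \<epsilon>" for z
    using \<epsilon>(2)[OF that] by (simp add: dist_real_def c_def abs_less_iff)
  obtain MA where MA: "MA > 0" "\<And>z. z \<in> D \<Longrightarrow> norm (A z) \<le> MA" using smooth_bounded[OF A bounded_domain] by blast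
  obtain MB where MB: "MB > 0" "\<And>z. z \<in> D \<Longrightarrow> norm (B z) \<le> MB" using smooth_bounded[OF B bounded_domain] by blast
  define M where "M = max MA MB"
  have M: "M > 0" "\<And>z. z \<in> D \<Longrightarrow> \<bar>A z\<bar> \<le> M" "\<And>z. z \<in> D \<Longrightarrow> \<bar>B z\<bar> \<le> M"
    using MA MB by (force simp: M_def)+
  \<comment> \<open>Outside the ball of radius \<open>\<epsilon>\<close> the gap |z - z0|^2 - r^2 is
    at least \<open>\<epsilon>\<close>^2 / 2 = 2 \<open>\<eta>\<close>.\<close>
  define \<eta> where "\<eta> = \<epsilon>\<^sup>2 / 4"
  have \<eta>: "\<eta> > 0" using \<epsilon> by (simp add: \<eta>_def)
  \<comment> \<open>Within distance s of p the gap is at most \<open>\<eta>\<close>: s^2 is at most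
    s, and s (2r + 1) is at most \<open>\<eta>\<close>.\<close>
  define s where "s = min \<epsilon> (min 1 (\<eta> / (2 * r + 1)))"
  have s: "s > 0" "s \<le> \<epsilon>" "s \<le> 1" "s \<le> \<eta> / (2 * r + 1)" using \<epsilon> \<eta> r by (auto simp: s_def)
  have s2: "(r + s)\<^sup>2 \<le> r\<^sup>2 + \<eta>"
  proof -
    have "s * s \<le> s * 1" using s by (intro mult_left_mono) auto
    moreover have "s * (2 * r + 1) \<le> \<eta>" using s(4) r by (simp add: field_simps)
    ultimately show ?thesis by (simp add: power2_eq_square algebra_simps)
  qed
  define S where "S = D \<inter> ball p s"
  define V1 where "V1 = measure lebesgue S"
  define V where "V = measure lebesgue D"
  have So: "open S" unfolding S_def using open_domain by auto
  \<comment> \<open>p lies in the closure of D, so the open set S is nonempty and therefore has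
    positive measure.\<close>
  have "S \<noteq> {}"
    using p s(1) unfolding S_def frontier_def closure_approachable
    by (metis (no_types, lifting) DiffD1 IntI closure_approachable dist_commute empty_iff mem_ball)
  then have "\<not> negligible S" using open_not_negligible[OF So] by blast
  moreover have Sm: "S \<in> lmeasurable"
    by (rule lmeasurable_open[OF bounded_subset[OF bounded_domain] So]) (simp add: S_def)
  ultimately have V1: "V1 > 0"
    unfolding V1_def by (metis negligible_iff_measure measure_nonneg order_le_less)
  \<comment> \<open>Bounds \<open>M * V * ((1 + a) * exp (- a * \<eta>))\<close> for all a > 0 at
    once, since exp(a \<open>\<eta>\<close>) is at least 1 + a \<open>\<eta>\<close>.\<close>
  define Kc where "Kc = M * V * (1 + 1 / \<eta>)"
  have V: "V \<ge> 0" by (simp add: V_def)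
  have Kc: "Kc \<ge> 0" using M V \<eta> by (simp add: Kc_def)
  have key: "0 \<le> (M - c * a) * V1 + Kc" if a: "a \<ge> M / c" for a
  proof -
    have apos: "a > 0" using a M c by (meson divide_pos_pos less_le_trans)
    have ca: "M - c * a \<le> 0" using a c by (simp add: field_simps)
    \<comment> \<open>The weight normalized to be 1 at p, where |p - z0| = r.\<close>
    let ?E = "\<lambda>z. exp (- a * ((norm (z - z0))\<^sup>2 - r\<^sup>2))"
    have ee: "exp (- quadratic_weight a 1 z0 z) = exp (1 - a * r\<^sup>2) * ?E z" for z
      by (simp add: quadratic_weight_def algebra_simps flip: exp_add)
    have ex: "exp (- quadratic_weight a 1 z0 z) / exp (1 - a * r\<^sup>2) = ?E z" for z
      unfolding ee by simp
    have int: "integrable LD (\<lambda>z. (A z + a * B z) * ?E z)"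
    proof -
      have "integrable LD (\<lambda>z. Re (of_real (A z + a * B z) * weight a 1 z0 z / exp (1 - a * r\<^sup>2)))"
        by (intro integrable_Re integrable_smooth smooth_divide_const smooth_mult smooth_exp_weight smooth_of_real
            smooth_add A B smooth_const)
      moreover have "Re (of_real (A z + a * B z) * weight a 1 z0 z / exp (1 - a * r\<^sup>2)) =
          (A z + a * B z) * ?E z" for z
        unfolding ex[symmetric] by (simp flip: of_real_exp of_real_add of_real_mult of_real_divide)
      ultimately show ?thesis by simp
    qed
    have bound: "(A z + a * B z) * ?E z \<le>
        (M - c * a) * exp (- a * \<eta>) * indicat_real S z + M * (1 + a) * exp (- 2 * a * \<eta>)" if z: "z \<in> D" for z
    proof (cases "dist z p < \<epsilon>")
      case True
      have "A z + a * B z \<le> M - c * a"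
        using M(2)[OF z] mult_left_mono[OF Bneg[OF True], of a] apos by (simp add: mult.commute)
      then have 1: "(A z + a * B z) * ?E z \<le> (M - c * a) * ?E z" by (intro mult_right_mono) auto
      have pos: "0 \<le> M * (1 + a) * exp (- 2 * a * \<eta>)" using M apos by simp
      show ?thesis
      proof (cases "z \<in> S")
        case True
        then have "norm (z - p) \<le> s" by (simp add: S_def dist_norm norm_minus_commute)
        then have "norm (z - z0) \<le> r + s" using norm_triangle_ineq[of "z - p" "p - z0"] r(2) by simp
        then have "(norm (z - z0))\<^sup>2 \<le> (r + s)\<^sup>2" by (intro power_mono) auto
        then have "(norm (z - z0))\<^sup>2 - r\<^sup>2 \<le> \<eta>" using s2 by simp
        then have "exp (- a * \<eta>) \<le> ?E z" using apos by simp
        then have "(M - c * a) * ?E z \<le> (M - c * a) * exp (- a * \<eta>)"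
          using ca by (intro mult_left_mono_neg) auto
        moreover have "indicat_real S z = 1" using True by simp
        ultimately show ?thesis using 1 pos by (simp only:)
      next
        \<comment> \<open>Near p but outside S the integrand is at most 0 because M - c a is, so
          this region is simply discarded from the upper bound.\<close>
        case False
        have "(M - c * a) * ?E z \<le> 0" using ca by (intro mult_nonpos_nonneg) auto
        moreover have "indicat_real S z = 0" using False by simp
        ultimately show ?thesis using 1 pos by (simp only:)
      qed
    next
      case False
      then have "z \<notin> S" using s(2) by (auto simp: S_def dist_commute)
      have "\<epsilon>\<^sup>2 \<le> (norm (z - p))\<^sup>2" using False \<epsilon> by (intro power_mono) (auto simp: dist_norm)
      then have "2 * \<eta> \<le> (norm (z - z0))\<^sup>2 - r\<^sup>2" using ext[OF z] by (simp add: \<eta>_def)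
      then have "a * (2 * \<eta>) \<le> a * ((norm (z - z0))\<^sup>2 - r\<^sup>2)" using apos by (intro mult_left_mono) auto
      then have E: "?E z \<le> exp (- 2 * a * \<eta>)" by simp
      have "a * B z \<le> a * M" using M(3)[OF z] apos by (intro mult_left_mono) auto
      then have "A z + a * B z \<le> M * (1 + a)"
        using M(2)[OF z] by (simp add: distrib_left mult.commute)
      then have "(A z + a * B z) * ?E z \<le> M * (1 + a) * ?E z" by (intro mult_right_mono) auto
      also have "\<dots> \<le> M * (1 + a) * exp (- 2 * a * \<eta>)" using E M apos by (intro mult_left_mono) auto
      finally show ?thesis using \<open>z \<notin> S\<close> by simp
    qed
    have SLD: "S \<in> sets LD" using So by (auto simp: S_def sets_restrict_space)
    have fS: "emeasure LD S < \<infinity>" using finite_measure.emeasure_finite[OF finite_measure_LD, of S] by (simp add: less_top)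
    have iind: "integrable LD (\<lambda>z. indicat_real S z)"
      by (rule integrable_real_indicator[OF SLD fS])
    have mS: "(LINT z|LD. indicat_real S z) = V1"
      using SLD unfolding V1_def by (simp add: measure_restrict_space space_restrict_space S_def Int_absorb1 Int_commute)
    have mD: "(LINT z|LD. (k::real)) = k * V" for k
      unfolding V_def by (simp add: measure_restrict_space space_restrict_space)
    have ik: "integrable LD (\<lambda>z. k::real)" for k by (rule finite_measure.integrable_const[OF finite_measure_LD])
    have "0 \<le> (LINT z|LD. (A z + a * B z) * exp (- quadratic_weight a 1 z0 z))" by (rule nonneg[OF apos])
    also have "\<dots> = exp (1 - a * r\<^sup>2) * (LINT z|LD. (A z + a * B z) * ?E z)"
      unfolding ee integral_mult_right_zero[symmetric] by (simp add: mult_ac)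
    finally have "0 \<le> (LINT z|LD. (A z + a * B z) * ?E z)" by (simp add: zero_le_mult_iff)
    also have "\<dots> \<le> (LINT z|LD. (M - c * a) * exp (- a * \<eta>) * indicat_real S z + M * (1 + a) * exp (- 2 * a * \<eta>))"
      by (rule integral_mono[OF int])
        (use bound in \<open>auto intro!: Bochner_Integration.integrable_add integrable_mult_right iind ik simp: space_restrict_space\<close>)
    also have "\<dots> = (M - c * a) * exp (- a * \<eta>) * V1 + M * (1 + a) * exp (- 2 * a * \<eta>) * V"
      by (simp only: Bochner_Integration.integral_add[OF integrable_mult_right[OF iind] ik]
          integral_mult_right_zero mS mD)
    also have "\<dots> = exp (- a * \<eta>) * ((M - c * a) * V1 + M * V * ((1 + a) * exp (- a * \<eta>)))"
    proof -
      have "exp (- 2 * a * \<eta>) = exp (- a * \<eta>) * exp (- a * \<eta>)" by (simp flip: exp_add)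
      then show ?thesis by (simp add: algebra_simps)
    qed
    finally have 2: "0 \<le> (M - c * a) * V1 + M * V * ((1 + a) * exp (- a * \<eta>))"
      by (simp add: zero_le_mult_iff)
    have "(1 + a) * exp (- a * \<eta>) \<le> 1 + 1 / \<eta>"
    proof -
      have "1 + a * \<eta> \<le> exp (a * \<eta>)" by (rule exp_ge_add_one_self)
      then have "(1 + 1 / \<eta>) * (1 + a * \<eta>) \<le> (1 + 1 / \<eta>) * exp (a * \<eta>)" using \<eta> by (intro mult_left_mono) auto
      moreover have "1 + a \<le> (1 + 1 / \<eta>) * (1 + a * \<eta>)" using \<eta> apos by (simp add: field_simps)
      ultimately have "1 + a \<le> (1 + 1 / \<eta>) * exp (a * \<eta>)" by linarith
      then show ?thesis by (simp add: exp_minus field_simps)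
    qed
    then have "M * V * ((1 + a) * exp (- a * \<eta>)) \<le> Kc"
      unfolding Kc_def using M V by (intro mult_left_mono) auto
    then show ?thesis using 2 by linarith
  qed
  \<comment> \<open>Chosen so that the quantity that \<open>key\<close> asserts to be non-negative
    equals -1.\<close>
  define a where "a = M / c + (Kc + 1) / (c * V1)"
  have "a \<ge> M / c" using Kc c V1 by (simp add: a_def)
  moreover have "(M - c * a) * V1 + Kc = - 1" using c V1 by (simp add: a_def field_simps)
  ultimately show False using key[of a] by simp
qed

end

section \<open>Eigenvectors of the Levi form\<close>

lemma independent_extension_matrix:
  fixes B :: "(complex ^ 'n) set" and f :: "complex ^ 'n \<Rightarrow> complex ^ 'n"
  assumes "vec.independent B"
  shows "\<exists>A :: complex ^ 'n ^ 'n. \<forall>x\<in>B. A *v x = f x"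
proof -
  obtain g where g: "Vector_Spaces.linear (*s) (*s) g" "\<forall>x\<in>B. g x = f x"
    using vec.linear_independent_extend[OF assms, of f] by blast
  then show ?thesis using matrix_works[OF g(1)] by (intro exI[of _ "matrix g"]) simp
qed

lemma sum_mset_eq_sum_count:
  fixes M :: "real multiset"
  assumes "finite S" "set_mset M \<subseteq> S"
  shows "(\<Sum>c\<in>S. real (count M c) * c) = sum_mset M"
  using assms(2)
proof (induction M)
  case (add x M)
  have "(\<Sum>c\<in>S. real (count (add_mset x M) c) * c) = (\<Sum>c\<in>S. real (count M c) * c + (if c = x then c else 0))"
    by (rule sum.cong) (auto simp: algebra_simps)
  also have "\<dots> = sum_mset M + x" using add assms(1) by (simp add: sum.distrib)
  finally show ?case by simp
qed simp

lemma hermitian_inner_sum_left: "hermitian_inner (\<Sum>a\<in>A. f a) y = (\<Sum>a\<in>A. hermitian_inner (f a) y)"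
proof -
  have "hermitian_inner (\<Sum>a\<in>A. f a) y = (\<Sum>i\<in>UNIV. \<Sum>a\<in>A. f a $ i * cnj (y $ i))"
    by (simp add: hermitian_inner_def sum_distrib_right)
  also have "\<dots> = (\<Sum>a\<in>A. \<Sum>i\<in>UNIV. f a $ i * cnj (y $ i))" by (rule sum.swap)
  finally show ?thesis by (simp add: hermitian_inner_def)
qed

lemma hermitian_inner_self_eq_0: "hermitian_inner x x = 0 \<Longrightarrow> x = 0"
proof -
  assume 0: "hermitian_inner x x = 0"
  have "hermitian_inner x x = complex_of_real (\<Sum>i\<in>UNIV. (cmod (x $ i))\<^sup>2)"
    by (simp add: hermitian_inner_def complex_norm_square[symmetric])
  then have "(\<Sum>i\<in>UNIV. (cmod (x $ i))\<^sup>2) = 0" using 0 by (metis of_real_eq_0_iff)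
  then show "x = 0" by (simp add: sum_nonneg_eq_0_iff vec_eq_iff)
qed

lemma hermitian_inner_cnj: "cnj (hermitian_inner x y) = hermitian_inner y x"
  by (simp add: hermitian_inner_def mult.commute)

lemma complex_hessian_hermitian:
  assumes "smooth \<rho>"
  shows "cnj (complex_hessian \<rho> p i j) = complex_hessian \<rho> p j i"
proof -
  let ?r = "\<lambda>z. complex_of_real (\<rho> z)"
  have s: "smooth ?r" by (rule smooth_of_real[OF assms])
  have "cnj (complex_hessian \<rho> p i j) = dzbar i (\<lambda>z. cnj (dzbar j ?r z)) p"
    unfolding complex_hessian_def by (rule dzbar_cnj[OF smooth_dzbar[OF s], symmetric])
  also have "(\<lambda>z. cnj (dzbar j ?r z)) = dz j ?r"
    using dzbar_of_real[OF assms] by (simp add: fun_eq_iff)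
  also have "dzbar i (dz j ?r) p = complex_hessian \<rho> p j i"
    unfolding complex_hessian_def by (rule dz_dzbar_commute[OF s, symmetric])
  finally show ?thesis .
qed

lemma levi_form_hermitian:
  assumes "smooth \<rho>"
  shows "cnj (levi_form \<rho> p \<xi> \<eta>) = levi_form \<rho> p \<eta> \<xi>"
proof -
  have "cnj (levi_form \<rho> p \<xi> \<eta>) = (\<Sum>i\<in>UNIV. \<Sum>j\<in>UNIV. complex_hessian \<rho> p j i * \<eta> $ j * cnj (\<xi> $ i))"
    by (simp add: levi_form_def complex_hessian_hermitian[OF assms] mult_ac)
  also have "\<dots> = levi_form \<rho> p \<eta> \<xi>" unfolding levi_form_def by (rule sum.swap)
  finally show ?thesis .
qed

text \<open>Both vectors are tangential, so each may serve as test vector in the eigenvalue equation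
  of the other; Hermitian symmetry and real eigenvalues finish the argument.\<close>

lemma levi_eigenspace_orthogonal:
  assumes \<rho>: "smooth \<rho>" and x: "x \<in> levi_eigenspace \<rho> p c" and y: "y \<in> levi_eigenspace \<rho> p d" and "c \<noteq> d"
  shows "hermitian_inner x y = 0"
proof -
  have "of_real c * hermitian_inner x y = levi_form \<rho> p x y"
    using x y by (simp add: levi_eigenspace_def)
  also have "\<dots> = cnj (levi_form \<rho> p y x)" by (rule levi_form_hermitian[OF \<rho>, symmetric])
  also have "\<dots> = complex_of_real d * hermitian_inner x y"
    using x y by (simp add: levi_eigenspace_def hermitian_inner_cnj)
  finally show ?thesis using \<open>c \<noteq> d\<close> by simp
qed

lemma levi_eigenspace_subspace: "vec.subspace (levi_eigenspace \<rho> p c)"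
  unfolding levi_eigenspace_def holomorphic_tangent_space_def levi_form_def hermitian_inner_def vec.subspace_def
  by (auto simp: distrib_left distrib_right sum.distrib mult.left_commute[of _ "_ :: complex"] mult.assoc
      sum_distrib_left[symmetric])

text \<open>Turns a multiset of eigenvalues into a list of eigenvectors: each eigenspace has room
  for as many independent vectors as the multiplicity asks for, and orthogonality of different
  eigenspaces keeps the union independent.\<close>

lemma independent_eigenvectors:
  fixes \<rho> :: "'n::finite cspace \<Rightarrow> real"
  assumes \<rho>: "smooth \<rho>" and size: "size M = q"
    and count: "\<And>c. count M c \<le> vec.dim (levi_eigenspace \<rho> p c)"
  shows "\<exists>\<xi> \<mu>. (\<forall>l<q. \<xi> l \<in> levi_eigenspace \<rho> p (\<mu> l)) \<and> inj_on \<xi> {..<q} \<and>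
    vec.independent (\<xi> ` {..<q}) \<and> (\<Sum>l<q. \<mu> l) = sum_mset M"
proof -
  let ?E = "levi_eigenspace \<rho> p"
  have "\<exists>B. B \<subseteq> ?E c \<and> vec.independent B \<and> card B = count M c" for c
  proof -
    obtain B where B: "B \<subseteq> ?E c" "vec.independent B" "card B = vec.dim (?E c)"
      using vec.basis_exists by metis
    obtain B' where "B' \<subseteq> B" "card B' = count M c"
      using obtain_subset_with_card_n[of "count M c" B] count[of c] B(3) by metis
    then show ?thesis using B vec.independent_mono by blast
  qed
  then obtain B where B: "\<And>c. B c \<subseteq> ?E c" "\<And>c. vec.independent (B c)" "\<And>c. card (B c) = count M c"
    by metis
  have finB: "finite (B c)" for c by (rule vec.finiteI_independent[OF B(2)])
  have disj: "B c \<inter> B d = {}" if "c \<noteq> d" for c d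
  proof (rule ccontr)
    assume "B c \<inter> B d \<noteq> {}"
    then obtain x where x: "x \<in> B c" "x \<in> B d" by blast
    then have "hermitian_inner x x = 0"
      using levi_eigenspace_orthogonal[OF \<rho> _ _ that] B(1) by blast
    then have "x = 0" by (rule hermitian_inner_self_eq_0)
    then show False using x(1) B(2) vec.dependent_zero by blast
  qed
  define S where "S = set_mset M"
  have finS: "finite S" by (simp add: S_def)
  define U where "U = (\<Union>c\<in>S. B c)"
  have finU: "finite U" using finS finB by (simp add: U_def)
  have sumU: "(\<Sum>b\<in>U. g b) = (\<Sum>c\<in>S. \<Sum>b\<in>B c. g b)" for g :: "'n cspace \<Rightarrow> 'b::comm_monoid_add"
    unfolding U_def by (rule sum.UNION_disjoint) (use finS finB disj in auto)
  have indep: "vec.independent U"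
    unfolding vec.independent_explicit
  proof (intro conjI allI impI ballI)
    show "finite U" by (rule finU)
    fix u b assume 0: "(\<Sum>v\<in>U. u v *s v) = 0" and b: "b \<in> U"
    define X where "X = (\<lambda>c. \<Sum>v\<in>B c. u v *s v)"
    have XE: "X c \<in> ?E c" for c
      unfolding X_def
      by (intro vec.subspace_sum[OF levi_eigenspace_subspace] vec.subspace_scale[OF levi_eigenspace_subspace]
          subsetD[OF B(1)])
    have X0: "(\<Sum>c\<in>S. X c) = 0" using 0 unfolding sumU X_def .
    obtain c where c: "c \<in> S" "b \<in> B c" using b by (auto simp: U_def)
    \<comment> \<open>Pairing the vanishing sum with its own component in one eigenspace isolates
      that component.\<close>
    have "hermitian_inner (\<Sum>d\<in>S. X d) (X c) = hermitian_inner (X c) (X c)"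
      unfolding hermitian_inner_sum_left
      using finS c(1) levi_eigenspace_orthogonal[OF \<rho> XE XE]
      by (subst sum.remove[of _ c]) (auto intro!: sum.neutral)
    then have "hermitian_inner (X c) (X c) = 0" unfolding X0 by (simp add: hermitian_inner_def)
    then have "X c = 0" by (rule hermitian_inner_self_eq_0)
    then show "u b = 0"
      using B(2)[of c] c(2) unfolding X_def vec.independent_explicit by blast
  qed
  have "card U = (\<Sum>c\<in>S. card (B c))"
    unfolding U_def by (rule card_UN_disjoint) (use finS finB disj in auto)
  then have cardU: "card U = q" using size by (simp add: B(3) S_def size_multiset_overloaded_eq)
  obtain \<xi> where \<xi>: "bij_betw \<xi> {..<q} U"
    using ex_bij_betw_nat_finite[OF finU] cardU by (auto simp: atLeast0LessThan)
  \<comment> \<open>The chosen bases are disjoint, so each vector determines its eigenvalue.\<close>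
  define \<mu>' where "\<mu>' = (\<lambda>b. THE c. b \<in> B c)"
  have \<mu>': "\<mu>' b = c" if "b \<in> B c" for b c
    unfolding \<mu>'_def using that disj by (intro the_equality) blast+
  have "(\<Sum>l<q. \<mu>' (\<xi> l)) = (\<Sum>b\<in>U. \<mu>' b)" by (rule sum.reindex_bij_betw[OF \<xi>])
  also have "\<dots> = (\<Sum>c\<in>S. \<Sum>b\<in>B c. c)" unfolding sumU using \<mu>' by (intro sum.cong refl) simp
  also have "\<dots> = sum_mset M" using sum_mset_eq_sum_count[OF finS, of M] by (simp add: B(3) S_def)
  finally have sum: "(\<Sum>l<q. \<mu>' (\<xi> l)) = sum_mset M" .
  have "\<xi> l \<in> ?E (\<mu>' (\<xi> l))" if "l < q" for l
  proof -
    have "\<xi> l \<in> U" using \<xi> that by (auto simp: bij_betw_def)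
    then obtain c where "\<xi> l \<in> B c" by (auto simp: U_def)
    then show ?thesis using \<mu>' B(1) by blast
  qed
  then show ?thesis
    using \<xi> indep sum unfolding bij_betw_def by (intro exI[of _ \<xi>] exI[of _ "\<lambda>l. \<mu>' (\<xi> l)"]) auto
qed

text \<open>On tangential forms the Levi form may be replaced by the linear map that has the chosen vectors
  as honest eigenvectors, and this map acts on their exterior product as a derivation.\<close>

lemma levi_form_wedge:
  fixes \<rho> :: "'n::{finite,linorder} cspace \<Rightarrow> real" and \<xi> :: "nat \<Rightarrow> 'n cspace"
  assumes eig: "\<And>l. l < Suc q \<Longrightarrow> \<xi> l \<in> levi_eigenspace \<rho> p (\<mu> l)"
    and inj: "inj_on \<xi> {..<Suc q}" and indep: "vec.independent (\<xi> ` {..<Suc q})"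
  defines "W \<equiv> wedge (Suc q) (\<lambda>l i. \<xi> l $ i)"
  shows "(\<Sum>K\<in>multi_indices q. \<Sum>j\<in>UNIV. \<Sum>i\<in>UNIV. complex_hessian \<rho> p i j * W (i # K) * cnj (W (j # K))) =
      of_real ((\<Sum>l<Suc q. \<mu> l) * form_normsq (Suc q) W)"
proof -
  let ?M = "multi_indices q :: 'n list set"
  let ?H = "complex_hessian \<rho> p"
  have cov: "W \<in> covectors (Suc q)" unfolding W_def by (rule wedge_covector)
  obtain A where A: "\<And>x. x \<in> \<xi> ` {..<Suc q} \<Longrightarrow>
      A *v x = complex_of_real (\<mu> (inv_into {..<Suc q} \<xi> x)) *s x"
    using independent_extension_matrix[OF indep, of "\<lambda>x. of_real (\<mu> (inv_into {..<Suc q} \<xi> x)) *s x"] by blast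
  \<comment> \<open>Transposed because \<open>levi_op\<close> sums over the first index of its
    matrix.\<close>
  define H' where "H' = (\<lambda>i j. A $ j $ i)"
  have H': "(\<Sum>i\<in>UNIV. H' i j * \<xi> l $ i) = complex_of_real (\<mu> l) * \<xi> l $ j" if "l < Suc q" for l j
  proof -
    have "A *v \<xi> l = complex_of_real (\<mu> l) *s \<xi> l"
      using A[of "\<xi> l"] that inv_into_f_f[OF inj, of l] by simp
    then have "(A *v \<xi> l) $ j = complex_of_real (\<mu> l) * \<xi> l $ j" by simp
    then show ?thesis by (simp add: matrix_vector_mult_def H'_def)
  qed
  have tang: "(\<Sum>i\<in>UNIV. dz i (\<lambda>z. of_real (\<rho> z)) p * \<xi> l $ i) = 0" if "l < Suc q" for l
    using eig[OF that] by (simp add: levi_eigenspace_def holomorphic_tangent_space_def)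
  have per: "\<sigma> 0 < Suc q" if "\<sigma> permutes {..<Suc q}" for \<sigma>
    using permutes_in_image[OF that, of 0] by simp
  have slice: "(\<Sum>j\<in>UNIV. \<Sum>i\<in>UNIV. ?H i j * W (i # K) * cnj (W (j # K))) =
      (\<Sum>j\<in>UNIV. \<Sum>i\<in>UNIV. H' i j * W (i # K) * cnj (W (j # K)))" if K: "length K = q" for K
  proof -
    \<comment> \<open>A slice of W in its first index. It is tangential because every factor of W
      is, and the eigenvalue equation for the Levi form may be used only against tangential
      vectors.\<close>
    define \<eta> :: "'n cspace" where "\<eta> = (\<chi> j. W (j # K))"
    have contr: "(\<Sum>j\<in>UNIV. \<Sum>i\<in>UNIV. X i j * W (i # K) * cnj (W (j # K))) =
      (\<Sum>\<sigma> | \<sigma> permutes {..<Suc q}. of_int (sign \<sigma>) * (\<Sum>i\<in>UNIV. (\<Sum>j\<in>UNIV. X i j * cnj (\<eta> $ j)) * \<xi> (\<sigma> 0) $ i) *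
        (\<Prod>l<q. \<xi> (\<sigma> (Suc l)) $ (K ! l)))" for X
    proof -
      have "(\<Sum>j\<in>UNIV. \<Sum>i\<in>UNIV. X i j * W (i # K) * cnj (W (j # K))) =
          (\<Sum>i\<in>UNIV. \<Sum>j\<in>UNIV. X i j * W (i # K) * cnj (W (j # K)))" by (rule sum.swap)
      also have "\<dots> = (\<Sum>i\<in>UNIV. (\<Sum>j\<in>UNIV. X i j * cnj (\<eta> $ j)) * W (i # K))"
        unfolding sum_distrib_right \<eta>_def vec_lambda_beta by (intro sum.cong refl) (simp only: mult_ac)
      finally show ?thesis unfolding W_def wedge_contraction[OF K] .
    qed
    have "(\<Sum>i\<in>UNIV. dz i (\<lambda>z. of_real (\<rho> z)) p * W (i # K)) = 0"
      unfolding W_def wedge_contraction[OF K] by (intro sum.neutral) (simp add: tang per)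
    then have \<eta>: "\<eta> \<in> holomorphic_tangent_space \<rho> p"
      by (simp add: holomorphic_tangent_space_def \<eta>_def)
    have "(\<Sum>i\<in>UNIV. (\<Sum>j\<in>UNIV. ?H i j * cnj (\<eta> $ j)) * \<xi> l $ i) =
        (\<Sum>i\<in>UNIV. (\<Sum>j\<in>UNIV. H' i j * cnj (\<eta> $ j)) * \<xi> l $ i)" if l: "l < Suc q" for l
    proof -
      have "(\<Sum>i\<in>UNIV. (\<Sum>j\<in>UNIV. ?H i j * cnj (\<eta> $ j)) * \<xi> l $ i) = levi_form \<rho> p (\<xi> l) \<eta>"
        unfolding levi_form_def sum_distrib_right by (intro sum.cong refl) (simp only: mult_ac)
      also have "\<dots> = complex_of_real (\<mu> l) * hermitian_inner (\<xi> l) \<eta>"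
        using eig[OF l] \<eta> by (simp add: levi_eigenspace_def)
      also have "\<dots> = (\<Sum>j\<in>UNIV. (of_real (\<mu> l) * \<xi> l $ j) * cnj (\<eta> $ j))"
        unfolding hermitian_inner_def sum_distrib_left by (intro sum.cong refl) (simp only: mult_ac)
      also have "\<dots> = (\<Sum>j\<in>UNIV. \<Sum>i\<in>UNIV. H' i j * \<xi> l $ i * cnj (\<eta> $ j))"
        unfolding H'[OF l, symmetric] by (simp add: sum_distrib_right)
      also have "\<dots> = (\<Sum>i\<in>UNIV. \<Sum>j\<in>UNIV. H' i j * \<xi> l $ i * cnj (\<eta> $ j))" by (rule sum.swap)
      also have "\<dots> = (\<Sum>i\<in>UNIV. (\<Sum>j\<in>UNIV. H' i j * cnj (\<eta> $ j)) * \<xi> l $ i)"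
        unfolding sum_distrib_right by (intro sum.cong refl) (simp only: mult_ac)
      finally show ?thesis .
    qed
    then show ?thesis unfolding contr by (intro sum.cong refl) (simp add: per)
  qed
  have "(\<Sum>K\<in>?M. \<Sum>j\<in>UNIV. \<Sum>i\<in>UNIV. ?H i j * W (i # K) * cnj (W (j # K))) =
      (\<Sum>K\<in>?M. \<Sum>j\<in>UNIV. \<Sum>i\<in>UNIV. H' i j * W (i # K) * cnj (W (j # K)))"
    by (intro sum.cong refl slice) (simp add: multi_indices_def)
  also have "\<dots> = (\<Sum>j\<in>UNIV. \<Sum>K\<in>?M. \<Sum>i\<in>UNIV. H' i j * W (i # K) * cnj (W (j # K)))"
    by (rule sum.swap)
  also have "\<dots> = (\<Sum>j\<in>UNIV. \<Sum>i\<in>UNIV. \<Sum>K\<in>?M. H' i j * W (i # K) * cnj (W (j # K)))"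
    by (intro sum.cong refl sum.swap)
  also have "\<dots> = (\<Sum>i\<in>UNIV. \<Sum>j\<in>UNIV. \<Sum>K\<in>?M. H' i j * W (i # K) * cnj (W (j # K)))"
    by (rule sum.swap)
  also have "\<dots> = form_inner (Suc q) (levi_op H' W) W" by (rule levi_op_inner[OF cov cov, symmetric])
  also have "levi_op H' W = (\<lambda>J. of_real (\<Sum>l<Suc q. \<mu> l) * W J)"
    unfolding W_def using levi_op_wedge[of "Suc q" H' "\<lambda>l i. \<xi> l $ i" "\<lambda>l. complex_of_real (\<mu> l)"] H'
    by (simp add: fun_eq_iff)
  also have "form_inner (Suc q) (\<lambda>J. of_real (\<Sum>l<Suc q. \<mu> l) * W J) W =
      of_real (\<Sum>l<Suc q. \<mu> l) * form_inner (Suc q) W W"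
    unfolding form_inner_def by (simp only: sum_distrib_left mult.assoc)
  finally show ?thesis unfolding form_inner_self by (simp only: of_real_mult)
qed

text \<open>Independence yields matrices that send one \<open>\<xi> l\<close> to a fixed unit vector
  and the others to 0; one row of each serves as a dual functional for \<open>wedge_nonzero\<close>.
  The coordinate \<open>i0\<close> is arbitrary.\<close>

lemma form_normsq_wedge_pos:
  fixes \<xi> :: "nat \<Rightarrow> 'n::{finite,linorder} cspace"
  assumes inj: "inj_on \<xi> {..<q}" and indep: "vec.independent (\<xi> ` {..<q})"
  shows "form_normsq q (wedge q (\<lambda>l i. \<xi> l $ i)) > 0"
proof -
  let ?W = "wedge q (\<lambda>l i. \<xi> l $ i)"
  obtain i0 :: 'n where True by simp
  have "\<exists>A. \<forall>x\<in>\<xi> ` {..<q}. A *v x = (if x = \<xi> l then axis i0 1 else 0)" for l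
    by (rule independent_extension_matrix[OF indep])
  then obtain A
    where A: "\<And>l x. x \<in> \<xi> ` {..<q} \<Longrightarrow> A l *v x = (if x = \<xi> l then axis i0 1 else 0)" by metis
  have "(\<Sum>i\<in>UNIV. \<xi> k $ i * A l $ i0 $ i) = (if k = l then 1 else 0)" if "k < q" "l < q" for k l
  proof -
    have "(\<Sum>i\<in>UNIV. \<xi> k $ i * A l $ i0 $ i) = (A l *v \<xi> k) $ i0"
      by (simp add: matrix_vector_mult_def mult.commute)
    also have "\<dots> = (if k = l then 1 else 0)"
      using that inj_onD[OF inj, of k l] by (subst A) (auto simp: axis_def)
    finally show ?thesis .
  qed
  then obtain I where I: "?W I \<noteq> 0" using wedge_nonzero[of q "\<lambda>l i. \<xi> l $ i" "\<lambda>l i. A l $ i0 $ i"] by blast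
  then obtain J where J: "J \<in> multi_indices q" "?W J \<noteq> 0"
    using covectors_eq_0[OF wedge_covector] by blast
  have "(cmod (?W J))\<^sup>2 \<le> form_normsq q ?W"
    unfolding form_normsq_eq by (rule member_le_sum[OF J(1)]) auto
  moreover have "(cmod (?W J))\<^sup>2 > 0" using J(2) by simp
  ultimately show ?thesis by linarith
qed

section \<open>The test form\<close>

context defined_domain
begin

definition contracted :: "'n cspace \<Rightarrow> 'n cspace \<Rightarrow> complex" where
  "contracted \<xi> z = (\<Sum>m\<in>UNIV. rho_z m z * \<xi> $ m)"

text \<open>The factor 4 normalizes, because the squares of the Wirtinger derivatives of \<open>\<rho>\<close> add up to 1/4
  on the boundary.\<close>

definition potential :: "'n cspace \<Rightarrow> 'n cspace \<Rightarrow> complex" where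
  "potential \<xi> z = (\<Sum>m\<in>UNIV. cnj (z $ m) * \<xi> $ m) - 4 * (of_real (\<rho> z) * contracted \<xi> z)"

text \<open>Vanishes on the boundary, where the gradient has norm 1, but in general not inside D; it
  measures how far the correction in \<open>potential\<close> fails to cancel the normal
  component.\<close>

definition defect :: "'n cspace \<Rightarrow> complex" where
  "defect z = 1 - 4 * (\<Sum>i\<in>UNIV. rho_z i z * cnj (rho_z i z))"

text \<open>A product of exact forms, so closedness comes for free whatever the vectors
  \<open>\<xi> l\<close> are.\<close>

definition test_form :: "nat \<Rightarrow> (nat \<Rightarrow> 'n cspace) \<Rightarrow> 'n form" where
  "test_form q \<xi> z = wedge q (\<lambda>l i. dzbar i (potential (\<xi> l)) z)"

lemma smooth_contracted: "smooth (contracted \<xi>)"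
  unfolding contracted_def[abs_def] by (intro smooth_sum smooth_mult smooth_rho_z smooth_const)

lemma smooth_potential: "smooth (potential \<xi>)"
  unfolding potential_def[abs_def]
  by (intro smooth_diff smooth_sum smooth_mult smooth_cnj smooth_vec_nth smooth_const smooth_of_real
      smooth_rho smooth_contracted)

lemma smooth_defect: "smooth defect"
  unfolding defect_def[abs_def]
  by (intro smooth_diff smooth_const smooth_mult smooth_sum smooth_rho_z smooth_cnj)

lemma smooth_test_form: "smooth (\<lambda>z. test_form q \<xi> z I)"
  unfolding test_form_def by (intro smooth_wedge smooth_dzbar smooth_potential)

lemma test_form_covector: "test_form q \<xi> z \<in> covectors q"
  unfolding test_form_def by (rule wedge_covector)

lemma defect_frontier: "p \<in> frontier D \<Longrightarrow> defect p = 0"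
  unfolding defect_def sum_rho_z_sq by (simp add: norm_grad)

lemma dzbar_potential:
  "dzbar i (potential \<xi>) z = \<xi> $ i - 4 * (cnj (rho_z i z) * contracted \<xi> z + of_real (\<rho> z) * dzbar i (contracted \<xi>) z)"
proof -
  let ?l = "\<lambda>z. \<Sum>m\<in>UNIV. cnj (z $ m) * \<xi> $ m"
  have sl: "smooth (\<lambda>z. cnj (z $ m) * \<xi> $ m)" for m
    by (intro smooth_mult smooth_cnj smooth_vec_nth smooth_const)
  have sr: "smooth (\<lambda>z. complex_of_real (\<rho> z))" by (intro smooth_of_real smooth_rho)
  have "potential \<xi> = (\<lambda>z. ?l z + (- 4) * (of_real (\<rho> z) * contracted \<xi> z))"
    by (simp add: potential_def fun_eq_iff)
  then have "dzbar i (potential \<xi>) z = dzbar i ?l z + dzbar i (\<lambda>z. (- 4) * (of_real (\<rho> z) * contracted \<xi> z)) z"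
    by (simp only:, intro dzbar_add smooth_sum sl smooth_mult smooth_const sr smooth_contracted)
  moreover have "dzbar i ?l z = (\<Sum>m\<in>UNIV. (if i = m then 1 else 0) * \<xi> $ m)"
    unfolding dzbar_sum[of UNIV "\<lambda>m z. cnj (z $ m) * \<xi> $ m", OF sl]
    by (intro sum.cong refl) (simp add: dzbar_mult smooth_cnj smooth_vec_nth smooth_const dzbar_cnj dz_vec_nth)
  moreover have "(\<Sum>m\<in>UNIV. (if i = m then 1 else 0) * \<xi> $ m) = \<xi> $ i"
    by (simp add: if_distrib[of "\<lambda>x. x * _"] cong: if_cong)
  moreover have "dzbar i (\<lambda>z. (- 4) * (of_real (\<rho> z) * contracted \<xi> z)) z =
      - 4 * (cnj (rho_z i z) * contracted \<xi> z + of_real (\<rho> z) * dzbar i (contracted \<xi>) z)"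
    by (simp only: dzbar_cmult[OF smooth_mult[OF sr smooth_contracted]] dzbar_mult[OF sr smooth_contracted]
        dzbar_of_real[OF smooth_rho])
  ultimately show ?thesis by simp
qed

text \<open>The part of the contracted derivative of \<open>potential\<close> that carries an
  explicit factor \<open>\<rho>\<close>.\<close>

definition rest :: "'n cspace \<Rightarrow> 'n cspace \<Rightarrow> complex" where
  "rest \<xi> z = - 4 * (\<Sum>i\<in>UNIV. rho_z i z * dzbar i (contracted \<xi>) z)"

lemma smooth_rest: "smooth (rest \<xi>)"
  unfolding rest_def[abs_def]
  by (intro smooth_mult smooth_const smooth_sum smooth_rho_z smooth_dzbar smooth_contracted)

lemma sum_rho_z_potential:
  "(\<Sum>i\<in>UNIV. rho_z i z * dzbar i (potential \<xi>) z) = contracted \<xi> z * defect z + of_real (\<rho> z) * rest \<xi> z"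
proof -
  have "(\<Sum>i\<in>UNIV. rho_z i z * dzbar i (potential \<xi>) z) =
      (\<Sum>i\<in>UNIV. rho_z i z * \<xi> $ i - 4 * (contracted \<xi> z * (rho_z i z * cnj (rho_z i z)))
        - 4 * (of_real (\<rho> z) * (rho_z i z * dzbar i (contracted \<xi>) z)))"
    by (intro sum.cong refl) (simp add: dzbar_potential algebra_simps)
  also have "\<dots> = contracted \<xi> z - 4 * (contracted \<xi> z * (\<Sum>i\<in>UNIV. rho_z i z * cnj (rho_z i z)))
      - 4 * (of_real (\<rho> z) * (\<Sum>i\<in>UNIV. rho_z i z * dzbar i (contracted \<xi>) z))"
    by (simp only: sum_subtractf sum_distrib_left contracted_def)
  finally show ?thesis by (simp add: defect_def rest_def algebra_simps)
qed

lemma test_form_contraction: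
  assumes "length K = q"
  shows "(contraction (test_form (Suc q) \<xi>) K z) =
    (\<Sum>\<sigma> | \<sigma> permutes {..<Suc q}. of_int (sign \<sigma>) *
      (contracted (\<xi> (\<sigma> 0)) z * defect z + of_real (\<rho> z) * rest (\<xi> (\<sigma> 0)) z) *
      (\<Prod>l<q. dzbar (K ! l) (potential (\<xi> (\<sigma> (Suc l)))) z))"
  unfolding test_form_def wedge_contraction[OF assms] sum_rho_z_potential ..

text \<open>Both terms in the contraction vanish on the entire boundary, one through
  \<open>defect\<close> and one through \<open>\<rho>\<close>, although the vectors
  \<open>\<xi> l\<close> will be tangential only at p.\<close>

lemma test_form_boundary_condition:
  assumes K: "length K = q"
  shows "\<exists>C. \<forall>z\<in>D. cmod (contraction (test_form (Suc q) \<xi>) K z) \<le> C * \<bar>\<rho> z\<bar>"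
proof -
  have "smooth (contraction (test_form (Suc q) \<xi>) K)"
    by (intro smooth_sum smooth_mult smooth_rho_z smooth_test_form)
  moreover have "(contraction (test_form (Suc q) \<xi>) K z) = 0" if "z \<in> frontier D" for z
    unfolding test_form_contraction[OF K] by (simp add: defect_frontier[OF that] frontier_rho[OF that])
  ultimately show ?thesis using vanishing_on_frontier_bound by blast
qed

lemma test_form_closed: "dbar_closed D q (test_form q \<xi>)"
proof -
  have "dbar_eq D q (test_form q \<xi>)
      (\<lambda>z J. \<Sum>k<Suc q. (-1) ^ k * dzbar (J ! k) (\<lambda>z. test_form q \<xi> z (delete_nth k J)) z)"
    by (rule dbar_eq_smooth[OF smooth_test_form])
  moreover have "(\<Sum>k<Suc q. (-1) ^ k * dzbar (J ! k) (\<lambda>z. test_form q \<xi> z (delete_nth k J)) z) = 0"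
    if "J \<in> multi_indices (Suc q)" for J z
    unfolding test_form_def
    by (rule wedge_dzbar_closed[OF smooth_potential]) (use that in \<open>simp add: multi_indices_def\<close>)
  ultimately show ?thesis unfolding dbar_closed_def dbar_eq_def by simp
qed

lemma test_form_smooth_forms: "test_form q \<xi> \<in> smooth_forms D q"
  unfolding smooth_forms_def using test_form_covector smooth_test_form by blast

lemma test_form_at_frontier:
  assumes p: "p \<in> frontier D" and tang: "\<And>l. l < q \<Longrightarrow> contracted (\<xi> l) p = 0"
  shows "test_form q \<xi> p = wedge q (\<lambda>l i. \<xi> l $ i)"
  unfolding test_form_def
  by (rule wedge_cong) (simp add: dzbar_potential tang frontier_rho[OF p])

text \<open>At p both factors of the product \<open>contracted \<xi> * defect\<close> vanish, so only the derivative of \<open>\<rho>\<close>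
  survives; it is killed by the tangential components of the form.\<close>

lemma dzbar_test_form_contraction:
  assumes p: "p \<in> frontier D" and tang: "\<And>l. l < Suc q \<Longrightarrow> contracted (\<xi> l) p = 0" and K: "length K = q"
  shows "\<exists>Y. \<forall>j. dzbar j (contraction (test_form (Suc q) \<xi>) K) p = cnj (rho_z j p) * Y"
proof -
  let ?P = "{\<sigma>. \<sigma> permutes {..<Suc q}}"
  define T where "T = (\<lambda>\<sigma>::nat \<Rightarrow> nat. \<lambda>z. contracted (\<xi> (\<sigma> 0)) z * defect z + of_real (\<rho> z) * rest (\<xi> (\<sigma> 0)) z)"
  define R where "R = (\<lambda>\<sigma> z. \<Prod>l<q. dzbar (K ! l) (potential (\<xi> (\<sigma> (Suc l)))) z)"
  have sr: "smooth (\<lambda>z. complex_of_real (\<rho> z))" by (intro smooth_of_real smooth_rho)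
  have sT: "smooth (T \<sigma>)" for \<sigma>
    unfolding T_def by (intro smooth_add smooth_mult smooth_contracted smooth_defect sr smooth_rest)
  have sR: "smooth (R \<sigma>)" for \<sigma>
    unfolding R_def by (intro smooth_prod smooth_dzbar smooth_potential)
  have T0: "T \<sigma> p = 0" for \<sigma> by (simp add: T_def defect_frontier[OF p] frontier_rho[OF p])
  have dT: "dzbar j (T \<sigma>) p = cnj (rho_z j p) * rest (\<xi> (\<sigma> 0)) p" if "\<sigma> \<in> ?P" for j \<sigma>
  proof -
    have "\<sigma> 0 < Suc q" using that permutes_in_image[of \<sigma> "{..<Suc q}" 0] by simp
    then have c: "contracted (\<xi> (\<sigma> 0)) p = 0" by (rule tang)
    have "dzbar j (T \<sigma>) p = dzbar j (\<lambda>z. contracted (\<xi> (\<sigma> 0)) z * defect z) p +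
        dzbar j (\<lambda>z. of_real (\<rho> z) * rest (\<xi> (\<sigma> 0)) z) p"
      unfolding T_def by (intro dzbar_add smooth_mult smooth_contracted smooth_defect sr smooth_rest)
    then show ?thesis
      by (simp add: dzbar_mult[OF smooth_contracted smooth_defect] dzbar_mult[OF sr smooth_rest] c
          defect_frontier[OF p] frontier_rho[OF p] dzbar_of_real[OF smooth_rho])
  qed
  have eq: "(contraction (test_form (Suc q) \<xi>) K) = (\<lambda>z. \<Sum>\<sigma>\<in>?P. of_int (sign \<sigma>) * (T \<sigma> z * R \<sigma> z))"
    unfolding test_form_contraction[OF K] T_def R_def by (simp only: mult.assoc)
  have d: "dzbar j (contraction (test_form (Suc q) \<xi>) K) p =
      (\<Sum>\<sigma>\<in>?P. dzbar j (\<lambda>z. of_int (sign \<sigma>) * (T \<sigma> z * R \<sigma> z)) p)" for j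
    unfolding eq by (intro dzbar_sum smooth_mult smooth_const sT sR)
  have e: "dzbar j (\<lambda>z. of_int (sign \<sigma>) * (T \<sigma> z * R \<sigma> z)) p =
      cnj (rho_z j p) * (of_int (sign \<sigma>) * (rest (\<xi> (\<sigma> 0)) p * R \<sigma> p))" if "\<sigma> \<in> ?P" for j \<sigma>
    unfolding dzbar_cmult[OF smooth_mult[OF sT sR]] dzbar_mult[OF sT sR] dT[OF that] T0 by simp
  have "dzbar j (contraction (test_form (Suc q) \<xi>) K) p =
      cnj (rho_z j p) * (\<Sum>\<sigma>\<in>?P. of_int (sign \<sigma>) * (rest (\<xi> (\<sigma> 0)) p * R \<sigma> p))" for j
    unfolding d sum_distrib_left by (intro sum.cong refl e)
  then show ?thesis by blast
qed

text \<open>By the product rule, applying \<open>dzbar j\<close> to the contraction trades the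
  derivatives of F for minus the complex Hessian of \<open>\<rho>\<close>, up to a multiple of the
  conjugate of \<open>rho_z j\<close>. Pairing with the conjugate of F_jK and summing over j removes
  this multiple by the boundary condition at p.\<close>

lemma boundary_density_at_frontier:
  assumes p: "p \<in> frontier D" and tang: "\<And>l. l < Suc q \<Longrightarrow> contracted (\<xi> l) p = 0"
  defines "F \<equiv> test_form (Suc q) \<xi>"
  shows "boundary_density (p + r *\<^sub>R grad p) q F p =
    of_real (2 * r) * (\<Sum>K\<in>multi_indices q. \<Sum>j\<in>UNIV. \<Sum>i\<in>UNIV.
      complex_hessian \<rho> p i j * F p (i # K) * cnj (F p (j # K)))"
proof -
  let ?d = "\<lambda>K. \<Sum>j\<in>UNIV. \<Sum>i\<in>UNIV. rho_z i p * dzbar j (\<lambda>z. F z (i # K)) p * cnj (F p (j # K))"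
  let ?h = "\<lambda>K. \<Sum>j\<in>UNIV. \<Sum>i\<in>UNIV. complex_hessian \<rho> p i j * F p (i # K) * cnj (F p (j # K))"
  have sF: "smooth (\<lambda>z. F z I)" for I unfolding F_def by (rule smooth_test_form)
  have slice: "(?d K) =
      - (?h K)"
    if K: "length K = q" for K
  proof -
    obtain Y where Y: "\<And>j. dzbar j (contraction F K) p = cnj (rho_z j p) * Y"
      using dzbar_test_form_contraction[of p q \<xi> K, OF p tang K] unfolding F_def by blast
    have "dzbar j (contraction F K) p =
        (\<Sum>i\<in>UNIV. dzbar j (\<lambda>z. rho_z i z * F z (i # K)) p)" for j
      by (intro dzbar_sum smooth_mult smooth_rho_z sF)
    then have Y': "(\<Sum>i\<in>UNIV. dzbar j (rho_z i) p * F p (i # K) + rho_z i p * dzbar j (\<lambda>z. F z (i # K)) p) =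
        cnj (rho_z j p) * Y" for j
      unfolding Y by (simp only: dzbar_mult[OF smooth_rho_z sF])
    have H: "dzbar j (rho_z i) p = complex_hessian \<rho> p i j" for i j
      unfolding complex_hessian_def
      by (rule dz_dzbar_commute[symmetric]) (intro smooth_of_real smooth_rho)
    have "(\<Sum>i\<in>UNIV. rho_z i p * F p (i # K)) = 0"
      unfolding F_def test_form_contraction[OF K] by (simp add: defect_frontier[OF p] frontier_rho[OF p])
    then have "cnj (\<Sum>i\<in>UNIV. rho_z i p * F p (i # K)) = 0" by simp
    then have zero: "(\<Sum>j\<in>UNIV. cnj (rho_z j p) * cnj (F p (j # K))) = 0" by simp
    have "(\<Sum>j\<in>UNIV. (\<Sum>i\<in>UNIV. complex_hessian \<rho> p i j * F p (i # K) + rho_z i p * dzbar j (\<lambda>z. F z (i # K)) p) * cnj (F p (j # K))) =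
        Y * (\<Sum>j\<in>UNIV. cnj (rho_z j p) * cnj (F p (j # K)))"
      unfolding H[symmetric] Y' by (simp add: sum_distrib_left mult_ac)
    then have "(?h K) +
        (?d K) = 0"
      unfolding zero by (simp add: sum_distrib_right distrib_right sum.distrib)
    then show ?thesis by (simp add: eq_neg_iff_add_eq_0 add.commute)
  qed
  \<comment> \<open>Here p - z0 = -r \<open>grad p\<close>, and \<open>rho_z\<close> is half the
    conjugate gradient. The minus sign of the outward centre cancels the one from
    \<open>slice\<close>.\<close>
  have g: "cnj (p $ i - (p + r *\<^sub>R grad p) $ i) = - of_real (2 * r) * rho_z i p" for i
    by (simp add: rho_z scaleR_conv_of_real[where 'a = complex])
  have "boundary_density (p + r *\<^sub>R grad p) q F p = - of_real (2 * r) *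
      (\<Sum>K\<in>multi_indices q. \<Sum>j\<in>UNIV. \<Sum>i\<in>UNIV. rho_z i p * dzbar j (\<lambda>z. F z (i # K)) p * cnj (F p (j # K)))"
    unfolding boundary_density_def g by (simp only: sum_distrib_left mult.assoc)
  also have "(\<Sum>K\<in>multi_indices q. \<Sum>j\<in>UNIV. \<Sum>i\<in>UNIV. rho_z i p * dzbar j (\<lambda>z. F z (i # K)) p * cnj (F p (j # K))) =
      (\<Sum>K\<in>multi_indices q. - (?h K))"
    by (intro sum.cong refl slice) (simp add: multi_indices_def)
  finally show ?thesis by (simp add: sum_negf)
qed

end

theorem theorem1p2:
  fixes D :: "'n::{finite,linorder} cspace set"
    and \<rho> :: "'n cspace \<Rightarrow> real"
    and q :: nat
  assumes "open D" "connected D" "D \<noteq> {}" "bounded D"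
    and "normalized_defining_function \<rho> D"
    and "1 \<le> q" "q \<le> CARD('n) - 1"
    and "\<And>a b z\<^sub>0 \<phi> f. a > 0 \<Longrightarrow> b > 0 \<Longrightarrow> \<phi> = quadratic_weight a b z\<^sub>0 \<Longrightarrow>
      f \<in> smooth_forms D q \<Longrightarrow> f \<in> dbar_adjoint_dom D \<phi> (q - 1) \<Longrightarrow> dbar_closed D q f \<Longrightarrow>
      \<exists>u \<in> L2_forms D \<phi> (q - 1). dbar_eq D (q - 1) u f \<and>
        (LINT z|lebesgue_on D. form_normsq (q - 1) (u z) * exp (- \<phi> z))
          \<le> (LINT z|lebesgue_on D. Re (form_inner q (Levi_inv \<phi> q f z) (f z)) * exp (- \<phi> z)) \<and>
        (LINT z|lebesgue_on D. Re (form_inner q (Levi_inv \<phi> q f z) (f z)) * exp (- \<phi> z))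
          = 1 / (a * real q) * (LINT z|lebesgue_on D. form_normsq q (f z) * exp (- \<phi> z))"
  shows "hyper_convex q \<rho> D"
  unfolding hyper_convex_def
proof (intro ballI allI impI, elim conjE)
  interpret defined_domain D \<rho> by unfold_locales (fact assms)+
  obtain q' where q: "q = Suc q'" using assms(6) by (cases q) auto
  fix p M assume p: "p \<in> frontier D" and size: "size M = q"
    and count: "\<forall>c. count M c \<le> vec.dim (levi_eigenspace \<rho> p c)"
  obtain \<xi> \<mu> where \<xi>: "\<And>l. l < Suc q' \<Longrightarrow> \<xi> l \<in> levi_eigenspace \<rho> p (\<mu> l)" "inj_on \<xi> {..<Suc q'}"
    "vec.independent (\<xi> ` {..<Suc q'})" and \<mu>: "(\<Sum>l<Suc q'. \<mu> l) = sum_mset M"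
    using independent_eigenvectors[OF smooth_rho size, of p] count unfolding q by blast
  have tang: "contracted (\<xi> l) p = 0" if "l < Suc q'" for l
    using \<xi>(1)[OF that] by (simp add: contracted_def levi_eigenspace_def holomorphic_tangent_space_def)
  define F where "F = test_form (Suc q') \<xi>"
  define W where "W = wedge (Suc q') (\<lambda>l i. \<xi> l $ i)"
  have Fp: "F p = W" unfolding F_def W_def by (rule test_form_at_frontier[of p "Suc q'" \<xi>, OF p tang])
  obtain r where r: "r > 0"
      "\<And>z. z \<in> D \<Longrightarrow> (norm (z - (p + r *\<^sub>R grad p)))\<^sup>2 \<ge> r\<^sup>2 + (norm (z - p))\<^sup>2 / 2"
    using exterior_ball[OF p] by blast
  define z0 where "z0 = p + r *\<^sub>R grad p"
  have cov: "F z \<in> covectors (Suc q')" for z unfolding F_def by (rule test_form_covector)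
  have sm: "smooth (\<lambda>z. F z I)" for I unfolding F_def by (rule smooth_test_form)
  have bd: "\<exists>C. \<forall>z\<in>D. cmod (contraction F K z) \<le> C * \<bar>\<rho> z\<bar>" if "length K = q'" for K
    unfolding F_def by (rule test_form_boundary_condition[OF that])
  have ineq: "0 \<le> (LINT z|LD. (Re (curvature_rest q' F z) + a * Re (boundary_density z0 q' F z)) *
      exp (- quadratic_weight a 1 z0 z))" if a: "a > 0" for a
  proof -
    let ?\<phi> = "quadratic_weight a 1 z0"
    have sf: "F \<in> smooth_forms D q" unfolding F_def q by (rule test_form_smooth_forms)
    have ad: "F \<in> dbar_adjoint_dom D ?\<phi> (q - 1)"
      unfolding q diff_Suc_1 by (rule smooth_in_adjoint_dom[OF cov sm bd])
    have cl: "dbar_closed D q F" unfolding F_def q by (rule test_form_closed)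
    obtain u where u: "u \<in> L2_forms D ?\<phi> (q - 1)" "dbar_eq D (q - 1) u F"
      and le: "(LINT z|LD. form_normsq (q - 1) (u z) * exp (- ?\<phi> z))
          \<le> (LINT z|LD. Re (form_inner q (Levi_inv ?\<phi> q F z) (F z)) * exp (- ?\<phi> z))"
      and eq: "(LINT z|LD. Re (form_inner q (Levi_inv ?\<phi> q F z) (F z)) * exp (- ?\<phi> z))
          = 1 / (a * real q) * (LINT z|LD. form_normsq q (F z) * exp (- ?\<phi> z))"
      \<comment> \<open>The choice b = 1 is immaterial: b only multiplies both sides of the estimate
        by exp b.\<close>
      using assms(8)[OF a zero_less_one refl sf ad cl] by blast
    have u': "u \<in> L2_forms D ?\<phi> q'" "dbar_eq D q' u F"
      "(LINT z|LD. form_normsq q' (u z) * exp (- ?\<phi> z)) \<le>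
        1 / (a * real (Suc q')) * (LINT z|LD. form_normsq (Suc q') (F z) * exp (- ?\<phi> z))"
      using u le[unfolded eq] unfolding q diff_Suc_1 .
    show ?thesis by (rule basic_inequality[OF cov sm bd a u'])
  qed
  have "0 \<le> Re (boundary_density z0 q' F p)"
  proof (rule concentration[OF p])
    show "r \<ge> 0" "norm (p - z0) = r" using r(1) norm_grad[OF p] by (auto simp: z0_def)
    show "smooth (\<lambda>z. Re (curvature_rest q' F z))" by (intro smooth_Re smooth_curvature_rest sm)
    show "smooth (\<lambda>z. Re (boundary_density z0 q' F z))" by (intro smooth_Re smooth_boundary_density sm)
  qed (use r(2) ineq z0_def in auto)
  also have "boundary_density z0 q' F p =
      of_real (2 * r) * of_real ((\<Sum>l<Suc q'. \<mu> l) * form_normsq (Suc q') W)"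
    using boundary_density_at_frontier[of p q' \<xi> r, OF p tang] levi_form_wedge[OF \<xi>, folded W_def]
    unfolding F_def[symmetric] z0_def[symmetric] Fp by simp
  finally have "0 \<le> 2 * r * (sum_mset M * form_normsq (Suc q') W)"
    unfolding \<mu> by (simp flip: of_real_mult)
  then show "sum_mset M \<ge> 0"
    using r(1) form_normsq_wedge_pos[OF \<xi>(2,3), folded W_def] by (simp add: zero_le_mult_iff)
qed

end
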